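(* Let $m\geq2$, $n\geq2$, $S=S_A$ a free profinite group and $N$ a closed normal subgroup of $S$ with $N\leq S_{n,\mathbb{Z}/m}$. Then: (a) the pairing $(\cdot,\cdot)'$ induces a perfect pairing $NS_{n+1,\mathbb{Z}/m}/S_{n+1,\mathbb{Z}/m}\times H^2(S/N)_{n\text{-Massey}}\to\mathbb{Z}/m$, given by $(\sigma S_{n+1,\mathbb{Z}/m},\alpha)\mapsto(\sigma N^m[S,N],\alpha)'$ for $\sigma\in N$; (b) the sequence $0\to H^2(S/N)_{n\text{-Massey}}\hookrightarrow H^2(S/N)\xrightarrow{\inf}H^2(S/(N\cap S_{n+1,\mathbb{Z}/m}))$ is exact.
   Context: $S_A$ is the free profinite group on $A$; $\Lambda\colon S\to(\mathbb{Z}/m)\langle\langle X_A\rangle\rangle^\times$ the continuous Magnus homomorphism $a\mapsto1+X_a$ into formal power series in non-commuting variables; $S_{k,\mathbb{Z}/m}$ is the set of $\sigma$ such that $\Lambda(\sigma)$ has zero coefficients at all words of length $1,\dots,k-1$. Cohomology $H^i(\Gamma)=H^i(\Gamma,\mathbb{Z}/m)$ with trivial action, via continuous inhomogeneous cochains, $(\partial c)(\sigma,\tau)=c(\sigma)+c(\tau)-c(\sigma\tau)$, $(c\cup c')(\sigma,\tau)=c(\sigma)c'(\tau)$. A defining system of size $n$ is $c_{ij}\in C^1$, $1\le i\le j\le n$, $(i,j)\ne(1,n)$, with $\partial c_{ij}=\widetilde c_{ij}:=-\sum_{r=i}^{j-1}c_{ir}\cup c_{r+1,j}$; the class of the 2-cocycle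 $\widetilde c_{1n}$ is an $n$-fold Massey product, and $H^2(\Gamma)_{n\text{-Massey}}$ is the subgroup generated by them. Since $N\le S^m[S,S]$ and $H^2(S)=0$, the transgression $\operatorname{trg}\colon H^1(N)^S\to H^2(S/N)$ is an isomorphism and $(\sigma N^m[S,N],\alpha)'=(\operatorname{trg}^{-1}(\alpha))(\sigma)$ defines a bilinear map $N/N^m[S,N]\times H^2(S/N)\to\mathbb{Z}/m$. *)

theory Defs
  imports
    "HOL-Algebra.Exact_Sequence"
    "HOL-Analysis.Analysis"
    "Berlekamp_Zassenhaus.Finite_Field"
begin

text \<open>
  The ring \<open>\<int>/m\<close> is the type \<open>'m mod_ring\<close> with \<open>m = CARD('m)\<close>; the sort \<open>nontriv\<close> says exactly
  that \<open>m \<ge> 2\<close>. It carries the discrete topology.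
\<close>

subsection \<open>Topological groups\<close>

record 'a top_group = "'a monoid" + topol :: "'a topology"

definition topological_group :: "'a top_group \<Rightarrow> bool" where
  "topological_group G \<longleftrightarrow> group G \<and> topspace (topol G) = carrier G \<and>
     continuous_map (prod_topology (topol G) (topol G)) (topol G) (\<lambda>(x, y). x \<otimes>\<^bsub>G\<^esub> y) \<and>
     continuous_map (topol G) (topol G) (\<lambda>x. inv\<^bsub>G\<^esub> x)"

definition profinite_group :: "'a top_group \<Rightarrow> bool" where
  "profinite_group G \<longleftrightarrow> topological_group G \<and> compact_space (topol G) \<and> Hausdorff_space (topol G) \<and>
     (\<forall>C. connectedin (topol G) C \<longrightarrow> (\<forall>x\<in>C. \<forall>y\<in>C. x = y))"

definition top_subgroup :: "'a top_group \<Rightarrow> 'a set \<Rightarrow> 'a top_group" where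
  "top_subgroup G H = G\<lparr>carrier := H, topol := subtopology (topol G) H\<rparr>"

definition quotient_topology :: "'a top_group \<Rightarrow> 'a set \<Rightarrow> 'a set topology" where
  "quotient_topology G N = topology (\<lambda>V. V \<subseteq> carrier (G Mod N) \<and>
     openin (topol G) {x \<in> topspace (topol G). N #>\<^bsub>G\<^esub> x \<in> V})"

lemma openin_quotient_topology:
  "openin (quotient_topology G N) V \<longleftrightarrow> V \<subseteq> carrier (G Mod N) \<and>
     openin (topol G) {x \<in> topspace (topol G). N #>\<^bsub>G\<^esub> x \<in> V}"
proof -
  have "istopology (\<lambda>V. V \<subseteq> carrier (G Mod N) \<and>
     openin (topol G) {x \<in> topspace (topol G). N #>\<^bsub>G\<^esub> x \<in> V})"
    unfolding istopology_def
  proof (intro conjI allI impI)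
    fix S T
    assume S: "S \<subseteq> carrier (G Mod N) \<and> openin (topol G) {x \<in> topspace (topol G). N #>\<^bsub>G\<^esub> x \<in> S}"
      and T: "T \<subseteq> carrier (G Mod N) \<and> openin (topol G) {x \<in> topspace (topol G). N #>\<^bsub>G\<^esub> x \<in> T}"
    have "{x \<in> topspace (topol G). N #>\<^bsub>G\<^esub> x \<in> S \<inter> T} =
      {x \<in> topspace (topol G). N #>\<^bsub>G\<^esub> x \<in> S} \<inter> {x \<in> topspace (topol G). N #>\<^bsub>G\<^esub> x \<in> T}"
      by blast
    then show "openin (topol G) {x \<in> topspace (topol G). N #>\<^bsub>G\<^esub> x \<in> S \<inter> T}"
      using S T by (simp add: openin_Int)
    show "S \<inter> T \<subseteq> carrier (G Mod N)" using S by blast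
  next
    fix K
    assume K: "\<forall>V\<in>K. V \<subseteq> carrier (G Mod N) \<and>
      openin (topol G) {x \<in> topspace (topol G). N #>\<^bsub>G\<^esub> x \<in> V}"
    have "{x \<in> topspace (topol G). N #>\<^bsub>G\<^esub> x \<in> \<Union>K} =
      (\<Union>V\<in>K. {x \<in> topspace (topol G). N #>\<^bsub>G\<^esub> x \<in> V})"
      by blast
    then show "openin (topol G) {x \<in> topspace (topol G). N #>\<^bsub>G\<^esub> x \<in> \<Union>K}"
      using K by auto
    show "\<Union>K \<subseteq> carrier (G Mod N)" using K by blast
  qed
  then show ?thesis by (simp add: quotient_topology_def topology_inverse')
qed

definition quotient_group :: "'a top_group \<Rightarrow> 'a set \<Rightarrow> 'a set top_group" where
  "quotient_group G N = \<lparr>carrier = carrier (G Mod N), monoid.mult = monoid.mult (G Mod N),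
     one = one (G Mod N), topol = quotient_topology G N\<rparr>"

subsection \<open>Free profinite groups\<close>

definition converges_to_one :: "'a set \<Rightarrow> ('a \<Rightarrow> 'b) \<Rightarrow> 'b top_group \<Rightarrow> bool" where
  "converges_to_one A \<phi> G \<longleftrightarrow>
     (\<forall>U. openin (topol G) U \<and> \<one>\<^bsub>G\<^esub> \<in> U \<longrightarrow> finite {a \<in> A. \<phi> a \<notin> U})"

text \<open>
  Free profinite group with (possibly infinite) basis \<open>A\<close>, in the usual sense of bases converging
  to 1. As HOL cannot quantify over types inside a formula, the universal property is stated for the
  profinite groups \<open>G\<close> whose carrier lives in the type \<open>'a list \<Rightarrow> nat\<close>. This is no restriction: a
  profinite group topologically generated by a set of cardinality \<open>\<kappa>\<close> converging to 1 has at most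
  \<open>2 ^ max \<kappa> \<aleph>\<^sub>0\<close> elements, which is at most the cardinality of that type if \<open>\<kappa> \<le> \<bar>A\<bar>\<close>, so up
  to isomorphism every profinite group generated by an image of \<open>A\<close> converging to 1 occurs.
\<close>

definition free_profinite_group :: "'a set \<Rightarrow> 'a top_group \<Rightarrow> bool" where
  "free_profinite_group A S \<longleftrightarrow> profinite_group S \<and> A \<subseteq> carrier S \<and>
     converges_to_one A (\<lambda>a. a) S \<and> topol S closure_of (generate S A) = carrier S \<and>
     (\<forall>(G :: ('a list \<Rightarrow> nat) top_group) \<phi>.
        profinite_group G \<and> \<phi> \<in> A \<rightarrow> carrier G \<and> converges_to_one A \<phi> G \<longrightarrow>
        (\<exists>h \<in> hom S G. continuous_map (topol S) (topol G) h \<and> (\<forall>a\<in>A. h a = \<phi> a)))"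

subsection \<open>Magnus homomorphism\<close>

text \<open>A formal power series in the non-commuting variables \<open>X\<^sub>a\<close>, \<open>a \<in> A\<close>, is the family of its
  coefficients, indexed by the words in \<open>A\<close> and set to 0 at all other lists.\<close>

definition power_series_ring :: "'a set \<Rightarrow> ('a list \<Rightarrow> 'm::nontriv mod_ring) ring" where
  "power_series_ring A = \<lparr>carrier = {f. \<forall>w. w \<notin> lists A \<longrightarrow> f w = 0},
     monoid.mult = (\<lambda>f g w. \<Sum>i\<le>length w. f (take i w) * g (drop i w)),
     one = (\<lambda>w. if w = [] then 1 else 0),
     zero = (\<lambda>w. 0),
     add = (\<lambda>f g w. f w + g w)\<rparr>"

definition series_var :: "'a \<Rightarrow> 'a list \<Rightarrow> 'm::nontriv mod_ring" where
  "series_var a = (\<lambda>w. if w = [a] then 1 else 0)"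

definition series_topology :: "'a set \<Rightarrow> ('a list \<Rightarrow> 'm::nontriv mod_ring) topology" where
  "series_topology A = subtopology (product_topology (\<lambda>_. discrete_topology UNIV) UNIV)
     (carrier (power_series_ring A))"

definition magnus :: "'a set \<Rightarrow> 'a top_group \<Rightarrow> 'a \<Rightarrow> 'a list \<Rightarrow> 'm::nontriv mod_ring" where
  "magnus A S = (THE \<Lambda>. \<Lambda> \<in> extensional (carrier S) \<and> \<Lambda> \<in> hom S (units_of (power_series_ring A)) \<and>
     continuous_map (topol S) (series_topology A) \<Lambda> \<and>
     (\<forall>a\<in>A. \<Lambda> a = \<one>\<^bsub>power_series_ring A\<^esub> \<oplus>\<^bsub>power_series_ring A\<^esub> series_var a))"

text \<open>\<open>magnus_filtration TYPE('m) A S k\<close> is \<open>S\<^bsub>k,\<int>/m\<^esub>\<close>.\<close>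

definition magnus_filtration :: "'m::nontriv itself \<Rightarrow> 'a set \<Rightarrow> 'a top_group \<Rightarrow> nat \<Rightarrow> 'a set" where
  "magnus_filtration _ A S k = {\<sigma> \<in> carrier S. \<forall>w \<in> lists A. 1 \<le> length w \<and> length w < k \<longrightarrow>
     (magnus A S :: 'a \<Rightarrow> 'a list \<Rightarrow> 'm mod_ring) \<sigma> w = 0}"

subsection \<open>Cohomology with coefficients in \<open>\<int>/m\<close>\<close>

text \<open>Cochains are normalised to be 0 outside the group. The coboundary on \<open>C\<^sup>0\<close> vanishes because the
  action is trivial, so \<open>H\<^sup>1 = Z\<^sup>1\<close>.\<close>

definition cochains1 :: "'a top_group \<Rightarrow> ('a \<Rightarrow> 'm::nontriv mod_ring) set" where
  "cochains1 G = {c. continuous_map (topol G) (discrete_topology UNIV) c \<and>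
     (\<forall>x. x \<notin> carrier G \<longrightarrow> c x = 0)}"

definition cochains2 :: "'a top_group \<Rightarrow> ('a \<times> 'a \<Rightarrow> 'm::nontriv mod_ring) set" where
  "cochains2 G = {z. continuous_map (prod_topology (topol G) (topol G)) (discrete_topology UNIV) z \<and>
     (\<forall>p. p \<notin> carrier G \<times> carrier G \<longrightarrow> z p = 0)}"

definition coboundary :: "'a top_group \<Rightarrow> ('a \<Rightarrow> 'm::nontriv mod_ring) \<Rightarrow> 'a \<times> 'a \<Rightarrow> 'm mod_ring" where
  "coboundary G c = (\<lambda>(x, y). if x \<in> carrier G \<and> y \<in> carrier G
     then c x + c y - c (x \<otimes>\<^bsub>G\<^esub> y) else 0)"

definition cup :: "('a \<Rightarrow> 'm::nontriv mod_ring) \<Rightarrow> ('a \<Rightarrow> 'm mod_ring) \<Rightarrow> 'a \<times> 'a \<Rightarrow> 'm mod_ring" where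
  "cup c c' = (\<lambda>(x, y). c x * c' y)"

definition H1 :: "'a top_group \<Rightarrow> ('a \<Rightarrow> 'm::nontriv mod_ring) set" where
  "H1 G = {c \<in> cochains1 G. coboundary G c = (\<lambda>_. 0)}"

definition Z2 :: "'a top_group \<Rightarrow> ('a \<times> 'a \<Rightarrow> 'm::nontriv mod_ring) monoid" where
  "Z2 G = \<lparr>carrier = {z \<in> cochains2 G. \<forall>x\<in>carrier G. \<forall>y\<in>carrier G. \<forall>t\<in>carrier G.
       z (y, t) - z (x \<otimes>\<^bsub>G\<^esub> y, t) + z (x, y \<otimes>\<^bsub>G\<^esub> t) - z (x, y) = 0},
     monoid.mult = (\<lambda>z z' p. z p + z' p), one = (\<lambda>p. 0)\<rparr>"

definition B2 :: "'a top_group \<Rightarrow> ('a \<times> 'a \<Rightarrow> 'm::nontriv mod_ring) set" where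
  "B2 G = coboundary G ` cochains1 G"

definition H2 :: "'a top_group \<Rightarrow> ('a \<times> 'a \<Rightarrow> 'm::nontriv mod_ring) set monoid" where
  "H2 G = Z2 G Mod B2 G"

definition H2_class :: "'a top_group \<Rightarrow> ('a \<times> 'a \<Rightarrow> 'm::nontriv mod_ring)
    \<Rightarrow> ('a \<times> 'a \<Rightarrow> 'm mod_ring) set" where
  "H2_class G z = B2 G #>\<^bsub>Z2 G\<^esub> z"

definition pullback2 :: "'a top_group \<Rightarrow> ('a \<Rightarrow> 'b) \<Rightarrow> ('b \<times> 'b \<Rightarrow> 'm::nontriv mod_ring)
    \<Rightarrow> 'a \<times> 'a \<Rightarrow> 'm mod_ring" where
  "pullback2 G f z = (\<lambda>(x, y). if x \<in> carrier G \<and> y \<in> carrier G then z (f x, f y) else 0)"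

text \<open>All sets in the following union coincide when \<open>f\<close> is a continuous homomorphism.\<close>

definition H2_map :: "'a top_group \<Rightarrow> ('a \<Rightarrow> 'b) \<Rightarrow> ('b \<times> 'b \<Rightarrow> 'm::nontriv mod_ring) set
    \<Rightarrow> ('a \<times> 'a \<Rightarrow> 'm mod_ring) set" where
  "H2_map G f \<alpha> = (\<Union>z\<in>\<alpha>. H2_class G (pullback2 G f z))"

text \<open>Inflation \<open>H\<^sup>2(S/N) \<rightarrow> H\<^sup>2(S/M)\<close> for \<open>M \<le> N\<close>; the map \<open>S/M \<rightarrow> S/N\<close> sends a coset \<open>C\<close> to \<open>NC\<close>.\<close>

definition inflation :: "'a top_group \<Rightarrow> 'a set \<Rightarrow> 'a set
    \<Rightarrow> ('a set \<times> 'a set \<Rightarrow> 'm::nontriv mod_ring) set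
    \<Rightarrow> ('a set \<times> 'a set \<Rightarrow> 'm mod_ring) set" where
  "inflation S N M = H2_map (quotient_group S M) (\<lambda>C. N <#>\<^bsub>S\<^esub> C)"

subsection \<open>Massey products\<close>

definition massey_cochain :: "(nat \<Rightarrow> nat \<Rightarrow> 'a \<Rightarrow> 'm::nontriv mod_ring) \<Rightarrow> nat \<Rightarrow> nat
    \<Rightarrow> 'a \<times> 'a \<Rightarrow> 'm mod_ring" where
  "massey_cochain c i j = (\<lambda>p. - (\<Sum>r = i..<j. cup (c i r) (c (r + 1) j) p))"

definition defining_system :: "'a top_group \<Rightarrow> nat
    \<Rightarrow> (nat \<Rightarrow> nat \<Rightarrow> 'a \<Rightarrow> 'm::nontriv mod_ring) \<Rightarrow> bool" where
  "defining_system G n c \<longleftrightarrow> (\<forall>i j. 1 \<le> i \<and> i \<le> j \<and> j \<le> n \<and> (i, j) \<noteq> (1, n) \<longrightarrow>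
     c i j \<in> cochains1 G \<and> coboundary G (c i j) = massey_cochain c i j)"

definition H2_massey :: "'a top_group \<Rightarrow> nat \<Rightarrow> ('a \<times> 'a \<Rightarrow> 'm::nontriv mod_ring) set monoid" where
  "H2_massey G n = (H2 G)\<lparr>carrier :=
     generate (H2 G) {H2_class G (massey_cochain c 1 n) | c. defining_system G n c}\<rparr>"

subsection \<open>Transgression and the pairing\<close>

definition H1_invariant :: "'a top_group \<Rightarrow> 'a set \<Rightarrow> ('a \<Rightarrow> 'm::nontriv mod_ring) set" where
  "H1_invariant S N = {\<psi> \<in> H1 (top_subgroup S N).
     \<forall>\<sigma>\<in>carrier S. \<forall>x\<in>N. \<psi> (inv\<^bsub>S\<^esub> \<sigma> \<otimes>\<^bsub>S\<^esub> x \<otimes>\<^bsub>S\<^esub> \<sigma>) = \<psi> x}"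

text \<open>\<open>trg \<psi>\<close> is the class of any cocycle of \<open>S/N\<close> whose inflation to \<open>S\<close> is the coboundary of a
  continuous cochain on \<open>S\<close> extending \<open>\<psi>\<close>.\<close>

definition transgression :: "'a top_group \<Rightarrow> 'a set \<Rightarrow> ('a \<Rightarrow> 'm::nontriv mod_ring)
    \<Rightarrow> ('a set \<times> 'a set \<Rightarrow> 'm mod_ring) set" where
  "transgression S N \<psi> = (THE \<alpha>. \<exists>y \<in> cochains1 S. \<exists>z \<in> carrier (Z2 (quotient_group S N)).
     (\<forall>x\<in>N. y x = \<psi> x) \<and> coboundary S y = pullback2 S (\<lambda>\<sigma>. N #>\<^bsub>S\<^esub> \<sigma>) z \<and>
     \<alpha> = H2_class (quotient_group S N) z)"

text \<open>The closed subgroup \<open>N\<^sup>m[S,N]\<close>.\<close>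

definition power_commutator_subgroup :: "nat \<Rightarrow> 'a top_group \<Rightarrow> 'a set \<Rightarrow> 'a set" where
  "power_commutator_subgroup m S N = topol S closure_of generate S
     ({x [^]\<^bsub>S\<^esub> m | x. x \<in> N} \<union>
      {\<sigma> \<otimes>\<^bsub>S\<^esub> x \<otimes>\<^bsub>S\<^esub> inv\<^bsub>S\<^esub> \<sigma> \<otimes>\<^bsub>S\<^esub> inv\<^bsub>S\<^esub> x | \<sigma> x. \<sigma> \<in> carrier S \<and> x \<in> N})"

text \<open>The first argument is a coset of \<open>N\<^sup>m[S,N]\<close> in \<open>N\<close>, on which \<open>trg\<^sup>-\<^sup>1(\<alpha>)\<close> is constant.\<close>

definition trg_pairing :: "'a top_group \<Rightarrow> 'a set \<Rightarrow> 'a set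
    \<Rightarrow> ('a set \<times> 'a set \<Rightarrow> 'm::nontriv mod_ring) set \<Rightarrow> 'm mod_ring" where
  "trg_pairing S N C \<alpha> =
     (THE r. \<forall>\<sigma>\<in>C. inv_into (H1_invariant S N) (transgression S N) \<alpha> \<sigma> = r)"

subsection \<open>Perfect pairings\<close>

definition additive_Zmod :: "'m::nontriv mod_ring monoid" where
  "additive_Zmod = \<lparr>carrier = UNIV, monoid.mult = (+), one = 0\<rparr>"

text \<open>
  Perfectness of a pairing between a topological group \<open>A\<close> and a discrete group \<open>B\<close> is meant in the
  sense of Pontryagin duality: it is bilinear and continuous, and the induced homomorphisms
  \<open>A \<rightarrow> Hom(B, \<int>/m)\<close> and \<open>B \<rightarrow> Hom\<^sub>c\<^sub>o\<^sub>n\<^sub>t(A, \<int>/m)\<close> are bijective. (With abstract homomorphisms on \<open>A\<close> the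
  second map cannot be surjective when \<open>A\<close> is infinite.)
\<close>

definition perfect_pairing :: "'a top_group \<Rightarrow> 'b monoid \<Rightarrow> ('a \<Rightarrow> 'b \<Rightarrow> 'm::nontriv mod_ring) \<Rightarrow> bool" where
  "perfect_pairing A B P \<longleftrightarrow>
     (\<forall>a\<in>carrier A. P a \<in> hom B additive_Zmod) \<and>
     (\<forall>b\<in>carrier B. (\<lambda>a. P a b) \<in> hom A additive_Zmod \<and>
        continuous_map (topol A) (discrete_topology UNIV) (\<lambda>a. P a b)) \<and>
     (\<forall>f \<in> hom B additive_Zmod. \<exists>!a. a \<in> carrier A \<and> (\<forall>b\<in>carrier B. P a b = f b)) \<and>
     (\<forall>g \<in> hom A additive_Zmod. continuous_map (topol A) (discrete_topology UNIV) g \<longrightarrow>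
        (\<exists>!b. b \<in> carrier B \<and> (\<forall>a\<in>carrier A. P a b = g a)))"

end

theory Submission
  imports Defs "HOL-Algebra.SndIsomorphismGrp"
begin

text \<open>
  Since \<open>S\<close> is free, every 2-cocycle of \<open>S/N\<close> becomes a coboundary \<open>\<partial>y\<close> on \<open>S\<close>, and the class is the
  transgression of \<open>y|\<^sub>N\<close>. For a word \<open>w\<close> of length \<open>n\<close> the Magnus coefficients at the subwords of \<open>w\<close>
  form a defining system, defined on \<open>S/N\<close> except for the coefficient \<open>\<epsilon>\<^sub>w\<close> at \<open>w\<close> itself; so
  \<open>trg (\<epsilon>\<^sub>w|\<^sub>N)\<close> is a Massey product. Conversely a defining system on \<open>S/N\<close> lifts to a unitriangular
  representation of \<open>S\<close>. Any such representation is determined by its values \<open>1 + M\<^sub>a\<close> on the basis, hence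
  is \<open>\<sigma> \<mapsto> \<Sum>\<^sub>v \<Lambda>(\<sigma>)\<^sub>v M\<^sub>v\<close>, and on \<open>N \<le> S\<^sub>n\<close> only the words of length \<open>n\<close> contribute to the corner entry. Thus the
  Massey subgroup is the image under \<open>trg\<close> of the span \<open>E\<close> of the \<open>\<epsilon>\<^sub>w|\<^sub>N\<close>. These coefficients cut out
  \<open>N \<inter> S\<^sub>n\<^sub>+\<^sub>1\<close> in \<open>N\<close>; by compactness and the self-injectivity of \<open>\<int>/m\<close>, \<open>E\<close> consists of all continuous
  homomorphisms on \<open>N\<close> that vanish on \<open>N \<inter> S\<^sub>n\<^sub>+\<^sub>1\<close> and is dual to \<open>N/(N \<inter> S\<^sub>n\<^sub>+\<^sub>1)\<close>. On the other hand
  \<open>trg \<psi>\<close> inflates to 0 on \<open>S/(N \<inter> S\<^sub>n\<^sub>+\<^sub>1)\<close> iff \<open>\<psi>\<close> vanishes on \<open>N \<inter> S\<^sub>n\<^sub>+\<^sub>1\<close>.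
\<close>

subsection \<open>Linear algebra over \<open>\<int>/m\<close>\<close>

text \<open>It enters in two forms: a functional that sees only finitely many coordinates is a
  linear combination of them, and a vector that satisfies every linear relation valid on a subgroup
  lies in that subgroup. The basis \<open>A\<close> may be infinite, and linear algebra handles only
  finite sets of words. Convergence of the basis to 1 keeps every expansion of a locally constant
  function finite, and compactness of \<open>N\<close> passes from finite sets of words to all of
  them. The bound n \<ge> 2 puts \<open>N\<close> inside S_2, so every continuous homomorphism from
  \<open>S\<close> to \<open>\<int>/m\<close> vanishes on \<open>N\<close>. This is why trg(\<psi>)
  determines \<psi>, and why the triviality of an inflated class can be read off from \<psi> itself:
  two cochains on \<open>S\<close> with the same coboundary agree on \<open>N\<close>. Elements of
  \<open>E\<close> are defined on \<open>N\<close> only, whereas the first group of the pairing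
  consists of cosets in N S_{n+1}; the combinations of Magnus coefficients on all of
  \<open>S\<close> link the two, since they do not change under S_{n+1}.\<close>

lemma of_int_mod_ring_eq_0_iff:
  "(of_int z :: 'm::nontriv mod_ring) = 0 \<longleftrightarrow> int CARD('m) dvd z"
  unfolding of_int_of_int_mod_ring
  by transfer auto

lemma of_nat_mod_ring_eq_0_iff:
  "(of_nat k :: 'm::nontriv mod_ring) = 0 \<longleftrightarrow> CARD('m) dvd k"
  using of_int_mod_ring_eq_0_iff[of "int k", where 'm = 'm] by simp

lemma of_nat_card_mod_ring [simp]: "(of_nat CARD('m) :: 'm::nontriv mod_ring) = 0"
  by (simp add: of_nat_mod_ring_eq_0_iff)

lemma of_nat_nat_to_int_mod_ring: "of_nat (nat (to_int_mod_ring x)) = (x :: 'm::nontriv mod_ring)"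
  unfolding of_nat_of_int_mod_ring by transfer simp

lemma nat_to_int_mod_ring_less: "nat (to_int_mod_ring (x :: 'm::nontriv mod_ring)) < CARD('m)"
  by transfer auto

lemma nat_to_int_mod_ring_of_nat:
  "k < CARD('m) \<Longrightarrow> nat (to_int_mod_ring (of_nat k :: 'm::nontriv mod_ring)) = k"
  unfolding of_nat_of_int_mod_ring by (simp add: to_int_mod_ring_of_int_mod_ring)

text \<open>Baer's criterion for \<open>\<int>/m\<close>. With g = gcd(u, m), the multiple m/g
  annihilates u, hence t, so g divides t; Bezout's identity writes g as a multiple of u modulo
  m.\<close>

lemma mod_ring_multiple_of_annihilator:
  fixes u t :: "'m::nontriv mod_ring"
  assumes "\<And>k::nat. of_nat k * u = 0 \<Longrightarrow> of_nat k * t = 0"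
  shows "\<exists>c. t = c * u"
proof -
  define U T where "U = to_int_mod_ring u" and "T = to_int_mod_ring t"
  have u: "u = of_int U" and t: "t = of_int T"
    by (simp_all add: U_def T_def of_int_of_int_mod_ring)
  let ?m = "int CARD('m)"
  define g where "g = gcd U ?m"
  have m0: "?m > 0" by simp
  have g0: "g > 0" by (simp add: g_def)
  obtain k where k: "?m = g * k" unfolding g_def by (metis dvdE gcd_dvd2)
  have k0: "k > 0" using k m0 g0 by (metis zero_less_mult_pos)
  obtain U' where U': "U = g * U'" unfolding g_def by (metis dvdE gcd_dvd1)
  have "of_nat (nat k) * u = (0 :: 'm mod_ring)"
  proof -
    have "of_nat (nat k) * u = (of_int (k * U) :: 'm mod_ring)"
      using k0 by (simp add: u)
    moreover have "?m dvd k * U" using k U' by simp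
    ultimately show ?thesis by (simp only: of_int_mod_ring_eq_0_iff)
  qed
  then have "of_nat (nat k) * t = 0" by (rule assms)
  then have "(of_int (k * T) :: 'm mod_ring) = 0"
    using k0 by (simp add: t)
  then have "?m dvd k * T" by (simp only: of_int_mod_ring_eq_0_iff)
  then have "g dvd T" using k k0 by (simp add: mult.commute)
  then obtain T' where T': "T = g * T'" by blast
  obtain a b where ab: "a * U + b * ?m = g" unfolding g_def using bezout_int by blast
  have "T = (T' * a) * U + (T' * b) * ?m"
    unfolding T' by (subst ab[symmetric]) (simp add: algebra_simps)
  then have "t = of_int (T' * a) * u + of_int (T' * b) * of_nat CARD('m)"
    unfolding t u by (metis of_int_add of_int_mult of_int_of_nat_eq)
  then show ?thesis by auto
qed

text \<open>Closure under addition gives a submodule: the values lie in \<open>\<int>/m\<close>, so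
  negatives and all multiples are repeated sums.\<close>

locale coordinate_subgroup =
  fixes I :: "('w \<Rightarrow> 'm::nontriv mod_ring) set"
  assumes zero_mem: "(\<lambda>_. 0) \<in> I"
    and add_mem: "f \<in> I \<Longrightarrow> g \<in> I \<Longrightarrow> (\<lambda>w. f w + g w) \<in> I"
begin

lemma scale_mem: "f \<in> I \<Longrightarrow> (\<lambda>w. of_nat k * f w) \<in> I"
proof (induction k)
  case 0
  then show ?case using zero_mem by simp
next
  case (Suc k)
  then have "(\<lambda>w. f w + of_nat k * f w) \<in> I" by (intro add_mem)
  then show ?case by (simp add: algebra_simps)
qed

lemma uminus_mem: "f \<in> I \<Longrightarrow> (\<lambda>w. - f w) \<in> I"
  using scale_mem[of f "CARD('m) - 1"] by (simp add: of_nat_diff)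

lemma diff_mem: "f \<in> I \<Longrightarrow> g \<in> I \<Longrightarrow> (\<lambda>w. f w - g w) \<in> I"
  using add_mem[OF _ uminus_mem, of f g] by simp

lemma additive_scale:
  assumes add: "\<And>f g. f \<in> I \<Longrightarrow> g \<in> I \<Longrightarrow> \<phi> (\<lambda>w. f w + g w) = \<phi> f + (\<phi> g :: 'm mod_ring)"
    and f: "f \<in> I"
  shows "\<phi> (\<lambda>w. of_nat k * f w) = of_nat k * \<phi> f"
proof (induction k)
  case 0
  show ?case using add[OF zero_mem zero_mem] by simp
next
  case (Suc k)
  have "\<phi> (\<lambda>w. f w + of_nat k * f w) = \<phi> f + of_nat k * \<phi> f"
    using add[OF f scale_mem[OF f]] Suc by simp
  then show ?case by (simp add: algebra_simps)
qed

end

text \<open>This is the self-injectivity of \<open>\<int>/m\<close>.\<close>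

lemma additive_eq_linear_combination:
  fixes \<phi> :: "('w \<Rightarrow> 'm::nontriv mod_ring) \<Rightarrow> 'm mod_ring"
  assumes "finite F" and "coordinate_subgroup I"
    and "\<And>f g. f \<in> I \<Longrightarrow> g \<in> I \<Longrightarrow> \<phi> (\<lambda>w. f w + g w) = \<phi> f + \<phi> g"
    and "\<And>f. f \<in> I \<Longrightarrow> \<forall>w\<in>F. f w = 0 \<Longrightarrow> \<phi> f = 0"
  shows "\<exists>c. \<forall>f\<in>I. \<phi> f = (\<Sum>w\<in>F. c w * f w)"
  using assms
proof (induction F arbitrary: I rule: finite_induct)
  case empty
  then show ?case by auto
next
  case (insert v F)
  interpret coordinate_subgroup I by fact
  \<comment> \<open>Elements without a \<open>v\<close>-coordinate are governed by \<open>F\<close>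
    alone, so the induction hypothesis applies to them.\<close>
  define J where "J = {f \<in> I. f v = 0}"
  have "coordinate_subgroup J"
    by unfold_locales (auto simp: J_def zero_mem add_mem)
  then have "\<exists>c. \<forall>f\<in>J. \<phi> f = (\<Sum>w\<in>F. c w * f w)"
    by (rule insert.IH) (use insert.prems in \<open>auto simp: J_def\<close>)
  then obtain c where c: "\<And>f. f \<in> J \<Longrightarrow> \<phi> f = (\<Sum>w\<in>F. c w * f w)" by blast
  \<comment> \<open>What is left after subtracting this combination vanishes on \<open>J\<close>,
    hence depends on the coordinate at \<open>v\<close> only.\<close>
  define \<phi>' where "\<phi>' f = \<phi> f - (\<Sum>w\<in>F. c w * f w)" for f
  have add': "\<phi>' (\<lambda>w. f w + g w) = \<phi>' f + \<phi>' g" if "f \<in> I" "g \<in> I" for f g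
    using insert.prems(2)[OF that] by (simp add: \<phi>'_def algebra_simps sum.distrib)
  have van: "\<phi>' f = 0" if "f \<in> I" "f v = 0" for f
    using c[of f] that by (simp add: \<phi>'_def J_def)
  have "\<exists>d. \<forall>f\<in>I. \<phi>' f = d * f v"
  proof (cases "\<forall>f\<in>I. f v = 0")
    case True
    then show ?thesis using van by (intro exI[of _ 0]) auto
  next
    case False
    define P where "P f \<longleftrightarrow> f \<in> I \<and> f v \<noteq> 0" for f
    \<comment> \<open>The values at \<open>v\<close> form an ideal of \<open>\<int>/m\<close>. The
      nonzero value with the least representative generates it, by division with remainder.\<close>
    define f0 where "f0 = arg_min (\<lambda>f. nat (to_int_mod_ring (f v))) P"
    obtain f1 where "P f1" using False by (auto simp: P_def)
    then have P0: "P f0" and min: "\<And>f. P f \<Longrightarrow> nat (to_int_mod_ring (f0 v)) \<le> nat (to_int_mod_ring (f v))"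
      unfolding f0_def using arg_min_nat_lemma[of P f1 "\<lambda>f. nat (to_int_mod_ring (f v))"] by blast+
    have f0: "f0 \<in> I" using P0 by (simp add: P_def)
    define u where "u = nat (to_int_mod_ring (f0 v))"
    have f0v: "f0 v = of_nat u" by (simp add: u_def of_nat_nat_to_int_mod_ring)
    have u0: "u > 0" using P0 f0v by (auto simp: P_def intro: Nat.gr0I)
    have scale': "\<phi>' (\<lambda>w. of_nat k * f0 w) = of_nat k * \<phi>' f0" for k
      by (rule additive_scale[OF _ f0]) (rule add')
    have mult: "\<exists>q::nat. f v = of_nat q * f0 v \<and> \<phi>' f = of_nat q * \<phi>' f0" if f: "f \<in> I" for f
    proof -
      define k where "k = nat (to_int_mod_ring (f v))"
      have fv: "f v = of_nat k" by (simp add: k_def of_nat_nat_to_int_mod_ring)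
      define q r where "q = k div u" and "r = k mod u"
      have kqr: "k = q * u + r" by (simp add: q_def r_def)
      define g where "g = (\<lambda>w. f w - of_nat q * f0 w)"
      have g: "g \<in> I" unfolding g_def using diff_mem[OF f scale_mem[OF f0]] .
      have gv: "g v = of_nat r" by (simp add: g_def fv f0v kqr)
      have "k < CARD('m)" by (simp add: k_def nat_to_int_mod_ring_less)
      then have "r < CARD('m)" using kqr by linarith
      then have "nat (to_int_mod_ring (g v)) = r" by (simp add: gv nat_to_int_mod_ring_of_nat)
      moreover have "r < u" using u0 by (simp add: r_def)
      ultimately have "\<not> P g" using min[of g] by (auto simp: u_def)
      then have "g v = 0" using g by (simp add: P_def)
      then have "\<phi>' g = 0" using van g by blast
      have "\<phi>' f = \<phi>' (\<lambda>w. g w + of_nat q * f0 w)" by (simp add: g_def)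
      also have "\<dots> = \<phi>' g + \<phi>' (\<lambda>w. of_nat q * f0 w)"
        by (rule add'[OF g scale_mem[OF f0]])
      finally have "\<phi>' f = of_nat q * \<phi>' f0"
        using \<open>\<phi>' g = 0\<close> scale' by simp
      moreover have "f v = of_nat q * f0 v" using \<open>g v = 0\<close> by (simp add: g_def)
      ultimately show ?thesis by blast
    qed
    \<comment> \<open>A multiple of \<open>f0\<close> that is 0 at \<open>v\<close> lies in
      \<open>J\<close>, where \<open>\<phi>'\<close> vanishes: this is the annihilator
      condition.\<close>
    have "\<exists>d. \<phi>' f0 = d * f0 v"
    proof (rule mod_ring_multiple_of_annihilator)
      fix k :: nat
      assume "of_nat k * f0 v = 0"
      then have "\<phi>' (\<lambda>w. of_nat k * f0 w) = 0" using van[OF scale_mem[OF f0]] by simp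
      then show "of_nat k * \<phi>' f0 = 0" using scale' by simp
    qed
    then obtain d where d: "\<phi>' f0 = d * f0 v" ..
    show ?thesis
    proof (intro exI[of _ d] ballI)
      fix f assume "f \<in> I"
      then obtain q :: nat where "f v = of_nat q * f0 v" "\<phi>' f = of_nat q * \<phi>' f0"
        using mult by blast
      then show "\<phi>' f = d * f v" using d by (simp add: algebra_simps)
    qed
  qed
  then obtain d where d: "\<And>f. f \<in> I \<Longrightarrow> \<phi>' f = d * f v" by blast
  have "\<forall>f\<in>I. \<phi> f = (\<Sum>w\<in>insert v F. (c(v := d)) w * f w)"
  proof
    fix f assume f: "f \<in> I"
    have "(\<Sum>w\<in>F. (c(v := d)) w * f w) = (\<Sum>w\<in>F. c w * f w)"
      using insert.hyps by (intro sum.cong) auto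
    then show "\<phi> f = (\<Sum>w\<in>insert v F. (c(v := d)) w * f w)"
      using d[OF f] insert.hyps by (simp add: \<phi>'_def algebra_simps)
  qed
  then show ?case by (intro exI[of _ "c(v := d)"])
qed

text \<open>Let \<open>v\<close> have order k modulo \<open>I\<close> on the coordinates
  \<open>F\<close>, and let m = k l. The functional on the span of \<open>I\<close> and
  \<open>v\<close> that kills \<open>I\<close> and sends \<open>v\<close> to l is well defined, so
  by self-injectivity it is a linear combination. Orthogonality makes it vanish at \<open>v\<close>;
  thus l = 0 in \<open>\<int>/m\<close>, which forces k = 1.\<close>

lemma separate_from_subgroup:
  fixes v :: "'w \<Rightarrow> 'm::nontriv mod_ring"
  assumes F: "finite F" and "coordinate_subgroup I"
    and orth: "\<And>c. \<forall>f\<in>I. (\<Sum>w\<in>F. c w * f w) = 0 \<Longrightarrow> (\<Sum>w\<in>F. c w * v w) = 0"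
  shows "\<exists>f\<in>I. \<forall>w\<in>F. f w = v w"
proof -
  interpret coordinate_subgroup I by fact
  define J where "J j \<longleftrightarrow> (\<exists>f\<in>I. \<forall>w\<in>F. f w = of_nat j * v w)" for j :: nat
  define k where "k = (LEAST j. J j \<and> j > 0)"
  have Jm: "J CARD('m) \<and> CARD('m) > 0" using zero_mem by (auto simp: J_def)
  then have "J k \<and> k > 0" unfolding k_def by (rule LeastI)
  then have k: "J k" "k > 0" by auto
  have least: "k \<le> j" if "J j" "j > 0" for j
    unfolding k_def using that by (intro Least_le) simp
  obtain fk where fk: "fk \<in> I" "\<And>w. w \<in> F \<Longrightarrow> fk w = of_nat k * v w"
    using k by (auto simp: J_def)
  have div: "k dvd j" if "J j" for j
  proof -
    obtain f where f: "f \<in> I" "\<And>w. w \<in> F \<Longrightarrow> f w = of_nat j * v w" using \<open>J j\<close> by (auto simp: J_def)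
    have "J (j mod k)" unfolding J_def
    proof (intro bexI ballI)
      show "(\<lambda>w. f w - of_nat (j div k) * fk w) \<in> I"
        using diff_mem[OF f(1) scale_mem[OF fk(1)]] .
      fix w assume "w \<in> F"
      have "(of_nat j :: 'm mod_ring) = of_nat (j div k) * of_nat k + of_nat (j mod k)"
        by (metis div_mult_mod_eq of_nat_add of_nat_mult)
      then show "f w - of_nat (j div k) * fk w = of_nat (j mod k) * v w"
        by (simp add: f fk \<open>w \<in> F\<close> algebra_simps)
    qed
    then have "\<not> j mod k > 0" using least[of "j mod k"] mod_less_divisor[OF k(2), of j] by linarith
    then show ?thesis by (simp add: mod_greater_zero_iff_not_dvd)
  qed
  have "k dvd CARD('m)" using Jm div by blast
  then obtain l where l: "CARD('m) = k * l" by blast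
  \<comment> \<open>The graph of this functional, kept as a relation because a decomposition of
    \<open>g\<close> is not unique; \<open>uniq\<close> shows that the value is.\<close>
  define R :: "('w \<Rightarrow> 'm mod_ring) \<Rightarrow> 'm mod_ring \<Rightarrow> bool" where "R g t \<longleftrightarrow> (\<exists>f\<in>I. \<exists>j::nat. (\<forall>w\<in>F. g w = f w + of_nat j * v w) \<and> t = of_nat j * (of_nat l :: 'm mod_ring))" for g t
  have uniq: "t = t'" if "R g t" "R g t'" for g t t'
  proof -
    obtain f j where 1: "f \<in> I" "\<And>w. w \<in> F \<Longrightarrow> g w = f w + of_nat j * v w" "t = of_nat j * of_nat l"
      using \<open>R g t\<close> unfolding R_def by blast
    obtain f' j' where 2: "f' \<in> I" "\<And>w. w \<in> F \<Longrightarrow> g w = f' w + of_nat j' * v w" "t' = of_nat j' * of_nat l"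
      using \<open>R g t'\<close> unfolding R_def by blast
    \<comment> \<open>Multiplicities are natural numbers, so (m - 1) j plays the role of -j.\<close>
    have c: "(of_nat (CARD('m) - 1) :: 'm mod_ring) = -1" by (simp add: of_nat_diff)
    have "J (j' + (CARD('m) - 1) * j)" unfolding J_def
    proof (intro bexI ballI)
      show "(\<lambda>w. f w - f' w) \<in> I" using 1 2 diff_mem by blast
      fix w assume "w \<in> F"
      show "f w - f' w = of_nat (j' + (CARD('m) - 1) * j) * v w"
        using 1(2)[OF \<open>w \<in> F\<close>] 2(2)[OF \<open>w \<in> F\<close>] by (simp only: of_nat_add of_nat_mult c) (simp add: algebra_simps)
    qed
    then have "CARD('m) dvd (j' + (CARD('m) - 1) * j) * l"
      unfolding l using div by simp
    then have "(of_nat ((j' + (CARD('m) - 1) * j) * l) :: 'm mod_ring) = 0"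
      by (simp only: of_nat_mod_ring_eq_0_iff)
    then have "of_nat j' * of_nat l - of_nat j * (of_nat l :: 'm mod_ring) = 0"
      by (simp only: of_nat_add of_nat_mult c) (simp add: algebra_simps)
    then show ?thesis using 1 2 by simp
  qed
  define I' where "I' = {g. \<exists>t. R g t}"
  define \<phi> where "\<phi> g = (THE t. R g t)" for g
  have \<phi>: "\<phi> g = t" if "R g t" for g t
    unfolding \<phi>_def using uniq that by blast
  have addR: "R (\<lambda>w. g w + g' w) (t + t')" if "R g t" "R g' t'" for g g' t t'
  proof -
    obtain f j where 1: "f \<in> I" "\<And>w. w \<in> F \<Longrightarrow> g w = f w + of_nat j * v w" "t = of_nat j * of_nat l"
      using \<open>R g t\<close> unfolding R_def by blast
    obtain f' j' where 2: "f' \<in> I" "\<And>w. w \<in> F \<Longrightarrow> g' w = f' w + of_nat j' * v w" "t' = of_nat j' * of_nat l"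
      using \<open>R g' t'\<close> unfolding R_def by blast
    show ?thesis unfolding R_def
      by (rule bexI[OF _ add_mem[OF 1(1) 2(1)]], rule exI[of _ "j + j'"]) (simp add: 1 2 algebra_simps)
  qed
  have R_I: "R f 0" if "f \<in> I" for f
    unfolding R_def using that by (intro bexI[of _ f] exI[of _ "0::nat"]) auto
  have R_v: "R v (of_nat l)"
    unfolding R_def using zero_mem by (intro bexI[of _ "\<lambda>_. 0"] exI[of _ "1::nat"]) auto
  have "coordinate_subgroup I'"
  proof
    show "(\<lambda>_. 0) \<in> I'" using R_I zero_mem by (auto simp: I'_def)
    show "(\<lambda>w. f w + g w) \<in> I'" if "f \<in> I'" "g \<in> I'" for f g
      using that addR unfolding I'_def by blast
  qed
  then have "\<exists>c. \<forall>g\<in>I'. \<phi> g = (\<Sum>w\<in>F. c w * g w)"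
  proof (rule additive_eq_linear_combination[OF F])
    fix f g assume "f \<in> I'" "g \<in> I'"
    then show "\<phi> (\<lambda>w. f w + g w) = \<phi> f + \<phi> g" unfolding I'_def using addR \<phi> by blast
  next
    fix f assume "f \<in> I'" and z: "\<forall>w\<in>F. f w = 0"
    have "R f 0" unfolding R_def
      using zero_mem z by (intro bexI[of _ "\<lambda>_. 0"] exI[of _ "0::nat"]) auto
    then show "\<phi> f = 0" by (rule \<phi>)
  qed
  then obtain c where c: "\<And>g. g \<in> I' \<Longrightarrow> \<phi> g = (\<Sum>w\<in>F. c w * g w)" by blast
  have "(\<Sum>w\<in>F. c w * f w) = 0" if "f \<in> I" for f
    using c[of f] R_I[OF that] \<phi> by (auto simp: I'_def)
  then have "(\<Sum>w\<in>F. c w * v w) = 0" using orth by blast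
  then have "(of_nat l :: 'm mod_ring) = 0" using c[of v] R_v \<phi> by (auto simp: I'_def)
  then have "k * l dvd l" by (simp only: of_nat_mod_ring_eq_0_iff l)
  moreover have "l > 0" using l zero_less_card_finite[where 'a = 'm] by (intro Nat.gr0I) simp
  ultimately have "k = 1" by simp
  then show ?thesis using k by (auto simp: J_def)
qed

subsection \<open>Locally constant functions and profinite groups\<close>

abbreviation locally_const :: "'a topology \<Rightarrow> ('a \<Rightarrow> 'b) \<Rightarrow> bool" where
  "locally_const X \<equiv> continuous_map X (discrete_topology UNIV)"

lemma locally_const_iff:
  "locally_const X f \<longleftrightarrow> (\<forall>x\<in>topspace X. \<exists>U. openin X U \<and> x \<in> U \<and> (\<forall>y\<in>U. f y = f x))"
proof
  assume f: "locally_const X f"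
  show "\<forall>x\<in>topspace X. \<exists>U. openin X U \<and> x \<in> U \<and> (\<forall>y\<in>U. f y = f x)"
  proof
    fix x assume "x \<in> topspace X"
    moreover have "openin X {y \<in> topspace X. f y \<in> {f x}}"
      by (rule openin_continuous_map_preimage[OF f]) simp
    ultimately show "\<exists>U. openin X U \<and> x \<in> U \<and> (\<forall>y\<in>U. f y = f x)"
      by (intro exI[of _ "{y \<in> topspace X. f y \<in> {f x}}"]) auto
  qed
next
  assume *: "\<forall>x\<in>topspace X. \<exists>U. openin X U \<and> x \<in> U \<and> (\<forall>y\<in>U. f y = f x)"
  show "locally_const X f"
    unfolding continuous_map_def
  proof (intro conjI allI impI)
    fix V
    show "openin X {x \<in> topspace X. f x \<in> V}"
    proof (subst openin_subopen, intro ballI)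
      fix x assume x: "x \<in> {x \<in> topspace X. f x \<in> V}"
      then obtain U where U: "openin X U" "x \<in> U" "\<forall>y\<in>U. f y = f x" using * by blast
      then show "\<exists>T. openin X T \<and> x \<in> T \<and> T \<subseteq> {x \<in> topspace X. f x \<in> V}"
      proof (intro exI[of _ U] conjI subsetI)
        fix y assume "y \<in> U"
        then have "f y = f x" "y \<in> topspace X" using U openin_subset by blast+
        then show "y \<in> {x \<in> topspace X. f x \<in> V}" using x by simp
      qed (use U(1,2) in auto)
    qed
  qed simp
qed

lemma locally_const_compose2:
  assumes "locally_const X f" "locally_const X g"
  shows "locally_const X (\<lambda>x. h (f x) (g x))"
  unfolding locally_const_iff
proof
  fix x assume x: "x \<in> topspace X"
  let ?U = "{y \<in> topspace X. f y \<in> {f x}}" and ?V = "{y \<in> topspace X. g y \<in> {g x}}"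
  have "openin X (?U \<inter> ?V)"
    by (intro openin_Int openin_continuous_map_preimage[OF assms(1)]
        openin_continuous_map_preimage[OF assms(2)]) simp_all
  then show "\<exists>W. openin X W \<and> x \<in> W \<and> (\<forall>y\<in>W. h (f y) (g y) = h (f x) (g x))"
    using x by (intro exI[of _ "?U \<inter> ?V"]) auto
qed

lemma locally_const_const: "locally_const X (\<lambda>_. c)"
  by (rule continuous_map_const[THEN iffD2]) simp

lemma locally_const_compose1: "locally_const X f \<Longrightarrow> locally_const X (\<lambda>x. h (f x))"
  by (rule locally_const_compose2[of X f f "\<lambda>a b. h a"])

lemma locally_const_add: "locally_const X f \<Longrightarrow> locally_const X g \<Longrightarrow> locally_const X (\<lambda>x. f x + g x)"
  by (rule locally_const_compose2)

lemma locally_const_diff: "locally_const X f \<Longrightarrow> locally_const X g \<Longrightarrow> locally_const X (\<lambda>x. f x - g x)"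
  by (rule locally_const_compose2)

lemma locally_const_mult: "locally_const X f \<Longrightarrow> locally_const X g \<Longrightarrow> locally_const X (\<lambda>x. f x * g x)"
  by (rule locally_const_compose2)

lemma locally_const_uminus: "locally_const X f \<Longrightarrow> locally_const X (\<lambda>x. - f x)"
  by (rule locally_const_compose1)

lemma locally_const_sum:
  "(\<And>i. i \<in> I \<Longrightarrow> locally_const X (f i)) \<Longrightarrow> locally_const X (\<lambda>x. \<Sum>i\<in>I. f i x)"
proof (induction I rule: infinite_finite_induct)
  case (insert j I)
  have "locally_const X (\<lambda>x. f j x + (\<Sum>i\<in>I. f i x))"
    by (intro locally_const_add insert.IH insert.prems) auto
  then show ?case using insert.hyps by simp
qed simp_all

lemma locally_const_compose:
  "continuous_map X Y g \<Longrightarrow> locally_const Y f \<Longrightarrow> locally_const X (\<lambda>x. f (g x))"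
  using continuous_map_compose[of X Y g "discrete_topology UNIV" f] by (simp add: o_def)

lemma locally_const_cong:
  "locally_const X f \<Longrightarrow> (\<And>x. x \<in> topspace X \<Longrightarrow> f x = g x) \<Longrightarrow> locally_const X g"
  by (rule continuous_map_eq)

lemma locally_const_eq_on_closure:
  assumes "locally_const X f" "locally_const X g" "x \<in> Abstract_Topology.closure_of X D"
    and "\<And>x. x \<in> D \<Longrightarrow> f x = g x"
  shows "f x = g x"
  by (rule forall_in_closure_of_eq[OF assms(3) Hausdorff_space_discrete_topology assms(1,2,4)])

text \<open>In a compact Hausdorff space the quasi-components are the components, here single
  points. So each point outside \<open>U\<close> is separated from \<open>x\<close> by a clopen set,
  and compactness of the complement of \<open>U\<close> leaves finitely many of these to
  intersect.\<close>

lemma compact_Hausdorff_totally_disconnected_clopen: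
  assumes "compact_space X" "Hausdorff_space X"
    and td: "\<And>C x y. connectedin X C \<Longrightarrow> x \<in> C \<Longrightarrow> y \<in> C \<Longrightarrow> x = y"
    and U: "openin X U" "x \<in> U"
  shows "\<exists>V. openin X V \<and> closedin X V \<and> x \<in> V \<and> V \<subseteq> U"
proof -
  have x: "x \<in> topspace X" using U openin_subset by blast
  have lc: "locally_compact_space X" using assms(1) by (rule compact_imp_locally_compact_space)
  have "C \<in> quasi_components_of X \<longleftrightarrow> C \<in> connected_components_of X" for C
  proof -
    have "compactin X C" if "C \<in> quasi_components_of X \<or> C \<in> connected_components_of X"
      using that assms(1) closedin_quasi_components_of closedin_connected_components_of
        closedin_compact_space by blast
    then show ?thesis
      using compact_quasi_eq_connected_components_of[OF lc assms(2), of C] by blast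
  qed
  then have "quasi_components_of X = connected_components_of X" by blast
  then have eq: "quasi_component_of X x = connected_component_of X x"
    using x unfolding quasi_eq_connected_components_of_pointwise by blast
  have sep: "\<exists>T. x \<in> T \<and> closedin X T \<and> openin X T \<and> y \<notin> T" if y: "y \<in> topspace X - U" for y
  proof (rule ccontr)
    assume "\<nexists>T. x \<in> T \<and> closedin X T \<and> openin X T \<and> y \<notin> T"
    then have "quasi_component_of X x y"
      unfolding quasi_component_of_def using x y by blast
    then have "connected_component_of X x y" using eq by simp
    then have "x = y" unfolding connected_component_of_def using td by blast
    then show False using y U by blast
  qed
  then obtain T where T: "\<And>y. y \<in> topspace X - U \<Longrightarrow> x \<in> T y \<and> closedin X (T y) \<and> openin X (T y) \<and> y \<notin> T y"
    by metis
  have "compactin X (topspace X - U)"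
    by (rule closedin_compact_space[OF assms(1)]) (rule closedin_diff[OF closedin_topspace U(1)])
  then have "\<exists>F. finite F \<and> F \<subseteq> (\<lambda>y. topspace X - T y) ` (topspace X - U) \<and> topspace X - U \<subseteq> \<Union>F"
  proof (rule compactinD)
    show "openin X V" if "V \<in> (\<lambda>y. topspace X - T y) ` (topspace X - U)" for V
      using that T by blast
    show "topspace X - U \<subseteq> \<Union>((\<lambda>y. topspace X - T y) ` (topspace X - U))"
      using T by blast
  qed
  then obtain F where F: "finite F" "F \<subseteq> (\<lambda>y. topspace X - T y) ` (topspace X - U)" "topspace X - U \<subseteq> \<Union>F"
    by blast
  obtain Y where Y: "finite Y" "Y \<subseteq> topspace X - U" "topspace X - U \<subseteq> (\<Union>y\<in>Y. topspace X - T y)"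
    using finite_subset_image[OF F(1,2)] F(3) by blast
  define W where "W = (\<Union>y\<in>Y. topspace X - T y)"
  define V where "V = topspace X - W"
  have "openin X W" unfolding W_def using Y(2) T by (intro openin_Union) auto
  moreover have "closedin X W" unfolding W_def using Y(1,2) T by (intro closedin_Union) auto
  ultimately have "openin X V" "closedin X V"
    unfolding V_def by auto
  moreover have "x \<in> V" "V \<subseteq> U" unfolding V_def W_def using x Y T by blast+
  ultimately show ?thesis by blast
qed

section \<open>Topological groups and profinite groups\<close>

locale top_grp =
  fixes G :: "'a top_group" (structure)
  assumes topological_group: "topological_group G"
begin

sublocale group G using topological_group by (simp add: topological_group_def)

lemma topspace_eq [simp]: "topspace (topol G) = carrier G"
  using topological_group by (simp add: topological_group_def)

lemma continuous_mult: "continuous_map (prod_topology (topol G) (topol G)) (topol G) (\<lambda>(x, y). x \<otimes> y)"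
  using topological_group by (simp add: topological_group_def)

lemma continuous_inv: "continuous_map (topol G) (topol G) (\<lambda>x. inv x)"
  using topological_group by (simp add: topological_group_def)

lemma continuous_mult':
  "continuous_map X (topol G) f \<Longrightarrow> continuous_map X (topol G) g \<Longrightarrow> continuous_map X (topol G) (\<lambda>x. f x \<otimes> g x)"
  using continuous_map_compose[OF continuous_map_pairedI continuous_mult] by (simp add: o_def)

lemma continuous_inv':
  "continuous_map X (topol G) f \<Longrightarrow> continuous_map X (topol G) (\<lambda>x. inv f x)"
  using continuous_map_compose[OF _ continuous_inv] by (simp add: o_def)

end

locale profinite_grp =
  fixes G :: "'a top_group" (structure)
  assumes profinite: "profinite_group G"
begin

sublocale top_grp using profinite by unfold_locales (simp add: profinite_group_def)

lemma compact: "compact_space (topol G)" and Hausdorff: "Hausdorff_space (topol G)"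
  and totally_disconnected: "connectedin (topol G) C \<Longrightarrow> x \<in> C \<Longrightarrow> y \<in> C \<Longrightarrow> x = y"
  using profinite by (auto simp: profinite_group_def)

text \<open>Openness of \<open>U\<close> is the tube lemma for the compact space \<open>G \<times> G\<close>.\<close>

lemma open_normal_invariance:
  assumes f: "locally_const (topol G) f"
  defines "U \<equiv> {x \<in> carrier G. \<forall>s\<in>carrier G. \<forall>t\<in>carrier G. f (s \<otimes> x \<otimes> t) = f (s \<otimes> t)}"
  shows "U \<lhd> G" "openin (topol G) U"
proof -
  have "subgroup U G"
  proof (rule subgroupI)
    show "U \<subseteq> carrier G" by (auto simp: U_def)
    show "U \<noteq> {}" using one_closed by (auto simp: U_def)
  next
    fix a assume a: "a \<in> U"
    then have ac: "a \<in> carrier G" by (auto simp: U_def)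
    show "inv a \<in> U" unfolding U_def
    proof (intro CollectI conjI ballI)
      fix s t assume st: "s \<in> carrier G" "t \<in> carrier G"
      have "f (s \<otimes> inv a \<otimes> a \<otimes> t) = f (s \<otimes> inv a \<otimes> t)"
        using a st ac by (simp add: U_def)
      then show "f (s \<otimes> inv a \<otimes> t) = f (s \<otimes> t)" using st ac by (simp add: m_assoc)
    qed (use ac in simp)
    fix b assume b: "b \<in> U"
    show "a \<otimes> b \<in> U" unfolding U_def
    proof (intro CollectI conjI ballI)
      fix s t assume st: "s \<in> carrier G" "t \<in> carrier G"
      have bc: "b \<in> carrier G" using b by (simp add: U_def)
      have "f (s \<otimes> (a \<otimes> b) \<otimes> t) = f ((s \<otimes> a) \<otimes> b \<otimes> t)" using st ac bc by (simp add: m_assoc)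
      also have "\<dots> = f (s \<otimes> a \<otimes> t)" using b st ac by (simp add: U_def)
      also have "\<dots> = f (s \<otimes> t)" using a st by (simp add: U_def)
      finally show "f (s \<otimes> (a \<otimes> b) \<otimes> t) = f (s \<otimes> t)" .
    qed (use a b in \<open>simp add: U_def\<close>)
  qed
  moreover have "x \<otimes> h \<otimes> inv x \<in> U" if x: "x \<in> carrier G" and h: "h \<in> U" for x h
    unfolding U_def
  proof (intro CollectI conjI ballI)
    have hc: "h \<in> carrier G" using h by (simp add: U_def)
    show "x \<otimes> h \<otimes> inv x \<in> carrier G" using x hc by simp
    fix s t assume st: "s \<in> carrier G" "t \<in> carrier G"
    have "f (s \<otimes> (x \<otimes> h \<otimes> inv x) \<otimes> t) = f ((s \<otimes> x) \<otimes> h \<otimes> (inv x \<otimes> t))"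
      using st x hc by (simp add: m_assoc)
    also have "\<dots> = f ((s \<otimes> x) \<otimes> (inv x \<otimes> t))" using h st x by (simp add: U_def)
    also have "(s \<otimes> x) \<otimes> (inv x \<otimes> t) = s \<otimes> t"
    proof -
      have "x \<otimes> (inv x \<otimes> t) = t" using m_assoc[of x "inv x" t] st x by simp
      then show ?thesis using st x by (simp add: m_assoc)
    qed
    finally show "f (s \<otimes> (x \<otimes> h \<otimes> inv x) \<otimes> t) = f (s \<otimes> t)" .
  qed
  ultimately show "U \<lhd> G" by (simp add: normal_inv_iff)
  let ?P = "prod_topology (prod_topology (topol G) (topol G)) (topol G)"
  let ?l = "\<lambda>p. f (fst (fst p) \<otimes> snd p \<otimes> snd (fst p))" and ?r = "\<lambda>p. f (fst (fst p) \<otimes> snd (fst p))"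
  define W where "W = {p \<in> topspace ?P. (?l p = ?r p) \<in> {True}}"
  have s: "continuous_map ?P (topol G) (\<lambda>p. fst (fst p))"
    using continuous_map_compose[OF continuous_map_fst continuous_map_fst] by (simp only: o_def)
  have t: "continuous_map ?P (topol G) (\<lambda>p. snd (fst p))"
    using continuous_map_compose[OF continuous_map_fst continuous_map_snd] by (simp only: o_def)
  have x: "continuous_map ?P (topol G) (\<lambda>p. snd p)"
    by (rule continuous_map_snd)
  have "locally_const ?P ?l" "locally_const ?P ?r"
    by (intro locally_const_compose[OF _ f] continuous_mult' s t x)+
  then have "locally_const ?P (\<lambda>p. ?l p = ?r p)" by (rule locally_const_compose2)
  then have W: "openin ?P W"
    unfolding W_def by (rule openin_continuous_map_preimage) simp
  have K: "compactin (prod_topology (topol G) (topol G)) (carrier G \<times> carrier G)"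
    using compact by (simp add: compactin_Times compact_space_def)
  show "openin (topol G) U"
  proof (subst openin_subopen, intro ballI)
    fix x assume x: "x \<in> U"
    then have "(carrier G \<times> carrier G) \<times> {x} \<subseteq> W" by (auto simp: W_def U_def)
    then obtain A B where AB: "openin (prod_topology (topol G) (topol G)) A" "openin (topol G) B"
      "carrier G \<times> carrier G \<subseteq> A" "x \<in> B" "A \<times> B \<subseteq> W"
      using tube_lemma_left[OF W K, of x] x by (auto simp: U_def)
    have "B \<subseteq> U"
    proof
      fix y assume y: "y \<in> B"
      have "((s, t), y) \<in> W" if "s \<in> carrier G" "t \<in> carrier G" for s t using AB y that by blast
      then show "y \<in> U" using y AB(2) openin_subset unfolding U_def W_def by fastforce
    qed
    then show "\<exists>T. openin (topol G) T \<and> x \<in> T \<and> T \<subseteq> U" using AB by blast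
  qed
qed

end

subsection \<open>Power series and the Magnus homomorphism\<close>

lemma topological_groupI:
  assumes "group G" "topspace (topol G) = carrier G"
    and "continuous_map (prod_topology (topol G) (topol G)) (topol G) (\<lambda>p. fst p \<otimes>\<^bsub>G\<^esub> snd p)"
    and "continuous_map (topol G) (topol G) (\<lambda>x. inv\<^bsub>G\<^esub> x)"
  shows "topological_group G"
  using assms by (simp add: topological_group_def case_prod_beta')

text \<open>Transport of structure along \<open>e\<close> frees the universal property from the type \<open>'a list \<Rightarrow> nat\<close>.\<close>

lemma free_profinite_group_lift:
  fixes G :: "'b top_group" and S :: "'a top_group" and e :: "'b \<Rightarrow> 'a list \<Rightarrow> nat"
  assumes free: "free_profinite_group A S" and G: "profinite_group G" and e: "inj_on e (carrier G)"
    and \<phi>: "\<phi> \<in> A \<rightarrow> carrier G" "converges_to_one A \<phi> G"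
  shows "\<exists>h\<in>hom S G. continuous_map (topol S) (topol G) h \<and> (\<forall>a\<in>A. h a = \<phi> a)"
proof -
  interpret G: profinite_grp G by unfold_locales (rule G)
  define g where "g = inv_into (carrier G) e"
  have ge [simp]: "g (e x) = x" if "x \<in> carrier G" for x
    using that e by (simp add: g_def)
  define G' :: "('a list \<Rightarrow> nat) top_group" where
    "G' = \<lparr>carrier = e ` carrier G, monoid.mult = \<lambda>x y. e (g x \<otimes>\<^bsub>G\<^esub> g y), one = e \<one>\<^bsub>G\<^esub>,
       topol = pullback_topology (e ` carrier G) g (topol G)\<rparr>"
  have G'_simps [simp]: "carrier G' = e ` carrier G" "x \<otimes>\<^bsub>G'\<^esub> y = e (g x \<otimes>\<^bsub>G\<^esub> g y)" "\<one>\<^bsub>G'\<^esub> = e \<one>\<^bsub>G\<^esub>" for x y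
    by (simp_all add: G'_def)
  have top': "topspace (topol G') = e ` carrier G"
    by (auto simp: G'_def topspace_pullback_topology)
  have group: "group G'"
  proof (rule groupI)
    fix x assume "x \<in> carrier G'"
    then obtain u where u: "u \<in> carrier G" "x = e u" by auto
    show "\<exists>y\<in>carrier G'. y \<otimes>\<^bsub>G'\<^esub> x = \<one>\<^bsub>G'\<^esub>"
      by (rule bexI[of _ "e (inv\<^bsub>G\<^esub> u)"]) (use u in simp_all)
  qed (auto simp: G.m_assoc)
  have g_cont: "continuous_map (topol G') (topol G) g"
    using continuous_map_pullback[OF continuous_map_id[of "topol G"], where A = "e ` carrier G" and f = g]
    by (simp add: G'_def)
  have into: "continuous_map X (topol G') (\<lambda>x. e (k x))" if k: "continuous_map X (topol G) k" for X :: "'c topology" and k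
    unfolding G'_def top_group.simps
  proof (rule continuous_map_pullback')
    have kc: "k x \<in> carrier G" if "x \<in> topspace X" for x
      using continuous_map_image_subset_topspace[OF k] that by auto
    show "continuous_map X (topol G) (g \<circ> (\<lambda>x. e (k x)))"
      by (rule continuous_map_eq[OF k]) (simp add: kc)
    show "topspace X \<subseteq> (\<lambda>x. e (k x)) -` e ` carrier G" using kc by auto
  qed
  have inv': "inv\<^bsub>G'\<^esub> x = e (inv\<^bsub>G\<^esub> (g x))" if "x \<in> carrier G'" for x
  proof (rule group.inv_equality[OF group])
    show "e (inv\<^bsub>G\<^esub> (g x)) \<otimes>\<^bsub>G'\<^esub> x = \<one>\<^bsub>G'\<^esub>" "x \<in> carrier G'" "e (inv\<^bsub>G\<^esub> (g x)) \<in> carrier G'"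
      using that by auto
  qed
  have "topological_group G'"
  proof (rule topological_groupI)
    have "continuous_map (prod_topology (topol G') (topol G')) (topol G) (\<lambda>p. g (fst p) \<otimes>\<^bsub>G\<^esub> g (snd p))"
      using continuous_map_compose[OF continuous_map_fst g_cont] continuous_map_compose[OF continuous_map_snd g_cont]
      by (intro G.continuous_mult') (simp_all only: o_def)
    from into[OF this] show "continuous_map (prod_topology (topol G') (topol G')) (topol G') (\<lambda>p. fst p \<otimes>\<^bsub>G'\<^esub> snd p)"
      by (simp only: G'_simps)
    show "continuous_map (topol G') (topol G') (\<lambda>x. inv\<^bsub>G'\<^esub> x)"
      by (rule continuous_map_eq[OF into[OF G.continuous_inv'[OF g_cont]]]) (simp add: top' inv' del: G'_simps(2))
  qed (use group top' in simp_all)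
  moreover have homeo: "topol G homeomorphic_space topol G'"
    unfolding homeomorphic_space_def homeomorphic_maps_def
    using into[OF continuous_map_id, unfolded id_def] g_cont by (intro exI[of _ e] exI[of _ g]) (auto simp: top')
  moreover have "x = y" if "connectedin (topol G') C" "x \<in> C" "y \<in> C" for C x y
  proof -
    have "g x = g y"
      using G.totally_disconnected[OF connectedin_continuous_map_image[OF g_cont that(1)]] that by blast
    moreover have "x \<in> e ` carrier G" "y \<in> e ` carrier G"
      using connectedin_subset_topspace[OF that(1)] that top' by auto
    ultimately show ?thesis by auto
  qed
  ultimately have "profinite_group G'"
    unfolding profinite_group_def
    using G.compact G.Hausdorff homeomorphic_compact_space[OF homeo] homeomorphic_Hausdorff_space[OF homeo] by blast
  moreover have "(\<lambda>a. e (\<phi> a)) \<in> A \<rightarrow> carrier G'" using \<phi> by auto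
  moreover have "converges_to_one A (\<lambda>a. e (\<phi> a)) G'"
    unfolding converges_to_one_def
  proof (intro allI impI)
    fix U assume U: "openin (topol G') U \<and> \<one>\<^bsub>G'\<^esub> \<in> U"
    define V where "V = {x \<in> topspace (topol G). e x \<in> U}"
    have "openin (topol G) V"
      unfolding V_def using U into[OF continuous_map_id, unfolded id_def] by (intro openin_continuous_map_preimage) auto
    moreover have "\<one>\<^bsub>G\<^esub> \<in> V" using U by (simp add: V_def)
    ultimately have "finite {a \<in> A. \<phi> a \<notin> V}" using \<phi>(2) by (simp add: converges_to_one_def)
    moreover have "{a \<in> A. e (\<phi> a) \<notin> U} \<subseteq> {a \<in> A. \<phi> a \<notin> V}" by (auto simp: V_def)
    ultimately show "finite {a \<in> A. e (\<phi> a) \<notin> U}" by (rule rev_finite_subset)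
  qed
  ultimately obtain h where h: "h \<in> hom S G'" "continuous_map (topol S) (topol G') h" "\<forall>a\<in>A. h a = e (\<phi> a)"
    using free unfolding free_profinite_group_def by blast
  have h_img: "\<exists>u\<in>carrier G. h x = e u" if "x \<in> carrier S" for x
    using hom_in_carrier[OF h(1) that] by (simp add: image_iff)
  show ?thesis
  proof (intro bexI conjI ballI)
    show "(\<lambda>x. g (h x)) \<in> hom S G"
    proof (rule homI)
      fix x assume x: "x \<in> carrier S"
      then show "g (h x) \<in> carrier G" using h_img[of x] by auto
      fix y assume y: "y \<in> carrier S"
      show "g (h (x \<otimes>\<^bsub>S\<^esub> y)) = g (h x) \<otimes>\<^bsub>G\<^esub> g (h y)"
        using h_img[OF x] h_img[OF y] hom_mult[OF h(1) x y] by auto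
    qed
    show "continuous_map (topol S) (topol G) (\<lambda>x. g (h x))"
      using continuous_map_compose[OF h(2) g_cont] by (simp only: o_def)
    show "g (h a) = \<phi> a" if "a \<in> A" for a using h(3) \<phi>(1) that by (simp add: Pi_iff)
  qed
qed

section \<open>Convolution of functions on words\<close>

definition convolution :: "('a list \<Rightarrow> 'r::comm_ring_1) \<Rightarrow> ('a list \<Rightarrow> 'r) \<Rightarrow> 'a list \<Rightarrow> 'r" where
  "convolution f g w = (\<Sum>i\<le>length w. f (take i w) * g (drop i w))"

definition series_one :: "'a list \<Rightarrow> 'r::comm_ring_1" where
  "series_one w = (if w = [] then 1 else 0)"

lemma convolution_Nil [simp]: "convolution f g [] = f [] * g []"
  by (simp add: convolution_def)

lemma series_one_Nil [simp]: "series_one [] = 1"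
  by (simp add: series_one_def)

lemma convolution_one_left [simp]: "convolution series_one f = f"
proof
  fix w
  have "convolution series_one f w = (\<Sum>i\<in>{0}. series_one (take i w) * f (drop i w))"
    unfolding convolution_def by (rule sum.mono_neutral_right) (auto simp: series_one_def)
  then show "convolution series_one f w = f w" by simp
qed

lemma convolution_one_right [simp]: "convolution f series_one = f"
proof
  fix w
  have "convolution f series_one w = (\<Sum>i\<in>{length w}. f (take i w) * series_one (drop i w))"
    unfolding convolution_def by (rule sum.mono_neutral_right) (auto simp: series_one_def)
  then show "convolution f series_one w = f w" by simp
qed

text \<open>Both sides sum over the ways to cut \<open>w\<close> into three consecutive pieces; the
  pairs of cuts j \<le> i are reindexed by the lengths of the first two pieces.\<close>

lemma convolution_assoc: "convolution (convolution f g) h = convolution f (convolution g h)"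
proof
  fix w :: "'a list"
  let ?n = "length w"
  have "convolution (convolution f g) h w =
      (\<Sum>i\<le>?n. \<Sum>j\<le>i. f (take j w) * g (take (i - j) (drop j w)) * h (drop i w))"
    unfolding convolution_def
  proof (rule sum.cong[OF refl])
    fix i assume "i \<in> {..?n}"
    then have len: "length (take i w) = i" by simp
    show "(\<Sum>j\<le>length (take i w). f (take j (take i w)) * g (drop j (take i w))) * h (drop i w) =
        (\<Sum>j\<le>i. f (take j w) * g (take (i - j) (drop j w)) * h (drop i w))"
      unfolding len sum_distrib_right by (rule sum.cong[OF refl]) (simp add: drop_take min_absorb1)
  qed
  also have "\<dots> = (\<Sum>(i, j)\<in>(SIGMA i:{..?n}. {..i}). f (take j w) * g (take (i - j) (drop j w)) * h (drop i w))"
    by (simp add: sum.Sigma)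
  also have "\<dots> = (\<Sum>(j, k)\<in>(SIGMA j:{..?n}. {..?n - j}). f (take j w) * g (take k (drop j w)) * h (drop (j + k) w))"
    by (rule sum.reindex_bij_witness[where i = "\<lambda>(j, k). (j + k, j)" and j = "\<lambda>(i, j). (j, i - j)"]) auto
  also have "\<dots> = (\<Sum>j\<le>?n. \<Sum>k\<le>?n - j. f (take j w) * g (take k (drop j w)) * h (drop (j + k) w))"
    by (simp add: sum.Sigma)
  also have "\<dots> = convolution f (convolution g h) w"
    unfolding convolution_def by (simp add: sum_distrib_left mult.assoc add.commute)
  finally show "convolution (convolution f g) h w = convolution f (convolution g h) w" .
qed

definition supported :: "'a set \<Rightarrow> ('a list \<Rightarrow> 'r::comm_ring_1) \<Rightarrow> bool" where
  "supported A f \<longleftrightarrow> (\<forall>w. w \<notin> lists A \<longrightarrow> f w = 0)"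

lemma supportedD: "supported A f \<Longrightarrow> w \<notin> lists A \<Longrightarrow> f w = 0"
  by (simp add: supported_def)

lemma supported_series_one: "supported A series_one"
  by (auto simp: supported_def series_one_def)

lemma take_or_drop_notin_lists: "w \<notin> lists A \<Longrightarrow> take i w \<notin> lists A \<or> drop i w \<notin> lists A"
  by (metis append_in_lists_conv append_take_drop_id)

lemma supported_convolution:
  assumes "supported A f" "supported A g"
  shows "supported A (convolution f g)"
  unfolding supported_def
proof (intro allI impI)
  fix w assume w: "w \<notin> lists A"
  show "convolution f g w = 0"
    unfolding convolution_def
  proof (rule sum.neutral, intro ballI)
    fix i
    show "f (take i w) * g (drop i w) = 0"
      using take_or_drop_notin_lists[OF w, of i] supportedD[OF assms(1)] supportedD[OF assms(2)] by fastforce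
  qed
qed

text \<open>The equation \<open>convolution f g = series_one\<close>, solved for \<open>g\<close>
  word by word under \<open>f [] = 1\<close>. The recursion descends because the sum starts at 1, so
  \<open>drop i w\<close> is shorter than \<open>w\<close>.\<close>

function series_inverse :: "('a list \<Rightarrow> 'r::comm_ring_1) \<Rightarrow> 'a list \<Rightarrow> 'r" where
  "series_inverse f w = (if w = [] then 1 else - (\<Sum>i\<in>{1..length w}. f (take i w) * series_inverse f (drop i w)))"
  by auto
termination by (relation "Wellfounded.measure (\<lambda>(f, w). length w)") auto

declare series_inverse.simps [simp del]

lemma series_inverse_Nil [simp]: "series_inverse f [] = 1"
  by (simp add: series_inverse.simps)

lemma convolution_series_inverse:
  fixes f :: "'a list \<Rightarrow> 'r::comm_ring_1"
  assumes "f [] = 1"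
  shows "convolution f (series_inverse f) = series_one"
proof
  fix w
  show "convolution f (series_inverse f) w = series_one w"
  proof (cases "w = []")
    case False
    have "convolution f (series_inverse f) w =
        f [] * series_inverse f w + (\<Sum>i\<in>{1..length w}. f (take i w) * series_inverse f (drop i w))"
      unfolding convolution_def by (simp add: atMost_atLeast0 sum.atLeast_Suc_atMost)
    also have "series_inverse f w = - (\<Sum>i\<in>{1..length w}. f (take i w) * series_inverse f (drop i w))"
      using False by (subst series_inverse.simps) simp
    finally show ?thesis using False assms by (simp add: series_one_def)
  qed (simp add: assms)
qed

text \<open>The right inverse of \<open>f\<close> has a right inverse of its own, and associativity
  identifies that one with \<open>f\<close>.\<close>

lemma convolution_series_inverse_left:
  assumes "f [] = 1"
  shows "convolution (series_inverse f) f = series_one"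
proof -
  let ?g = "series_inverse f"
  have g: "convolution ?g (series_inverse ?g) = series_one"
    by (rule convolution_series_inverse) simp
  have "f = convolution f (convolution ?g (series_inverse ?g))"
    by (simp add: g)
  also have "\<dots> = series_inverse ?g"
    by (simp add: convolution_series_inverse[where f = f, OF assms] flip: convolution_assoc)
  finally show ?thesis using g by simp
qed

lemma supported_series_inverse:
  assumes f: "supported A f"
  shows "supported A (series_inverse f)"
proof -
  have "w \<notin> lists A \<Longrightarrow> series_inverse f w = 0" for w
  proof (induction w rule: length_induct)
    case (1 w)
    have "(\<Sum>i\<in>{1..length w}. f (take i w) * series_inverse f (drop i w)) = 0"
    proof (rule sum.neutral, intro ballI)
      fix i assume i: "i \<in> {1..length w}"
      then have "length (drop i w) < length w" by auto
      then show "f (take i w) * series_inverse f (drop i w) = 0"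
        using 1(1)[rule_format, of "drop i w"] take_or_drop_notin_lists[OF 1(2), of i] supportedD[OF f]
        by fastforce
    qed
    moreover have "w \<noteq> []" using 1(2) by auto
    ultimately show ?case by (subst series_inverse.simps) simp
  qed
  then show ?thesis by (simp add: supported_def)
qed

text \<open>The units with constant term 1. They contain all 1 + X_a and form a closed subset of a
  power of the finite ring \<open>\<int>/m\<close>, hence a profinite group to which the universal
  property of \<open>S\<close> applies.\<close>

definition magnus_group :: "'a set \<Rightarrow> ('a list \<Rightarrow> 'm::nontriv mod_ring) top_group" where
  "magnus_group A = \<lparr>carrier = {f. f [] = 1 \<and> supported A f}, monoid.mult = convolution, one = series_one,
     topol = subtopology (product_topology (\<lambda>_. discrete_topology UNIV) UNIV) {f. f [] = 1 \<and> supported A f}\<rparr>"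

lemma magnus_group_simps [simp]:
  "f \<in> carrier (magnus_group A) \<longleftrightarrow> f [] = 1 \<and> supported A f"
  "f \<otimes>\<^bsub>magnus_group A\<^esub> g = convolution f g" "\<one>\<^bsub>magnus_group A\<^esub> = series_one"
  by (simp_all add: magnus_group_def)

lemma topspace_magnus_group: "topspace (topol (magnus_group A)) = carrier (magnus_group A)"
  by (auto simp: magnus_group_def)

lemma group_magnus_group: "group (magnus_group A)"
proof (rule groupI)
  fix x assume "x \<in> carrier (magnus_group A)"
  then show "\<exists>y\<in>carrier (magnus_group A). y \<otimes>\<^bsub>magnus_group A\<^esub> x = \<one>\<^bsub>magnus_group A\<^esub>"
    by (intro bexI[of _ "series_inverse x"]) (auto simp: convolution_series_inverse_left supported_series_inverse)
qed (auto simp: convolution_assoc supported_convolution supported_series_one)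

lemma inv_magnus_group: "f \<in> carrier (magnus_group A) \<Longrightarrow> inv\<^bsub>magnus_group A\<^esub> f = series_inverse f"
  by (rule group.inv_equality[OF group_magnus_group])
    (auto simp: convolution_series_inverse_left supported_series_inverse)

lemma continuous_map_magnus_group_iff:
  "continuous_map X (topol (magnus_group A)) k \<longleftrightarrow>
     (\<forall>w. locally_const X (\<lambda>x. k x w)) \<and> (\<forall>x\<in>topspace X. k x \<in> carrier (magnus_group A))"
  by (auto simp: magnus_group_def continuous_map_in_subtopology continuous_map_componentwise_UNIV)

lemma locally_const_convolution:
  assumes "\<And>w. locally_const X (\<lambda>x. k x w)" "\<And>w. locally_const X (\<lambda>x. l x w)"
  shows "locally_const X (\<lambda>x. convolution (k x) (l x) w)"
  unfolding convolution_def by (intro locally_const_sum locally_const_mult assms)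

lemma locally_const_series_inverse:
  assumes "\<And>w. locally_const X (\<lambda>x. k x w)"
  shows "locally_const X (\<lambda>x. series_inverse (k x) w)"
proof (induction w rule: length_induct)
  case (1 w)
  show ?case
  proof (cases "w = []")
    case False
    have "locally_const X (\<lambda>x. - (\<Sum>i\<in>{1..length w}. k x (take i w) * series_inverse (k x) (drop i w)))"
      using 1 False by (intro locally_const_uminus locally_const_sum locally_const_mult assms) auto
    then show ?thesis using False by (subst series_inverse.simps) simp
  qed simp
qed

lemma profinite_magnus_group: "profinite_group (magnus_group A :: ('a list \<Rightarrow> 'm::nontriv mod_ring) top_group)"
proof -
  let ?G = "magnus_group A :: ('a list \<Rightarrow> 'm mod_ring) top_group"
  note G = group_magnus_group[of A] and ctn = continuous_map_magnus_group_iff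
  interpret group ?G by (rule G)
  have coord: "locally_const (topol ?G) (\<lambda>f. f w)" for w
  proof -
    have "continuous_map (topol ?G) (topol ?G) (\<lambda>x. x)" using continuous_map_id by (simp add: id_def)
    then show ?thesis unfolding ctn by blast
  qed
  have coord2: "locally_const (prod_topology (topol ?G) (topol ?G)) (\<lambda>p. fst p w)"
    "locally_const (prod_topology (topol ?G) (topol ?G)) (\<lambda>p. snd p w)" for w
    using locally_const_compose[OF continuous_map_fst coord] locally_const_compose[OF continuous_map_snd coord] by blast+
  have "topological_group ?G"
  proof (rule topological_groupI)
    show "continuous_map (prod_topology (topol ?G) (topol ?G)) (topol ?G) (\<lambda>p. fst p \<otimes>\<^bsub>?G\<^esub> snd p)"
      unfolding ctn
    proof (intro conjI allI ballI)
      show "fst p \<otimes>\<^bsub>?G\<^esub> snd p \<in> carrier ?G" if "p \<in> topspace (prod_topology (topol ?G) (topol ?G))" for p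
        using that unfolding topspace_prod_topology topspace_magnus_group by (intro m_closed) auto
      show "locally_const (prod_topology (topol ?G) (topol ?G)) (\<lambda>p. (fst p \<otimes>\<^bsub>?G\<^esub> snd p) w)" for w
        unfolding magnus_group_simps by (intro locally_const_convolution coord2)
    qed
    have "continuous_map (topol ?G) (topol ?G) series_inverse"
      unfolding ctn using locally_const_series_inverse[where k = "\<lambda>x. x", OF coord]
      by (auto simp: topspace_magnus_group supported_series_inverse)
    then show "continuous_map (topol ?G) (topol ?G) (\<lambda>x. inv\<^bsub>?G\<^esub> x)"
      by (rule continuous_map_eq) (simp only: topspace_magnus_group inv_magnus_group)
  qed (rule G, rule topspace_magnus_group)
  moreover have "compact_space (topol ?G)"
  proof -
    \<comment> \<open>The carrier is a full product of finite discrete sets, so compactness is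
      Tychonoff's theorem.\<close>
    define Q where "Q w = (if w = [] then {1} else if w \<in> lists A then UNIV else {0} :: 'm mod_ring set)" for w
    have iff: "f \<in> carrier ?G \<longleftrightarrow> (\<forall>w. f w \<in> Q w)" for f
    proof
      assume f: "f \<in> carrier ?G"
      then have "supported A f" by simp
      with f show "\<forall>w. f w \<in> Q w" by (simp add: Q_def supportedD)
    next
      assume f: "\<forall>w. f w \<in> Q w"
      have "f [] = 1" using spec[OF f, of "[]"] by (simp add: Q_def)
      moreover have "f w = 0" if "w \<notin> lists A" for w
      proof -
        have "w \<noteq> []" using that by (intro notI) simp
        then show ?thesis using spec[OF f, of w] that by (simp add: Q_def)
      qed
      ultimately show "f \<in> carrier ?G" by (simp add: supported_def)
    qed
    have "carrier ?G = PiE UNIV Q"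
      unfolding PiE_UNIV_domain Pi_def by (simp only: iff set_eq_iff mem_Collect_eq UNIV_I simp_thms)
    moreover have "compactin (product_topology (\<lambda>_. discrete_topology UNIV) UNIV) (PiE UNIV Q)"
      unfolding compactin_PiE by (simp add: compactin_discrete_topology)
    ultimately show ?thesis unfolding magnus_group_def by (simp add: compact_space_subtopology)
  qed
  moreover have "Hausdorff_space (topol ?G)"
    unfolding magnus_group_def by (simp add: Hausdorff_space_subtopology Hausdorff_space_product_topology)
  moreover have "x = y" if C: "connectedin (topol ?G) C" "x \<in> C" "y \<in> C" for C x y
  proof
    fix w
    have "connectedin (discrete_topology UNIV) ((\<lambda>f. f w) ` C)"
      by (rule connectedin_continuous_map_image[OF coord C(1)])
    then obtain c where "(\<lambda>f. f w) ` C \<subseteq> {c}" unfolding connectedin_discrete_topology by blast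
    then show "x w = y w" using C by blast
  qed
  ultimately show ?thesis unfolding profinite_group_def by blast
qed

text \<open>A basic neighbourhood of 1 restricts finitely many coefficients, and 1 + X_a differs
  from 1 only at the word \<open>[a]\<close>.\<close>

lemma converges_to_one_magnus:
  "converges_to_one A (\<lambda>a w. if w = [] \<or> w = [a] then 1 else 0)
     (magnus_group A :: ('a list \<Rightarrow> 'm::nontriv mod_ring) top_group)"
  unfolding converges_to_one_def
proof (intro allI impI)
  let ?\<phi> = "\<lambda>a w. if w = [] \<or> w = [a] then 1 else 0 :: 'm mod_ring"
  fix U assume U: "openin (topol (magnus_group A)) U \<and> \<one>\<^bsub>magnus_group A\<^esub> \<in> (U :: ('a list \<Rightarrow> 'm mod_ring) set)"
  then obtain V where V: "openin (product_topology (\<lambda>_. discrete_topology UNIV) UNIV) V"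
    "U = V \<inter> carrier (magnus_group A)"
    unfolding magnus_group_def by (auto simp: openin_subtopology)
  have "series_one \<in> V" using U V by simp
  then obtain X where X: "series_one \<in> PiE UNIV X" "finite {i. X i \<noteq> (UNIV :: 'm mod_ring set)}" "PiE UNIV X \<subseteq> V"
    using product_topology_open_contains_basis[OF V(1) \<open>series_one \<in> V\<close>] unfolding topspace_discrete_topology by blast
  have "{a \<in> A. ?\<phi> a \<notin> U} \<subseteq> (\<lambda>a. [a]) -` {i. X i \<noteq> UNIV}"
  proof
    fix a assume a: "a \<in> {a \<in> A. ?\<phi> a \<notin> U}"
    have "?\<phi> a \<in> carrier (magnus_group A)" using a by (auto simp: supported_def)
    then have "?\<phi> a \<notin> PiE UNIV X" using a X V by blast
    moreover have "?\<phi> a w \<in> X w" if "X [a] = UNIV" for w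
      using X(1) that by (cases "w = [a]") (auto simp: PiE_def Pi_def series_one_def)
    ultimately show "a \<in> (\<lambda>a. [a]) -` {i. X i \<noteq> UNIV}" by (auto simp: PiE_def Pi_def)
  qed
  moreover have "finite ((\<lambda>a. [a]) -` {i. X i \<noteq> UNIV})"
    using X(2) by (rule finite_vimageI) (simp add: inj_on_def)
  ultimately show "finite {a \<in> A. ?\<phi> a \<notin> U}" by (rule finite_subset)
qed

lemma group_additive_Zmod: "group (additive_Zmod :: 'm::nontriv mod_ring monoid)"
proof (rule groupI)
  fix x :: "'m mod_ring"
  show "\<exists>y\<in>carrier additive_Zmod. y \<otimes>\<^bsub>additive_Zmod\<^esub> x = \<one>\<^bsub>additive_Zmod\<^esub>"
    by (rule bexI[of _ "- x"]) (simp_all add: additive_Zmod_def)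
qed (simp_all add: additive_Zmod_def add.assoc)

lemma hom_additive_Zmod_iff:
  "f \<in> hom G additive_Zmod \<longleftrightarrow> (\<forall>x\<in>carrier G. \<forall>y\<in>carrier G. f (x \<otimes>\<^bsub>G\<^esub> y) = f x + f y)"
  by (auto simp: hom_def additive_Zmod_def)

lemma convolution_singleton: "convolution f g [a] = f [] * g [a] + f [a] * g []"
  by (simp add: convolution_def)

section \<open>Continuous homomorphisms and cocycles on a free profinite group\<close>

locale free_profinite =
  fixes A :: "'a set" and S :: "'a top_group" (structure)
  assumes free: "free_profinite_group A S"
begin

sublocale profinite_grp S
  using free by unfold_locales (simp add: free_profinite_group_def)

lemma basis_subset: "A \<subseteq> carrier S"
  and basis_converges: "converges_to_one A (\<lambda>a. a) S"
  and basis_dense: "Abstract_Topology.closure_of (topol S) (generate S A) = carrier S"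
  using free unfolding free_profinite_group_def by blast+

text \<open>Both maps agree on the dense subgroup generated by \<open>A\<close>. The topology
  \<open>Y\<close> is kept apart from \<open>K\<close> because targets such as
  \<open>units_of (power_series_ring A)\<close> and \<open>additive_Zmod\<close> carry none of their
  own.\<close>

lemma hom_eqI:
  assumes K: "group K" and f: "f \<in> hom S K" and g: "g \<in> hom S K" and Y: "Hausdorff_space Y"
    and cont: "continuous_map (topol S) Y f" "continuous_map (topol S) Y g"
    and eq: "\<And>a. a \<in> A \<Longrightarrow> f a = g a" and x: "x \<in> carrier S"
  shows "f x = g x"
proof (rule forall_in_closure_of_eq[OF _ Y cont])
  show "x \<in> Abstract_Topology.closure_of (topol S) (generate S A)" using x basis_dense by simp
  interpret f: group_hom S K f using K f by (simp add: group_hom_def group_hom_axioms_def)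
  interpret g: group_hom S K g using K g by (simp add: group_hom_def group_hom_axioms_def)
  show "f y = g y" if "y \<in> generate S A" for y
    using that
  proof induction
    case (inv h)
    then show ?case using eq basis_subset by (simp add: subset_iff)
  next
    case (eng h1 h2)
    then show ?case using generate_in_carrier[OF basis_subset] by simp
  qed (simp_all add: eq)
qed

lemma monoid_power_series_ring: "monoid (power_series_ring A :: ('a list \<Rightarrow> 'm::nontriv mod_ring) ring)"
proof -
  have m: "x \<otimes>\<^bsub>power_series_ring A\<^esub> y = convolution x y" for x y :: "'a list \<Rightarrow> 'm mod_ring"
    by (simp add: power_series_ring_def convolution_def fun_eq_iff)
  have c: "carrier (power_series_ring A) = {f :: 'a list \<Rightarrow> 'm mod_ring. supported A f}"
    by (simp add: power_series_ring_def supported_def)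
  have o: "\<one>\<^bsub>power_series_ring A\<^esub> = (series_one :: 'a list \<Rightarrow> 'm mod_ring)"
    by (simp add: power_series_ring_def series_one_def fun_eq_iff)
  show ?thesis
    by (rule monoidI) (simp_all add: m c o supported_convolution supported_series_one convolution_assoc)
qed

lemma magnus_exists:
  "\<exists>\<Lambda> \<in> hom S (magnus_group A :: ('a list \<Rightarrow> 'm::nontriv mod_ring) top_group).
     continuous_map (topol S) (topol (magnus_group A)) \<Lambda> \<and>
     (\<forall>a\<in>A. \<Lambda> a = (\<lambda>w. if w = [] \<or> w = [a] then 1 else 0))"
proof (rule free_profinite_group_lift[OF free profinite_magnus_group])
  show "inj_on (\<lambda>f w. nat (to_int_mod_ring (f w :: 'm mod_ring))) (carrier (magnus_group A))"
  proof (rule inj_onI, rule ext)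
    fix f g :: "'a list \<Rightarrow> 'm mod_ring" and w
    assume "(\<lambda>w. nat (to_int_mod_ring (f w))) = (\<lambda>w. nat (to_int_mod_ring (g w)))"
    then show "f w = g w" by (metis of_nat_nat_to_int_mod_ring)
  qed
  show "(\<lambda>a w. if w = [] \<or> w = [a] then 1 else 0) \<in> A \<rightarrow> carrier (magnus_group A)"
    by (auto simp: supported_def)
qed (rule converges_to_one_magnus)

text \<open>Discharges the definite description in \<open>magnus\<close>. The lift to
  \<open>magnus_group\<close> is restricted to the carrier to make it extensional. A competitor is
  only known to take values in the units, so uniqueness is tested in the Hausdorff topology on all
  series.\<close>

lemma magnus_properties:
  fixes \<Lambda> :: "'a \<Rightarrow> 'a list \<Rightarrow> 'm::nontriv mod_ring"
  defines "\<Lambda> \<equiv> magnus A S"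
  shows "\<Lambda> \<in> hom S (magnus_group A)" "continuous_map (topol S) (topol (magnus_group A)) \<Lambda>"
    "a \<in> A \<Longrightarrow> \<Lambda> a = (\<lambda>w. if w = [] \<or> w = [a] then 1 else 0)"
proof -
  let ?R = "power_series_ring A :: ('a list \<Rightarrow> 'm mod_ring) ring"
  let ?M = "magnus_group A :: ('a list \<Rightarrow> 'm mod_ring) top_group"
  have m: "x \<otimes>\<^bsub>?R\<^esub> y = convolution x y" for x y
    by (simp add: power_series_ring_def convolution_def fun_eq_iff)
  have c: "carrier ?R = {f. supported A f}"
    by (simp add: power_series_ring_def supported_def)
  have o: "\<one>\<^bsub>?R\<^esub> = series_one"
    by (simp add: power_series_ring_def series_one_def fun_eq_iff)
  have M_Units: "f \<in> Units ?R" if "f \<in> carrier ?M" for f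
  proof -
    have "f [] = 1" "supported A f" using that by auto
    then show ?thesis unfolding Units_def m c o
      using convolution_series_inverse_left[of f] convolution_series_inverse[of f] supported_series_inverse[of A f]
      by blast
  qed
  interpret M: group ?M by (rule group_magnus_group)
  interpret R: monoid ?R by (rule monoid_power_series_ring)
  let ?P = "\<lambda>\<Lambda>. \<Lambda> \<in> extensional (carrier S) \<and> \<Lambda> \<in> hom S (units_of ?R) \<and>
     continuous_map (topol S) (series_topology A) \<Lambda> \<and>
     (\<forall>a\<in>A. \<Lambda> a = \<one>\<^bsub>?R\<^esub> \<oplus>\<^bsub>?R\<^esub> series_var a)"
  have gen: "\<one>\<^bsub>?R\<^esub> \<oplus>\<^bsub>?R\<^esub> series_var a = (\<lambda>w. if w = [] \<or> w = [a] then 1 else 0)" for a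
    by (auto simp: power_series_ring_def series_var_def fun_eq_iff)
  obtain h where h: "h \<in> hom S ?M" "continuous_map (topol S) (topol ?M) h"
    "\<And>a. a \<in> A \<Longrightarrow> h a = (\<lambda>w. if w = [] \<or> w = [a] then 1 else 0)"
    using magnus_exists by blast
  define L where "L = restrict h (carrier S)"
  have Lh: "L x = h x" if "x \<in> carrier S" for x using that by (simp add: L_def)
  have L: "L \<in> hom S ?M" "continuous_map (topol S) (topol ?M) L"
    "\<And>a. a \<in> A \<Longrightarrow> L a = (\<lambda>w. if w = [] \<or> w = [a] then 1 else 0)"
  proof -
    show "L \<in> hom S ?M"
    proof (rule homI)
      fix x assume x: "x \<in> carrier S"
      show "L x \<in> carrier ?M" using hom_in_carrier[OF h(1) x] Lh[OF x] by simp
      fix y assume y: "y \<in> carrier S"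
      show "L (x \<otimes> y) = L x \<otimes>\<^bsub>?M\<^esub> L y" using hom_mult[OF h(1) x y] x y by (simp add: Lh)
    qed
    show "continuous_map (topol S) (topol ?M) L" by (rule continuous_map_eq[OF h(2)]) (simp add: Lh)
    show "L a = (\<lambda>w. if w = [] \<or> w = [a] then 1 else 0)" if "a \<in> A" for a
      using that h(3) Lh basis_subset by auto
  qed
  have PL: "?P L"
  proof (intro conjI ballI)
    show "L \<in> hom S (units_of ?R)"
    proof (rule homI)
      fix x assume x: "x \<in> carrier S"
      show "L x \<in> carrier (units_of ?R)"
        using M_Units[OF hom_in_carrier[OF L(1) x]] by (simp add: units_of_carrier)
      fix y assume y: "y \<in> carrier S"
      show "L (x \<otimes> y) = L x \<otimes>\<^bsub>units_of ?R\<^esub> L y"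
        using hom_mult[OF L(1) x y] by (simp add: units_of_mult m)
    qed
    show "continuous_map (topol S) (series_topology A) L"
      using L(2) unfolding series_topology_def continuous_map_in_subtopology c magnus_group_def top_group.simps
      by (simp add: Pi_iff continuous_map_in_subtopology)
    show "L a = \<one>\<^bsub>?R\<^esub> \<oplus>\<^bsub>?R\<^esub> series_var a" if "a \<in> A" for a using L(3)[OF that] by (simp only: gen)
  qed (simp add: L_def)
  have uniq: "\<Lambda>' = L" if P: "?P \<Lambda>'" for \<Lambda>'
  proof (rule extensionalityI[where A = "carrier S"])
    show "\<Lambda>' \<in> extensional (carrier S)" "L \<in> extensional (carrier S)" using P by (auto simp: L_def)
    fix x assume x: "x \<in> carrier S"
    have H: "Hausdorff_space (series_topology A :: ('a list \<Rightarrow> 'm mod_ring) topology)"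
      unfolding series_topology_def by (simp add: Hausdorff_space_subtopology Hausdorff_space_product_topology)
    show "\<Lambda>' x = L x"
    proof (rule hom_eqI[OF R.units_group _ _ H _ _ _ x])
      show "\<Lambda>' \<in> hom S (units_of ?R)" "continuous_map (topol S) (series_topology A) \<Lambda>'" using P by blast+
      show "L \<in> hom S (units_of ?R)" "continuous_map (topol S) (series_topology A) L" using PL by blast+
      show "\<Lambda>' a = L a" if "a \<in> A" for a using P PL that by metis
    qed
  qed
  have "\<Lambda> = L" unfolding \<Lambda>_def magnus_def
    by (rule the_equality) (rule PL, rule uniq)
  then show "\<Lambda> \<in> hom S ?M" "continuous_map (topol S) (topol ?M) \<Lambda>"
    "a \<in> A \<Longrightarrow> \<Lambda> a = (\<lambda>w. if w = [] \<or> w = [a] then 1 else 0)"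
    using L by auto
qed

lemma magnus_mult:
  "\<sigma> \<in> carrier S \<Longrightarrow> \<tau> \<in> carrier S \<Longrightarrow>
     magnus A S (\<sigma> \<otimes> \<tau>) = convolution (magnus A S \<sigma>) (magnus A S \<tau> :: 'a list \<Rightarrow> 'm::nontriv mod_ring)"
  using hom_mult[OF magnus_properties(1)] by simp

lemma magnus_Nil [simp]:
  assumes "\<sigma> \<in> carrier S"
  shows "magnus A S \<sigma> [] = (1 :: 'm::nontriv mod_ring)"
  using hom_in_carrier[OF magnus_properties(1)[where 'm = 'm] assms] by simp

lemma magnus_outside:
  assumes "\<sigma> \<in> carrier S" "w \<notin> lists A"
  shows "magnus A S \<sigma> w = (0 :: 'm::nontriv mod_ring)"
proof -
  have "supported A (magnus A S \<sigma> :: 'a list \<Rightarrow> 'm mod_ring)"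
    using hom_in_carrier[OF magnus_properties(1)[where 'm = 'm] assms(1)] by simp
  then show ?thesis using assms(2) by (rule supportedD)
qed

lemma magnus_one: "magnus A S \<one> = (series_one :: 'a list \<Rightarrow> 'm::nontriv mod_ring)"
  using hom_one[OF magnus_properties(1) is_group group_magnus_group] by simp

lemma locally_const_magnus:
  "locally_const (topol S) (\<lambda>\<sigma>. magnus A S \<sigma> w :: 'm::nontriv mod_ring)"
  using magnus_properties(2) unfolding continuous_map_magnus_group_iff by blast

lemma finite_basis_support:
  assumes "locally_const (topol S) f"
  shows "finite {a \<in> A. f a \<noteq> f \<one>}"
proof -
  have "openin (topol S) {x \<in> topspace (topol S). f x \<in> {f \<one>}}"
    by (rule openin_continuous_map_preimage[OF assms]) simp
  then have "finite {a \<in> A. a \<notin> {x \<in> topspace (topol S). f x \<in> {f \<one>}}}"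
    using basis_converges unfolding converges_to_one_def by auto
  then show ?thesis by (rule rev_finite_subset) auto
qed

text \<open>The coefficient at a one-letter word is additive and is the indicator of that letter on
  the basis, so both sides are continuous homomorphisms that agree on \<open>A\<close>. Convergence
  of the basis to 1 makes the sum finite.\<close>

lemma additive_expansion:
  fixes c :: "'a \<Rightarrow> 'm::nontriv mod_ring"
  assumes cont: "locally_const (topol S) c"
    and add: "\<And>x y. x \<in> carrier S \<Longrightarrow> y \<in> carrier S \<Longrightarrow> c (x \<otimes> y) = c x + c y"
  defines "F \<equiv> {a \<in> A. c a \<noteq> 0}"
  shows "finite F" "\<sigma> \<in> carrier S \<Longrightarrow> c \<sigma> = (\<Sum>a\<in>F. c a * magnus A S \<sigma> [a])"
proof -
  have c1: "c \<one> = 0" using add[of \<one> \<one>] by simp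
  show fin: "finite F" using finite_basis_support[OF cont] by (simp add: F_def c1)
  assume \<sigma>: "\<sigma> \<in> carrier S"
  show "c \<sigma> = (\<Sum>a\<in>F. c a * magnus A S \<sigma> [a])"
  proof (rule hom_eqI[OF group_additive_Zmod _ _ Hausdorff_space_discrete_topology cont _ _ \<sigma>])
    show "c \<in> hom S additive_Zmod" by (simp add: hom_additive_Zmod_iff add)
    show "(\<lambda>\<sigma>. \<Sum>a\<in>F. c a * magnus A S \<sigma> [a]) \<in> hom S additive_Zmod"
      by (simp add: hom_additive_Zmod_iff magnus_mult convolution_singleton distrib_left sum.distrib)
    show "locally_const (topol S) (\<lambda>\<sigma>. \<Sum>a\<in>F. c a * magnus A S \<sigma> [a])"
      by (intro locally_const_sum locally_const_mult locally_const_const locally_const_magnus)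
    fix b assume b: "b \<in> A"
    have "(\<Sum>a\<in>F. c a * magnus A S b [a]) = (\<Sum>a\<in>F. if a = b then c a else 0)"
      by (rule sum.cong[OF refl]) (simp add: magnus_properties(3)[OF b])
    also have "\<dots> = c b" using fin b by (simp add: F_def)
    finally show "c b = (\<Sum>a\<in>F. c a * magnus A S b [a])" by simp
  qed
qed

text \<open>A continuous 2-cocycle \<open>z\<close> gives a profinite central extension of \<open>S\<close> by \<open>\<int>/m\<close>; by freeness
  it splits, and the first component of the splitting is a cochain with coboundary \<open>z\<close>.\<close>

lemma Z2_is_coboundary:
  fixes z :: "'a \<times> 'a \<Rightarrow> 'm::nontriv mod_ring"
  assumes z: "z \<in> carrier (Z2 S)"
  shows "\<exists>c\<in>cochains1 S. coboundary S c = z"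
proof -
  have z_cont: "locally_const (prod_topology (topol S) (topol S)) z"
    and z_out: "\<And>p. p \<notin> carrier S \<times> carrier S \<Longrightarrow> z p = 0"
    and z_coc: "\<And>x y t. x \<in> carrier S \<Longrightarrow> y \<in> carrier S \<Longrightarrow> t \<in> carrier S \<Longrightarrow>
      z (x, y) + z (x \<otimes> y, t) = z (y, t) + z (x, y \<otimes> t)"
    using z by (auto simp: Z2_def cochains2_def algebra_simps)
  have z1l: "z (\<one>, x) = z (\<one>, \<one>)" if "x \<in> carrier S" for x
    using z_coc[of \<one> \<one> x] that by simp
  \<comment> \<open>The sign of \<open>z\<close> is chosen so that the first component of a section
    has coboundary exactly \<open>z\<close>. As \<open>z\<close> need not be normalised, the
    identity has first component \<open>z (\<one>, \<one>)\<close>.\<close>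
  define E :: "('m mod_ring \<times> 'a) top_group" where
    "E = \<lparr>carrier = UNIV \<times> carrier S,
       monoid.mult = \<lambda>p q. (fst p + fst q - z (snd p, snd q), snd p \<otimes> snd q),
       one = (z (\<one>, \<one>), \<one>), topol = prod_topology (discrete_topology UNIV) (topol S)\<rparr>"
  have E_simps: "carrier E = UNIV \<times> carrier S" "p \<otimes>\<^bsub>E\<^esub> q = (fst p + fst q - z (snd p, snd q), snd p \<otimes> snd q)"
    "\<one>\<^bsub>E\<^esub> = (z (\<one>, \<one>), \<one>)" "topol E = prod_topology (discrete_topology UNIV) (topol S)" for p q
    by (simp_all add: E_def)
  define iE where "iE p = (z (inv (snd p), snd p) + z (\<one>, \<one>) - fst p, inv (snd p))" for p :: "'m mod_ring \<times> 'a"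
  have group: "group E"
  proof (rule groupI)
    fix p q r assume pqr: "p \<in> carrier E" "q \<in> carrier E" "r \<in> carrier E"
    then have c: "snd p \<in> carrier S" "snd q \<in> carrier S" "snd r \<in> carrier S" by (auto simp: E_simps)
    have "z (snd p \<otimes> snd q, snd r) = z (snd q, snd r) + z (snd p, snd q \<otimes> snd r) - z (snd p, snd q)"
      unfolding z_coc[OF c, symmetric] by simp
    then show "p \<otimes>\<^bsub>E\<^esub> q \<otimes>\<^bsub>E\<^esub> r = p \<otimes>\<^bsub>E\<^esub> (q \<otimes>\<^bsub>E\<^esub> r)"
      using c by (simp add: E_simps m_assoc)
  next
    fix p assume p: "p \<in> carrier E"
    show "\<one>\<^bsub>E\<^esub> \<otimes>\<^bsub>E\<^esub> p = p" using p z1l[of "snd p"] by (auto simp: E_simps)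
    show "\<exists>q\<in>carrier E. q \<otimes>\<^bsub>E\<^esub> p = \<one>\<^bsub>E\<^esub>"
      by (rule bexI[of _ "iE p"]) (use p in \<open>auto simp: E_simps iE_def\<close>)
  qed (auto simp: E_simps)
  have inv_E: "inv\<^bsub>E\<^esub> p = iE p" if "p \<in> carrier E" for p
    by (rule group.inv_equality[OF group]) (use that in \<open>auto simp: E_simps iE_def\<close>)
  have top: "topspace (topol E) = carrier E" by (simp add: E_simps)
  let ?E2 = "prod_topology (topol E) (topol E)"
  have fst_c: "locally_const (topol E) fst" and snd_c: "continuous_map (topol E) (topol S) snd"
    unfolding E_simps by (rule continuous_map_fst, rule continuous_map_snd)
  have f1: "locally_const ?E2 (\<lambda>p. fst (fst p))" "locally_const ?E2 (\<lambda>p. fst (snd p))"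
    by (rule locally_const_compose[OF continuous_map_fst fst_c], rule locally_const_compose[OF continuous_map_snd fst_c])
  have s1: "continuous_map ?E2 (topol S) (\<lambda>p. snd (fst p))" "continuous_map ?E2 (topol S) (\<lambda>p. snd (snd p))"
    using continuous_map_compose[OF continuous_map_fst snd_c] continuous_map_compose[OF continuous_map_snd snd_c]
    by (simp_all only: o_def)
  have "topological_group E"
  proof (rule topological_groupI[OF group top])
    show "continuous_map ?E2 (topol E) (\<lambda>p. fst p \<otimes>\<^bsub>E\<^esub> snd p)"
      unfolding E_simps(2) unfolding E_simps(4)[of ]
      by (intro continuous_map_pairedI locally_const_diff locally_const_add
          locally_const_compose[OF _ z_cont] continuous_mult' f1[unfolded E_simps(4)] s1[unfolded E_simps(4)])
    have "continuous_map (topol E) (topol E) iE"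
      unfolding iE_def[abs_def] unfolding E_simps(4)
      by (intro continuous_map_pairedI locally_const_diff locally_const_add locally_const_const
          locally_const_compose[OF _ z_cont] continuous_inv' fst_c[unfolded E_simps(4)] snd_c[unfolded E_simps(4)])
    then show "continuous_map (topol E) (topol E) (\<lambda>p. inv\<^bsub>E\<^esub> p)"
      by (rule continuous_map_eq) (simp only: top inv_E)
  qed
  moreover have "compact_space (topol E)"
    unfolding E_simps using compact by (simp add: compact_space_prod_topology compact_space_discrete_topology)
  moreover have "Hausdorff_space (topol E)"
    unfolding E_simps using Hausdorff by (simp add: Hausdorff_space_prod_topology)
  moreover have "p = q" if C: "connectedin (topol E) C" "p \<in> C" "q \<in> C" for C p q
  proof (rule prod_eqI)
    have "connectedin (discrete_topology UNIV) (fst ` C)"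
      by (rule connectedin_continuous_map_image[OF fst_c C(1)])
    then obtain c where "fst ` C \<subseteq> {c}" unfolding connectedin_discrete_topology by blast
    then show "fst p = fst q" using C by blast
    show "snd p = snd q"
      using totally_disconnected[OF connectedin_continuous_map_image[OF snd_c C(1)]] C by blast
  qed
  ultimately have "profinite_group E" unfolding profinite_group_def by blast
  then have "\<exists>h\<in>hom S E. continuous_map (topol S) (topol E) h \<and> (\<forall>a\<in>A. h a = (z (\<one>, \<one>), a))"
  proof (rule free_profinite_group_lift[OF free])
    \<comment> \<open>The extension embeds into functions on words: the empty word records the
      residue, the one-letter words mark the group element.\<close>
    let ?e = "\<lambda>(p :: 'm mod_ring \<times> 'a) w. if w = [] then nat (to_int_mod_ring (fst p)) else if w = [snd p] then 1 else 0"
    show "inj_on ?e (carrier E)"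
    proof (rule inj_onI)
      fix p q :: "'m mod_ring \<times> 'a" assume eq: "?e p = ?e q"
      have "nat (to_int_mod_ring (fst p)) = nat (to_int_mod_ring (fst q))"
        using fun_cong[OF eq, of "[]"] by simp
      then have "fst p = fst q" by (metis of_nat_nat_to_int_mod_ring)
      moreover have "snd p = snd q" using fun_cong[OF eq, of "[snd p]"] by (simp split: if_splits)
      ultimately show "p = q" by (rule prod_eqI)
    qed
    show "(\<lambda>a. (z (\<one>, \<one>), a)) \<in> A \<rightarrow> carrier E" using basis_subset by (auto simp: E_simps)
    \<comment> \<open>The lifts of the basis share the first component of the identity; this is what
      preserves convergence to 1.\<close>
    show "converges_to_one A (\<lambda>a. (z (\<one>, \<one>), a)) E"
      unfolding converges_to_one_def
    proof (intro allI impI)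
      fix U assume U: "openin (topol E) U \<and> \<one>\<^bsub>E\<^esub> \<in> U"
      then obtain V W where VW: "openin (topol S) W" "z (\<one>, \<one>) \<in> V" "\<one> \<in> W" "V \<times> W \<subseteq> U"
        unfolding E_simps openin_prod_topology_alt by blast
      then have "finite {a \<in> A. a \<notin> W}" using basis_converges unfolding converges_to_one_def by blast
      then show "finite {a \<in> A. (z (\<one>, \<one>), a) \<notin> U}"
        by (rule rev_finite_subset) (use VW in auto)
    qed
  qed
  then obtain h where h: "h \<in> hom S E" "continuous_map (topol S) (topol E) h" "\<And>a. a \<in> A \<Longrightarrow> h a = (z (\<one>, \<one>), a)"
    by blast
  have h_mult: "h (x \<otimes> y) = (fst (h x) + fst (h y) - z (snd (h x), snd (h y)), snd (h x) \<otimes> snd (h y))"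
    if "x \<in> carrier S" "y \<in> carrier S" for x y
    using hom_mult[OF h(1) that] by (simp add: E_simps)
  have snd_h: "snd (h x) = x" if x: "x \<in> carrier S" for x
  proof (rule hom_eqI[OF is_group _ _ Hausdorff _ continuous_map_id[unfolded id_def] _ x])
    show "(\<lambda>x. snd (h x)) \<in> hom S S"
    proof (rule homI)
      fix x y assume x: "x \<in> carrier S" and y: "y \<in> carrier S"
      show "snd (h x) \<in> carrier S" using hom_in_carrier[OF h(1) x] by (auto simp: E_simps)
      show "snd (h (x \<otimes> y)) = snd (h x) \<otimes> snd (h y)" using h_mult[OF x y] by simp
    qed
    show "(\<lambda>x. x) \<in> hom S S" by (rule homI) auto
    show "continuous_map (topol S) (topol S) (\<lambda>x. snd (h x))"
      using continuous_map_compose[OF h(2) snd_c] by (simp only: o_def)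
  qed (simp add: h(3))
  define c where "c x = (if x \<in> carrier S then fst (h x) else 0)" for x
  show ?thesis
  proof (rule bexI)
    have "locally_const (topol S) (\<lambda>x. fst (h x))" by (rule locally_const_compose[OF h(2) fst_c])
    then have "locally_const (topol S) c" by (rule locally_const_cong) (simp add: c_def)
    then show "c \<in> cochains1 S" by (simp add: cochains1_def c_def)
    show "coboundary S c = z"
    proof
      fix p
      show "coboundary S c p = z p"
        using h_mult snd_h z_out[of p] by (cases p) (auto simp: coboundary_def c_def)
    qed
  qed
qed

end

subsection \<open>Cohomology of quotient groups\<close>

lemma cochains1_iff: "c \<in> cochains1 G \<longleftrightarrow> locally_const (topol G) c \<and> (\<forall>x. x \<notin> carrier G \<longrightarrow> c x = 0)"
  by (simp add: cochains1_def)

lemma cochains2_iff: "z \<in> cochains2 G \<longleftrightarrow>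
    locally_const (prod_topology (topol G) (topol G)) z \<and> (\<forall>p. p \<notin> carrier G \<times> carrier G \<longrightarrow> z p = 0)"
  by (simp add: cochains2_def)

lemma cochains1_outside: "c \<in> cochains1 G \<Longrightarrow> x \<notin> carrier G \<Longrightarrow> c x = 0"
  by (simp add: cochains1_iff)

lemma cochains2_outside: "z \<in> cochains2 G \<Longrightarrow> p \<notin> carrier G \<times> carrier G \<Longrightarrow> z p = 0"
  unfolding cochains2_iff by blast

lemma cochains2_compose2:
  assumes z: "z \<in> cochains2 G" and z': "z' \<in> cochains2 G" and h: "h 0 0 = (0 :: 'm::nontriv mod_ring)"
  shows "(\<lambda>p. h (z p) (z' p)) \<in> cochains2 G"
  unfolding cochains2_iff
proof (intro conjI allI impI)
  show "locally_const (prod_topology (topol G) (topol G)) (\<lambda>p. h (z p) (z' p))"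
  proof (rule locally_const_compose2[where f = z and g = z' and h = h])
    show "locally_const (prod_topology (topol G) (topol G)) z" "locally_const (prod_topology (topol G) (topol G)) z'"
      using z z' unfolding cochains2_iff by blast+
  qed
  show "h (z p) (z' p) = 0" if "p \<notin> carrier G \<times> carrier G" for p
    using cochains2_outside[OF z that] cochains2_outside[OF z' that] h by simp
qed

lemma coboundary_apply:
  "x \<in> carrier G \<Longrightarrow> y \<in> carrier G \<Longrightarrow> coboundary G c (x, y) = c x + c y - c (x \<otimes>\<^bsub>G\<^esub> y)"
  by (simp add: coboundary_def)

lemma coboundary_outside: "p \<notin> carrier G \<times> carrier G \<Longrightarrow> coboundary G c p = 0"
  by (cases p) (auto simp: coboundary_def)

lemma pullback2_apply: "x \<in> carrier G \<Longrightarrow> y \<in> carrier G \<Longrightarrow> pullback2 G f z (x, y) = z (f x, f y)"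
  by (simp add: pullback2_def)

lemma pullback2_outside: "p \<notin> carrier G \<times> carrier G \<Longrightarrow> pullback2 G f z p = 0"
  by (cases p) (auto simp: pullback2_def)

lemma carrier_Z2_iff: "z \<in> carrier (Z2 G) \<longleftrightarrow> z \<in> cochains2 G \<and>
    (\<forall>x\<in>carrier G. \<forall>y\<in>carrier G. \<forall>t\<in>carrier G.
       z (x, y) + z (x \<otimes>\<^bsub>G\<^esub> y, t) = z (y, t) + z (x, y \<otimes>\<^bsub>G\<^esub> t))"
proof -
  have iff: "(a - b + c - d = 0) = (d + b = a + c)" for a b c d :: "'c::nontriv mod_ring"
    by (metis (no_types, lifting) add.commute add_diff_cancel_left' diff_add_eq diff_diff_add eq_iff_diff_eq_0)
  show ?thesis by (simp only: Z2_def partial_object.simps mem_Collect_eq iff)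
qed

lemma Z2_simps [simp]:
  "z \<otimes>\<^bsub>Z2 G\<^esub> z' = (\<lambda>p. z p + z' p)" "\<one>\<^bsub>Z2 G\<^esub> = (\<lambda>p. 0)"
  by (simp_all add: Z2_def)

lemma ext_on_pairs:
  assumes "\<And>p. p \<notin> X \<times> X \<Longrightarrow> f p = (0 :: 'b::zero)" "\<And>p. p \<notin> X \<times> X \<Longrightarrow> g p = 0"
    and "\<And>x y. x \<in> X \<Longrightarrow> y \<in> X \<Longrightarrow> f (x, y) = g (x, y)"
  shows "f = g"
proof
  fix p show "f p = g p" using assms by (cases "p \<in> X \<times> X") auto
qed

definition pullback1 :: "'a top_group \<Rightarrow> ('a \<Rightarrow> 'b) \<Rightarrow> ('b \<Rightarrow> 'm::nontriv mod_ring) \<Rightarrow> 'a \<Rightarrow> 'm mod_ring" where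
  "pullback1 G f c = (\<lambda>x. if x \<in> carrier G then c (f x) else 0)"

lemma pullback1_apply: "x \<in> carrier G \<Longrightarrow> pullback1 G f c x = c (f x)"
  by (simp add: pullback1_def)

section \<open>Second cohomology as cocycles modulo coboundaries\<close>

context top_grp
begin

lemma cochains1_add: "c \<in> cochains1 G \<Longrightarrow> d \<in> cochains1 G \<Longrightarrow> (\<lambda>x. c x + d x) \<in> cochains1 G"
  unfolding cochains1_iff by (simp add: locally_const_add)

lemma cochains1_diff: "c \<in> cochains1 G \<Longrightarrow> d \<in> cochains1 G \<Longrightarrow> (\<lambda>x. c x - d x) \<in> cochains1 G"
  unfolding cochains1_iff by (simp add: locally_const_diff)

lemma cochains1_zero: "(\<lambda>x. 0) \<in> cochains1 G"
  unfolding cochains1_iff by simp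

lemma coboundary_add: "coboundary G (\<lambda>x. c x + d x) = (\<lambda>p. coboundary G c p + coboundary G d p)"
  by (auto simp: coboundary_def fun_eq_iff)

lemma coboundary_diff: "coboundary G (\<lambda>x. c x - d x) = (\<lambda>p. coboundary G c p - coboundary G d p)"
  by (auto simp: coboundary_def fun_eq_iff)

lemma coboundary_zero: "coboundary G (\<lambda>x. 0) = (\<lambda>p. 0)"
  by (auto simp: coboundary_def fun_eq_iff)

lemma coboundary_in_Z2:
  assumes c: "c \<in> cochains1 G"
  shows "coboundary G c \<in> carrier (Z2 G)"
  unfolding carrier_Z2_iff
proof (intro conjI ballI)
  let ?X = "prod_topology (topol G) (topol G)"
  have cc: "locally_const (topol G) c" using c by (simp add: cochains1_iff)
  have "locally_const ?X (\<lambda>p. c (fst p) + c (snd p) - c (fst p \<otimes> snd p))"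
    by (intro locally_const_diff locally_const_add locally_const_compose[OF _ cc] continuous_mult'
        continuous_map_fst continuous_map_snd)
  then have "locally_const ?X (coboundary G c)"
    by (rule locally_const_cong) (auto simp: coboundary_def)
  then show "coboundary G c \<in> cochains2 G"
    by (simp add: cochains2_iff coboundary_outside)
  show "coboundary G c (x, y) + coboundary G c (x \<otimes> y, t) = coboundary G c (y, t) + coboundary G c (x, y \<otimes> t)"
    if "x \<in> carrier G" "y \<in> carrier G" "t \<in> carrier G" for x y t
    using that by (simp add: coboundary_apply m_assoc)
qed

lemma Z2_add_closed:
  assumes z: "z \<in> carrier (Z2 G)" and z': "z' \<in> carrier (Z2 G)"
  shows "(\<lambda>p. z p + z' p) \<in> carrier (Z2 G)"
  unfolding carrier_Z2_iff
proof (intro conjI ballI)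
  have "z \<in> cochains2 G" "z' \<in> cochains2 G" using z z' by (simp_all add: carrier_Z2_iff)
  then show "(\<lambda>p. z p + z' p) \<in> cochains2 G"
    by (rule cochains2_compose2) simp
  fix x y t assume xyt: "x \<in> carrier G" "y \<in> carrier G" "t \<in> carrier G"
  have "z (x, y) + z' (x, y) + (z (x \<otimes> y, t) + z' (x \<otimes> y, t)) =
      (z (x, y) + z (x \<otimes> y, t)) + (z' (x, y) + z' (x \<otimes> y, t))" by (simp add: algebra_simps)
  also have "z (x, y) + z (x \<otimes> y, t) = z (y, t) + z (x, y \<otimes> t)"
    using z xyt unfolding carrier_Z2_iff by blast
  also have "z' (x, y) + z' (x \<otimes> y, t) = z' (y, t) + z' (x, y \<otimes> t)"
    using z' xyt unfolding carrier_Z2_iff by blast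
  finally show "z (x, y) + z' (x, y) + (z (x \<otimes> y, t) + z' (x \<otimes> y, t)) =
      z (y, t) + z' (y, t) + (z (x, y \<otimes> t) + z' (x, y \<otimes> t))" by (simp add: algebra_simps)
qed

lemma Z2_zero_closed: "(\<lambda>p. 0) \<in> carrier (Z2 G)"
  unfolding carrier_Z2_iff cochains2_iff by simp

lemma Z2_scale_closed:
  assumes z: "z \<in> carrier (Z2 G)"
  shows "(\<lambda>p. a * z p) \<in> carrier (Z2 G)"
  unfolding carrier_Z2_iff
proof (intro conjI ballI)
  have "z \<in> cochains2 G" using z by (simp add: carrier_Z2_iff)
  from cochains2_compose2[OF this this, of "\<lambda>r s. a * r"] show "(\<lambda>p. a * z p) \<in> cochains2 G" by simp
  fix x y t assume xyt: "x \<in> carrier G" "y \<in> carrier G" "t \<in> carrier G"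
  have "z (x, y) + z (x \<otimes> y, t) = z (y, t) + z (x, y \<otimes> t)"
    using z xyt unfolding carrier_Z2_iff by blast
  then show "a * z (x, y) + a * z (x \<otimes> y, t) = a * z (y, t) + a * z (x, y \<otimes> t)"
    by (simp flip: distrib_left)
qed

lemma Z2_uminus_closed:
  assumes "z \<in> carrier (Z2 G)"
  shows "(\<lambda>p. - z p) \<in> carrier (Z2 G)"
  using Z2_scale_closed[OF assms, of "-1"] by simp

lemma Z2_diff_closed:
  assumes "z \<in> carrier (Z2 G)" "z' \<in> carrier (Z2 G)"
  shows "(\<lambda>p. z p - z' p) \<in> carrier (Z2 G)"
  using Z2_add_closed[OF assms(1) Z2_uminus_closed[OF assms(2)]] by simp

lemma comm_group_Z2: "comm_group (Z2 G :: ('a \<times> 'a \<Rightarrow> 'm::nontriv mod_ring) monoid)"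
proof (rule comm_groupI)
  fix z :: "'a \<times> 'a \<Rightarrow> 'm mod_ring" assume "z \<in> carrier (Z2 G)"
  then show "\<exists>y\<in>carrier (Z2 G). y \<otimes>\<^bsub>Z2 G\<^esub> z = \<one>\<^bsub>Z2 G\<^esub>"
    by (intro bexI[of _ "\<lambda>p. - z p"]) (simp_all add: Z2_uminus_closed)
qed (simp_all add: Z2_add_closed Z2_zero_closed algebra_simps)

lemma inv_Z2: "z \<in> carrier (Z2 G) \<Longrightarrow> inv\<^bsub>Z2 G\<^esub> z = (\<lambda>p. - z p)"
  by (rule group.inv_equality[OF comm_group.axioms(2)[OF comm_group_Z2]]) (simp_all add: Z2_uminus_closed)

lemma normal_B2: "B2 G \<lhd> (Z2 G :: ('a \<times> 'a \<Rightarrow> 'm::nontriv mod_ring) monoid)"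
proof -
  interpret Z: comm_group "Z2 G :: ('a \<times> 'a \<Rightarrow> 'm mod_ring) monoid" by (rule comm_group_Z2)
  have "subgroup (B2 G) (Z2 G :: ('a \<times> 'a \<Rightarrow> 'm mod_ring) monoid)"
  proof (rule Z.subgroupI)
    show "B2 G \<subseteq> carrier (Z2 G)" using coboundary_in_Z2 by (auto simp: B2_def)
    show "B2 G \<noteq> {}" using cochains1_zero by (auto simp: B2_def)
    fix a :: "'a \<times> 'a \<Rightarrow> 'm mod_ring" assume "a \<in> B2 G"
    then obtain c where c: "c \<in> cochains1 G" "a = coboundary G c" by (auto simp: B2_def)
    have "inv\<^bsub>Z2 G\<^esub> a = coboundary G (\<lambda>x. 0 - c x)"
      unfolding c(2) inv_Z2[OF coboundary_in_Z2[OF c(1)]] coboundary_diff coboundary_zero by simp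
    then show "inv\<^bsub>Z2 G\<^esub> a \<in> B2 G"
      using cochains1_diff[OF cochains1_zero c(1)] by (simp add: B2_def)
    fix b :: "'a \<times> 'a \<Rightarrow> 'm mod_ring" assume "b \<in> B2 G"
    then obtain d where d: "d \<in> cochains1 G" "b = coboundary G d" by (auto simp: B2_def)
    have "a \<otimes>\<^bsub>Z2 G\<^esub> b = coboundary G (\<lambda>x. c x + d x)"
      using c d by (simp add: coboundary_add)
    then show "a \<otimes>\<^bsub>Z2 G\<^esub> b \<in> B2 G"
      using cochains1_add[OF c(1) d(1)] by (simp add: B2_def)
  qed
  then show ?thesis using Z.normal_iff_subgroup by blast
qed

lemma group_H2: "group (H2 G :: ('a \<times> 'a \<Rightarrow> 'm::nontriv mod_ring) set monoid)"
  unfolding H2_def by (rule normal.factorgroup_is_group[OF normal_B2])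

lemma H2_class_closed: "z \<in> carrier (Z2 G) \<Longrightarrow> H2_class G z \<in> carrier (H2 G)"
  by (auto simp: H2_def H2_class_def FactGroup_def RCOSETS_def)

lemma H2_cases:
  assumes "\<alpha> \<in> carrier (H2 G)"
  obtains z where "z \<in> carrier (Z2 G)" "\<alpha> = H2_class G z"
  using assms by (auto simp: H2_def H2_class_def FactGroup_def RCOSETS_def)

lemma H2_mult:
  "z \<in> carrier (Z2 G) \<Longrightarrow> z' \<in> carrier (Z2 G) \<Longrightarrow>
     H2_class G z \<otimes>\<^bsub>H2 G\<^esub> H2_class G z' = H2_class G (\<lambda>p. z p + z' p)"
  using normal.rcos_sum[OF normal_B2] by (simp add: H2_def H2_class_def FactGroup_def)

lemma mem_H2_class_iff: "x \<in> H2_class G z \<longleftrightarrow> (\<exists>c\<in>cochains1 G. x = (\<lambda>p. coboundary G c p + z p))"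
  by (auto simp: H2_class_def r_coset_def B2_def)

lemma H2_class_refl: "z \<in> H2_class G z"
  unfolding mem_H2_class_iff by (rule bexI[OF _ cochains1_zero]) (simp add: coboundary_zero)

lemma H2_class_eqI:
  assumes "c \<in> cochains1 G" "\<And>p. z p = z' p + coboundary G c p"
  shows "H2_class G z = H2_class G z'"
proof (intro subset_antisym subsetI)
  fix x assume "x \<in> H2_class G z"
  then obtain d where d: "d \<in> cochains1 G" "x = (\<lambda>p. coboundary G d p + z p)" by (auto simp: mem_H2_class_iff)
  show "x \<in> H2_class G z'" unfolding mem_H2_class_iff
    by (rule bexI[OF _ cochains1_add[OF d(1) assms(1)]]) (simp add: d(2) assms(2) coboundary_add algebra_simps)
next
  fix x assume "x \<in> H2_class G z'"
  then obtain d where d: "d \<in> cochains1 G" "x = (\<lambda>p. coboundary G d p + z' p)" by (auto simp: mem_H2_class_iff)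
  show "x \<in> H2_class G z" unfolding mem_H2_class_iff
    by (rule bexI[OF _ cochains1_diff[OF d(1) assms(1)]]) (simp add: d(2) assms(2) coboundary_diff algebra_simps)
qed

lemma H2_class_eqD:
  assumes "H2_class G z = H2_class G z'"
  shows "\<exists>c\<in>cochains1 G. \<forall>p. z p = z' p + coboundary G c p"
proof -
  have "z \<in> H2_class G z'" using assms H2_class_refl by blast
  then show ?thesis unfolding mem_H2_class_iff by (metis add.commute)
qed

lemma H2_one: "\<one>\<^bsub>H2 G\<^esub> = H2_class G (\<lambda>p. 0)"
proof -
  have "H2_class G (\<lambda>p. 0 :: 'b mod_ring) = B2 G"
    by (auto simp: H2_class_def r_coset_def)
  then show ?thesis by (simp add: H2_def FactGroup_def)
qed

end

section \<open>Functoriality of cochains and of second cohomology\<close>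

locale top_hom = G: top_grp G + K: top_grp K
  for G :: "'a top_group" and K :: "'b top_group" +
  fixes f :: "'a \<Rightarrow> 'b"
  assumes f_hom: "f \<in> hom G K" and f_cont: "continuous_map (topol G) (topol K) f"
begin

lemma f_closed: "x \<in> carrier G \<Longrightarrow> f x \<in> carrier K"
  using hom_in_carrier[OF f_hom] .

lemma f_mult: "x \<in> carrier G \<Longrightarrow> y \<in> carrier G \<Longrightarrow> f (x \<otimes>\<^bsub>G\<^esub> y) = f x \<otimes>\<^bsub>K\<^esub> f y"
  by (rule hom_mult[OF f_hom])

lemma pullback1_cochain: "c \<in> cochains1 K \<Longrightarrow> pullback1 G f c \<in> cochains1 G"
proof -
  assume "c \<in> cochains1 K"
  then have "locally_const (topol K) c" by (simp add: cochains1_iff)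
  from locally_const_compose[OF f_cont this] have "locally_const (topol G) (pullback1 G f c)"
    by (rule locally_const_cong) (simp add: pullback1_def)
  then show ?thesis by (simp add: cochains1_iff pullback1_def)
qed

lemma pullback2_cochain: "z \<in> cochains2 K \<Longrightarrow> pullback2 G f z \<in> cochains2 G"
proof -
  let ?X = "prod_topology (topol G) (topol G)"
  assume z: "z \<in> cochains2 K"
  have "continuous_map ?X (prod_topology (topol K) (topol K)) (\<lambda>p. (f (fst p), f (snd p)))"
    using continuous_map_compose[OF continuous_map_fst f_cont] continuous_map_compose[OF continuous_map_snd f_cont]
    by (intro continuous_map_pairedI) (simp_all only: o_def)
  moreover have "locally_const (prod_topology (topol K) (topol K)) z"
    using z by (simp add: cochains2_iff)
  ultimately have "locally_const ?X (\<lambda>p. z (f (fst p), f (snd p)))"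
    by (rule locally_const_compose)
  then have "locally_const ?X (pullback2 G f z)"
    by (rule locally_const_cong) (auto simp: pullback2_def)
  then show ?thesis by (simp add: cochains2_iff pullback2_outside)
qed

lemma pullback2_Z2: "z \<in> carrier (Z2 K) \<Longrightarrow> pullback2 G f z \<in> carrier (Z2 G)"
  unfolding carrier_Z2_iff
  using pullback2_cochain[of z] by (simp add: pullback2_apply f_closed f_mult)

lemma coboundary_pullback1: "coboundary G (pullback1 G f c) = pullback2 G f (coboundary K c)"
  by (rule ext_on_pairs[of "carrier G"])
    (simp_all add: coboundary_outside pullback2_outside coboundary_apply pullback2_apply pullback1_apply f_closed f_mult)

lemma pullback2_add: "pullback2 G f (\<lambda>p. z p + z' p) = (\<lambda>p. pullback2 G f z p + pullback2 G f z' p)"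
  by (auto simp: pullback2_def)

text \<open>The pullback of a coboundary is a coboundary, so the union in \<open>H2_map\<close> runs
  over one and the same class.\<close>

lemma H2_map_class: "H2_map G f (H2_class K z) = H2_class G (pullback2 G f z)"
proof -
  have "H2_class G (pullback2 G f z') = H2_class G (pullback2 G f z)" if "z' \<in> H2_class K z" for z'
  proof -
    obtain c where c: "c \<in> cochains1 K" "z' = (\<lambda>p. coboundary K c p + z p)"
      using \<open>z' \<in> H2_class K z\<close> by (auto simp: K.mem_H2_class_iff)
    show ?thesis
      by (rule G.H2_class_eqI[OF pullback1_cochain[OF c(1)]])
        (simp add: c(2) pullback2_add coboundary_pullback1 add.commute)
  qed
  then show ?thesis unfolding H2_map_def using K.H2_class_refl by blast
qed

lemma H2_map_hom: "H2_map G f \<in> hom (H2 K) (H2 G :: ('a \<times> 'a \<Rightarrow> 'm::nontriv mod_ring) set monoid)"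
proof (rule homI)
  fix \<alpha> :: "('b \<times> 'b \<Rightarrow> 'm mod_ring) set" assume "\<alpha> \<in> carrier (H2 K)"
  then obtain z where z: "z \<in> carrier (Z2 K)" "\<alpha> = H2_class K z" by (rule K.H2_cases)
  show "H2_map G f \<alpha> \<in> carrier (H2 G)"
    unfolding z H2_map_class by (rule G.H2_class_closed[OF pullback2_Z2[OF z(1)]])
  fix \<beta> :: "('b \<times> 'b \<Rightarrow> 'm mod_ring) set" assume "\<beta> \<in> carrier (H2 K)"
  then obtain z' where z': "z' \<in> carrier (Z2 K)" "\<beta> = H2_class K z'" by (rule K.H2_cases)
  show "H2_map G f (\<alpha> \<otimes>\<^bsub>H2 K\<^esub> \<beta>) = H2_map G f \<alpha> \<otimes>\<^bsub>H2 G\<^esub> H2_map G f \<beta>"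
    unfolding z(2) z'(2) K.H2_mult[OF z(1) z'(1)] H2_map_class
      G.H2_mult[OF pullback2_Z2[OF z(1)] pullback2_Z2[OF z'(1)]] pullback2_add ..
qed

end

section \<open>Topological quotient groups and descent of cochains\<close>

locale top_quotient = top_grp S for S :: "'a top_group" (structure) +
  fixes N :: "'a set"
  assumes normal: "N \<lhd> S"
begin

abbreviation Q where "Q \<equiv> quotient_group S N"
abbreviation proj where "proj \<equiv> (\<lambda>x. N #> x)"

lemma N_subgroup: "subgroup N S" using normal by (rule normal_imp_subgroup)

lemma N_subset: "N \<subseteq> carrier S" using N_subgroup by (rule subgroup.subset)

lemma carrier_Q: "carrier Q = proj ` carrier S"
  by (auto simp: quotient_group_def FactGroup_def RCOSETS_def)

lemma proj_closed: "x \<in> carrier S \<Longrightarrow> proj x \<in> carrier Q"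
  by (simp add: carrier_Q)

lemma mult_Q: "x \<in> carrier S \<Longrightarrow> y \<in> carrier S \<Longrightarrow> proj x \<otimes>\<^bsub>Q\<^esub> proj y = proj (x \<otimes> y)"
  using normal.rcos_sum[OF normal] by (simp add: quotient_group_def FactGroup_def)

lemma one_Q: "\<one>\<^bsub>Q\<^esub> = proj \<one>"
  using coset_join2[OF one_closed N_subgroup] N_subgroup[THEN subgroup.one_closed]
  by (simp add: quotient_group_def FactGroup_def)

lemma proj_eq_iff:
  assumes "x \<in> carrier S" "y \<in> carrier S"
  shows "proj x = proj y \<longleftrightarrow> (\<exists>n\<in>N. y = x \<otimes> n)"
proof -
  have xN: "x <# N = N #> x" using normal.coset_eq[OF normal] assms(1) by simp
  have "proj x = proj y \<longleftrightarrow> y \<in> N #> x"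
    using repr_independence[OF _ assms(1) N_subgroup] repr_independenceD[OF N_subgroup assms(2)] by blast
  also have "\<dots> \<longleftrightarrow> (\<exists>n\<in>N. y = x \<otimes> n)"
    unfolding xN[symmetric] by (auto simp: l_coset_def)
  finally show ?thesis .
qed

lemma proj_mult_N: "x \<in> carrier S \<Longrightarrow> n \<in> N \<Longrightarrow> proj (x \<otimes> n) = proj x"
  using proj_eq_iff[of x "x \<otimes> n"] N_subset by (metis m_closed subsetD)

lemma group_Q: "group Q"
proof (rule groupI)
  fix p assume "p \<in> carrier Q"
  then obtain x where x: "x \<in> carrier S" "p = proj x" by (auto simp: carrier_Q)
  show "\<one>\<^bsub>Q\<^esub> \<otimes>\<^bsub>Q\<^esub> p = p" by (simp add: one_Q mult_Q x)
  show "\<exists>q\<in>carrier Q. q \<otimes>\<^bsub>Q\<^esub> p = \<one>\<^bsub>Q\<^esub>"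
    by (rule bexI[of _ "proj (inv x)"]) (simp_all add: x mult_Q one_Q proj_closed)
  fix q assume "q \<in> carrier Q"
  then obtain y where y: "y \<in> carrier S" "q = proj y" by (auto simp: carrier_Q)
  show "p \<otimes>\<^bsub>Q\<^esub> q \<in> carrier Q" by (simp add: x y mult_Q proj_closed)
  fix r assume "r \<in> carrier Q"
  then obtain t where t: "t \<in> carrier S" "r = proj t" by (auto simp: carrier_Q)
  show "p \<otimes>\<^bsub>Q\<^esub> q \<otimes>\<^bsub>Q\<^esub> r = p \<otimes>\<^bsub>Q\<^esub> (q \<otimes>\<^bsub>Q\<^esub> r)" by (simp add: x y t mult_Q m_assoc)
qed (simp add: one_Q proj_closed)

lemma inv_Q: "x \<in> carrier S \<Longrightarrow> inv\<^bsub>Q\<^esub> (proj x) = proj (inv x)"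
  by (rule group.inv_equality[OF group_Q]) (simp_all add: mult_Q one_Q proj_closed)

lemma openin_Q_iff: "openin (topol Q) V \<longleftrightarrow> V \<subseteq> carrier Q \<and> openin (topol S) {x \<in> carrier S. proj x \<in> V}"
  by (simp add: quotient_group_def openin_quotient_topology)

lemma topspace_Q: "topspace (topol Q) = carrier Q"
proof -
  have "openin (topol Q) (carrier Q)"
    unfolding openin_Q_iff using proj_closed openin_topspace[of "topol S"] by (simp cong: conj_cong)
  then show ?thesis unfolding topspace_def using openin_Q_iff by blast
qed

lemma proj_continuous: "continuous_map (topol S) (topol Q) proj"
  unfolding continuous_map_def topspace_Q openin_Q_iff by (simp add: proj_closed)

text \<open>The saturation of \<open>U\<close> is the union of the preimages of \<open>U\<close>
  under right translation by elements of \<open>N\<close>.\<close>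

lemma proj_open:
  assumes U: "openin (topol S) U"
  shows "openin (topol Q) (proj ` U)"
proof -
  have Usub: "U \<subseteq> carrier S" using openin_subset[OF U] by simp
  have "{x \<in> carrier S. proj x \<in> proj ` U} = (\<Union>n\<in>N. {x \<in> topspace (topol S). x \<otimes> n \<in> U})"
  proof (intro subset_antisym subsetI)
    fix x assume "x \<in> {x \<in> carrier S. proj x \<in> proj ` U}"
    then obtain u where "x \<in> carrier S" "u \<in> U" "proj x = proj u" by auto
    then show "x \<in> (\<Union>n\<in>N. {x \<in> topspace (topol S). x \<otimes> n \<in> U})"
      using proj_eq_iff[of x u] Usub by auto
  next
    fix x assume "x \<in> (\<Union>n\<in>N. {x \<in> topspace (topol S). x \<otimes> n \<in> U})"
    then obtain n where n: "n \<in> N" "x \<in> carrier S" "x \<otimes> n \<in> U" by auto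
    then have "proj x \<in> proj ` U" using proj_mult_N[OF n(2,1)] by (metis imageI)
    then show "x \<in> {x \<in> carrier S. proj x \<in> proj ` U}" using n by simp
  qed
  moreover have "openin (topol S) {x \<in> topspace (topol S). x \<otimes> n \<in> U}" if "n \<in> N" for n
  proof (rule openin_continuous_map_preimage[OF _ U])
    show "continuous_map (topol S) (topol S) (\<lambda>x. x \<otimes> n)"
      using that N_subset by (intro continuous_mult' continuous_map_id[unfolded id_def]) auto
  qed
  ultimately have "openin (topol S) {x \<in> carrier S. proj x \<in> proj ` U}" by auto
  then show ?thesis unfolding openin_Q_iff using Usub proj_closed by auto
qed

lemma continuous_from_Q:
  assumes f: "continuous_map (topol S) Y (\<lambda>x. f (proj x))"
  shows "continuous_map (topol Q) Y f"
  unfolding continuous_map_def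
proof (intro conjI allI impI)
  show "f \<in> topspace (topol Q) \<rightarrow> topspace Y"
    using continuous_map_image_subset_topspace[OF f] by (auto simp: topspace_Q carrier_Q)
  fix V assume "openin Y V"
  from openin_continuous_map_preimage[OF f this]
  have "openin (topol S) {x \<in> carrier S. proj x \<in> {q \<in> carrier Q. f q \<in> V}}"
    using proj_closed by (simp cong: conj_cong)
  then show "openin (topol Q) {x \<in> topspace (topol Q). f x \<in> V}"
    unfolding topspace_Q openin_Q_iff by simp
qed

text \<open>A product of quotient maps need not be a quotient map. Here \<open>proj\<close> is open,
  so it carries an open box in \<open>S \<times> S\<close> to an open box in the product of the
  quotients.\<close>

lemma continuous_from_Q2:
  assumes f: "continuous_map (prod_topology (topol S) (topol S)) Y (\<lambda>p. f (proj (fst p), proj (snd p)))"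
  shows "continuous_map (prod_topology (topol Q) (topol Q)) Y f"
  unfolding continuous_map_def
proof (intro conjI allI impI)
  show "f \<in> topspace (prod_topology (topol Q) (topol Q)) \<rightarrow> topspace Y"
    using continuous_map_image_subset_topspace[OF f] by (force simp: topspace_Q carrier_Q)
  fix V assume V: "openin Y V"
  define W where "W = {p \<in> topspace (prod_topology (topol S) (topol S)). f (proj (fst p), proj (snd p)) \<in> V}"
  have W: "openin (prod_topology (topol S) (topol S)) W"
    unfolding W_def by (rule openin_continuous_map_preimage[OF f V])
  show "openin (prod_topology (topol Q) (topol Q)) {p \<in> topspace (prod_topology (topol Q) (topol Q)). f p \<in> V}"
    unfolding openin_prod_topology_alt
  proof (intro allI impI)
    fix p q assume pq: "(p, q) \<in> {p \<in> topspace (prod_topology (topol Q) (topol Q)). f p \<in> V}"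
    then obtain x y where xy: "x \<in> carrier S" "y \<in> carrier S" "p = proj x" "q = proj y"
      by (auto simp: topspace_Q carrier_Q)
    then have "(x, y) \<in> W" using pq by (simp add: W_def)
    with W obtain U1 U2 where U: "openin (topol S) U1" "openin (topol S) U2" "x \<in> U1" "y \<in> U2" "U1 \<times> U2 \<subseteq> W"
      unfolding openin_prod_topology_alt by meson
    show "\<exists>U V'. openin (topol Q) U \<and> openin (topol Q) V' \<and> p \<in> U \<and> q \<in> V' \<and>
        U \<times> V' \<subseteq> {p \<in> topspace (prod_topology (topol Q) (topol Q)). f p \<in> V}"
    proof (intro exI conjI)
      show "openin (topol Q) (proj ` U1)" "openin (topol Q) (proj ` U2)" using U proj_open by auto
      show "p \<in> proj ` U1" "q \<in> proj ` U2" using xy U by auto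
      show "proj ` U1 \<times> proj ` U2 \<subseteq> {p \<in> topspace (prod_topology (topol Q) (topol Q)). f p \<in> V}"
      proof
        fix r assume "r \<in> proj ` U1 \<times> proj ` U2"
        then obtain u v where uv: "u \<in> U1" "v \<in> U2" "r = (proj u, proj v)" by auto
        then have "(u, v) \<in> W" using U(5) by blast
        then show "r \<in> {p \<in> topspace (prod_topology (topol Q) (topol Q)). f p \<in> V}"
          using uv by (simp add: topspace_Q proj_closed W_def)
      qed
    qed
  qed
qed

lemma topological_group_Q: "topological_group Q"
proof (rule topological_groupI[OF group_Q topspace_Q])
  have "continuous_map (prod_topology (topol S) (topol S)) (topol Q) (\<lambda>p. proj (fst p \<otimes> snd p))"
    using continuous_map_compose[OF continuous_mult'[OF continuous_map_fst continuous_map_snd] proj_continuous]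
    by (simp only: o_def)
  then have "continuous_map (prod_topology (topol S) (topol S)) (topol Q) (\<lambda>p. proj (fst p) \<otimes>\<^bsub>Q\<^esub> proj (snd p))"
    by (rule continuous_map_eq) (auto simp: mult_Q)
  then show "continuous_map (prod_topology (topol Q) (topol Q)) (topol Q) (\<lambda>p. fst p \<otimes>\<^bsub>Q\<^esub> snd p)"
    by (intro continuous_from_Q2) simp
  have "continuous_map (topol S) (topol Q) (\<lambda>x. proj (inv x))"
    using continuous_map_compose[OF continuous_inv proj_continuous] by (simp only: o_def)
  then have "continuous_map (topol S) (topol Q) (\<lambda>x. inv\<^bsub>Q\<^esub> (proj x))"
    by (rule continuous_map_eq) (simp add: inv_Q)
  then show "continuous_map (topol Q) (topol Q) (\<lambda>x. inv\<^bsub>Q\<^esub> x)" by (rule continuous_from_Q)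
qed

sublocale Q: top_grp "quotient_group S N" by unfold_locales (rule topological_group_Q)

sublocale proj: top_hom S "quotient_group S N" "\<lambda>x. N #> x"
  by unfold_locales (auto intro!: homI simp: proj_closed mult_Q proj_continuous)

lemma descend1:
  fixes y :: "'a \<Rightarrow> 'm::nontriv mod_ring"
  assumes y: "locally_const (topol S) y"
    and inv: "\<And>x n. x \<in> carrier S \<Longrightarrow> n \<in> N \<Longrightarrow> y (x \<otimes> n) = y x"
  shows "\<exists>c\<in>cochains1 Q. \<forall>x\<in>carrier S. c (proj x) = y x"
proof -
  define c where "c q = (if q \<in> carrier Q then y (SOME x. x \<in> carrier S \<and> q = proj x) else 0)" for q
  have c: "c (proj x) = y x" if x: "x \<in> carrier S" for x
  proof -
    let ?x = "SOME x'. x' \<in> carrier S \<and> proj x = proj x'"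
    have "?x \<in> carrier S \<and> proj x = proj ?x" by (rule someI[of _ x]) (simp add: x)
    then obtain n where "n \<in> N" "?x = x \<otimes> n" using proj_eq_iff[OF x] by blast
    then show ?thesis using inv[OF x] by (simp add: c_def proj_closed[OF x])
  qed
  have "locally_const (topol Q) c"
    by (rule continuous_from_Q, rule locally_const_cong[OF y]) (simp add: c)
  then have "c \<in> cochains1 Q" by (simp add: cochains1_iff c_def)
  then show ?thesis using c by blast
qed

lemma descend2:
  fixes y :: "'a \<times> 'a \<Rightarrow> 'm::nontriv mod_ring"
  assumes y: "locally_const (prod_topology (topol S) (topol S)) y"
    and out: "\<And>p. p \<notin> carrier S \<times> carrier S \<Longrightarrow> y p = 0"
    and inv: "\<And>x n x' n'. x \<in> carrier S \<Longrightarrow> n \<in> N \<Longrightarrow> x' \<in> carrier S \<Longrightarrow> n' \<in> N \<Longrightarrow>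
      y (x \<otimes> n, x' \<otimes> n') = y (x, x')"
  shows "\<exists>z\<in>cochains2 Q. pullback2 S proj z = y"
proof -
  define r where "r q = (SOME x. x \<in> carrier S \<and> q = proj x)" for q
  define z where "z p = (if p \<in> carrier Q \<times> carrier Q then y (r (fst p), r (snd p)) else 0)" for p
  have r: "\<exists>n\<in>N. r (proj x) = x \<otimes> n" if x: "x \<in> carrier S" for x
  proof -
    have "r (proj x) \<in> carrier S \<and> proj x = proj (r (proj x))" unfolding r_def by (rule someI[of _ x]) (simp add: x)
    then show ?thesis using proj_eq_iff[OF x] by blast
  qed
  have z: "z (proj x, proj x') = y (x, x')" if x: "x \<in> carrier S" "x' \<in> carrier S" for x x'
    using r[OF x(1)] r[OF x(2)] inv[OF x(1) _ x(2)] by (auto simp: z_def proj_closed x)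
  have "locally_const (prod_topology (topol Q) (topol Q)) z"
    by (rule continuous_from_Q2, rule locally_const_cong[OF y]) (auto simp: z)
  then have "z \<in> cochains2 Q" by (simp add: cochains2_iff z_def)
  moreover have "pullback2 S proj z = y"
    by (rule ext_on_pairs[of "carrier S"]) (simp_all add: pullback2_outside out pullback2_apply z)
  ultimately show ?thesis by blast
qed

lemma Z2_if_pullback2:
  assumes z: "z \<in> cochains2 Q" and p: "pullback2 S proj z \<in> carrier (Z2 S)"
  shows "z \<in> carrier (Z2 Q)"
  unfolding carrier_Z2_iff
proof (intro conjI z ballI)
  fix a b c assume "a \<in> carrier Q" "b \<in> carrier Q" "c \<in> carrier Q"
  then obtain x y t where xyt: "x \<in> carrier S" "y \<in> carrier S" "t \<in> carrier S"
    and abc: "a = proj x" "b = proj y" "c = proj t"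
    by (auto simp: carrier_Q)
  have "\<forall>x\<in>carrier S. \<forall>y\<in>carrier S. \<forall>t\<in>carrier S. pullback2 S proj z (x, y) + pullback2 S proj z (x \<otimes> y, t) =
      pullback2 S proj z (y, t) + pullback2 S proj z (x, y \<otimes> t)"
    using p unfolding carrier_Z2_iff by blast
  from this[rule_format, OF xyt]
  show "z (a, b) + z (a \<otimes>\<^bsub>Q\<^esub> b, c) = z (b, c) + z (a, b \<otimes>\<^bsub>Q\<^esub> c)"
    using xyt by (simp add: abc mult_Q pullback2_apply)
qed

lemma pullback2_inject:
  assumes "z \<in> cochains2 Q" "z' \<in> cochains2 Q" "pullback2 S proj z = pullback2 S proj z'"
  shows "z = z'"
proof (rule ext_on_pairs[of "carrier Q"])
  fix a b assume "a \<in> carrier Q" "b \<in> carrier Q"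
  then obtain x y where "x \<in> carrier S" "y \<in> carrier S" "a = proj x" "b = proj y" by (auto simp: carrier_Q)
  then show "z (a, b) = z' (a, b)" using fun_cong[OF assms(3), of "(x, y)"] by (simp add: pullback2_apply)
qed (use assms cochains2_outside in blast)+

end

subsection \<open>Transgression\<close>

lemma H1_invariant_iff:
  assumes "group S" "N \<subseteq> carrier S"
  shows "\<psi> \<in> H1_invariant S N \<longleftrightarrow> locally_const (subtopology (topol S) N) \<psi> \<and> (\<forall>x. x \<notin> N \<longrightarrow> \<psi> x = 0) \<and>
     (\<forall>x\<in>N. \<forall>y\<in>N. \<psi> (x \<otimes>\<^bsub>S\<^esub> y) = \<psi> x + \<psi> y) \<and>
     (\<forall>\<sigma>\<in>carrier S. \<forall>x\<in>N. \<psi> (inv\<^bsub>S\<^esub> \<sigma> \<otimes>\<^bsub>S\<^esub> x \<otimes>\<^bsub>S\<^esub> \<sigma>) = \<psi> x)"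
proof -
  have "coboundary (top_subgroup S N) \<psi> = (\<lambda>_. 0) \<longleftrightarrow> (\<forall>x\<in>N. \<forall>y\<in>N. \<psi> (x \<otimes>\<^bsub>S\<^esub> y) = \<psi> x + \<psi> y)"
    by (auto simp: coboundary_def top_subgroup_def fun_eq_iff)
  then show ?thesis
    by (simp add: H1_invariant_def H1_def cochains1_iff top_subgroup_def)
qed

text \<open>The inclusion of \<open>N\<close> in S_2 corresponds to N \<le> S^m[S,S]. The argument
  \<open>ty\<close> fixes the modulus of the filtration.\<close>

locale transgression_setup = free_profinite A S + top_quotient S N
  for A :: "'a set" and S :: "'a top_group" (structure) and N +
  fixes ty :: "'m::nontriv itself"
  assumes N2: "N \<subseteq> magnus_filtration ty A S 2"
begin

lemmas H1_inv_iff = H1_invariant_iff[OF is_group N_subset]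

abbreviation H1N :: "('a \<Rightarrow> 'm mod_ring) set" where "H1N \<equiv> H1_invariant S N"
abbreviation trg :: "('a \<Rightarrow> 'm mod_ring) \<Rightarrow> ('a set \<times> 'a set \<Rightarrow> 'm mod_ring) set" where
  "trg \<equiv> transgression S N"

lemma N_carrier [simp]: "x \<in> N \<Longrightarrow> x \<in> carrier S" using N_subset by blast
lemma N_mult: "x \<in> N \<Longrightarrow> y \<in> N \<Longrightarrow> x \<otimes> y \<in> N" by (rule subgroup.m_closed[OF N_subgroup])
lemma N_one: "\<one> \<in> N" by (rule subgroup.one_closed[OF N_subgroup])
lemma N_conj: "\<sigma> \<in> carrier S \<Longrightarrow> x \<in> N \<Longrightarrow> inv \<sigma> \<otimes> x \<otimes> \<sigma> \<in> N"
  using normal.inv_op_closed1[OF normal] .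

lemma H1N_one: "\<psi> \<in> H1N \<Longrightarrow> \<psi> \<one> = 0"
proof -
  assume "\<psi> \<in> H1N"
  then have "\<psi> (\<one> \<otimes> \<one>) = \<psi> \<one> + \<psi> \<one>" unfolding H1_inv_iff using N_one by blast
  then show ?thesis by simp
qed

text \<open>A continuous homomorphism on \<open>S\<close> is a combination of coefficients at
  one-letter words, and these vanish on S_2. So restriction from H^1(S) to H^1(N) is zero, which is
  the source of the injectivity of the transgression.\<close>

lemma hom_vanishes_on_N:
  fixes c :: "'a \<Rightarrow> 'm mod_ring"
  assumes c: "c \<in> cochains1 S" and d: "coboundary S c = (\<lambda>p. 0)" and x: "x \<in> N"
  shows "c x = 0"
proof -
  have cc: "locally_const (topol S) c" using c by (simp add: cochains1_iff)
  have add: "c (x \<otimes> y) = c x + c y" if "x \<in> carrier S" "y \<in> carrier S" for x y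
    using fun_cong[OF d, of "(x, y)"] that by (simp add: coboundary_apply)
  have "c x = (\<Sum>a\<in>{a \<in> A. c a \<noteq> 0}. c a * magnus A S x [a])"
    using additive_expansion(2)[OF cc add] x by simp
  also have "\<dots> = 0"
  proof (rule sum.neutral, intro ballI)
    fix a assume "a \<in> {a \<in> A. c a \<noteq> 0}"
    then have "[a] \<in> lists A" by simp
    then have "magnus A S x [a] = (0 :: 'm mod_ring)"
      using N2 x unfolding magnus_filtration_def by force
    then show "c a * magnus A S x [a] = 0" by simp
  qed
  finally show ?thesis .
qed

text \<open>The difference of the cochains vanishes on \<open>N\<close> and has an inflated
  coboundary. Comparing the coboundary at (x, n) and (x, 1) shows that the difference is constant on
  cosets of \<open>N\<close>, so it descends to a cochain with coboundary z - z'.\<close>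

lemma transgression_unique:
  fixes y y' :: "'a \<Rightarrow> 'm mod_ring"
  assumes y: "y \<in> cochains1 S" "coboundary S y = pullback2 S proj z"
    and y': "y' \<in> cochains1 S" "coboundary S y' = pullback2 S proj z'"
    and z: "z \<in> cochains2 Q" "z' \<in> cochains2 Q"
    and eq: "\<And>x. x \<in> N \<Longrightarrow> y x = y' x"
  shows "H2_class Q z = H2_class Q z'"
proof -
  define u where "u x = y x - y' x" for x
  have u: "u \<in> cochains1 S" unfolding u_def by (rule cochains1_diff[OF y(1) y'(1)])
  have du: "coboundary S u = (\<lambda>p. pullback2 S proj z p - pullback2 S proj z' p)"
    unfolding u_def coboundary_diff y(2) y'(2) ..
  have u0: "u x = 0" if "x \<in> N" for x using eq[OF that] by (simp add: u_def)
  have inv: "u (x \<otimes> n) = u x" if x: "x \<in> carrier S" and n: "n \<in> N" for x n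
  proof -
    have pn: "proj n = proj \<one>" using coset_join2[OF _ N_subgroup] n N_one by simp
    have "coboundary S u (x, n) = coboundary S u (x, \<one>)"
      unfolding du using x n pn by (simp add: pullback2_apply)
    then show ?thesis using x n by (simp add: coboundary_apply u0 N_one)
  qed
  have "locally_const (topol S) u" using u by (simp add: cochains1_iff)
  from descend1[OF this inv] obtain c where c: "c \<in> cochains1 Q" "\<And>x. x \<in> carrier S \<Longrightarrow> c (proj x) = u x"
    by blast
  have pc: "pullback1 S proj c = u"
  proof
    fix x show "pullback1 S proj c x = u x"
      using c(2)[of x] cochains1_outside[OF u, of x] by (simp add: pullback1_def)
  qed
  have "z = (\<lambda>p. z' p + coboundary Q c p)"
  proof (rule pullback2_inject)
    show "z \<in> cochains2 Q" by (rule z)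
    have "coboundary Q c \<in> cochains2 Q"
      using Q.coboundary_in_Z2[OF c(1)] by (simp add: carrier_Z2_iff)
    from cochains2_compose2[OF z(2) this, of "(+)"] show "(\<lambda>p. z' p + coboundary Q c p) \<in> cochains2 Q" by simp
    show "pullback2 S proj z = pullback2 S proj (\<lambda>p. z' p + coboundary Q c p)"
      unfolding proj.pullback2_add proj.coboundary_pullback1[symmetric] pc du by simp
  qed
  then show ?thesis by (intro Q.H2_class_eqI[OF c(1)]) (rule fun_cong)
qed

lemma Z2_of_coboundary:
  assumes "y \<in> cochains1 S" "coboundary S y = pullback2 S proj z" "z \<in> cochains2 Q"
  shows "z \<in> carrier (Z2 Q)"
  using Z2_if_pullback2[OF assms(3)] coboundary_in_Z2[OF assms(1)] assms(2) by simp

text \<open>The cocycle identity for \<open>z\<close> comes from its pullback, a coboundary, and the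
  surjectivity of \<open>proj\<close>. Concrete transgressions are computed below by exhibiting such
  a pair \<open>y\<close>, \<open>z\<close>.\<close>

lemma transgression_eqI:
  fixes y :: "'a \<Rightarrow> 'm mod_ring"
  assumes y: "y \<in> cochains1 S" "coboundary S y = pullback2 S proj z" and z: "z \<in> cochains2 Q"
    and eq: "\<And>x. x \<in> N \<Longrightarrow> y x = \<psi> x"
  shows "trg \<psi> = H2_class Q z"
  unfolding transgression_def
proof (rule the_equality)
  have "z \<in> carrier (Z2 Q)" by (rule Z2_of_coboundary[OF y z])
  then show "\<exists>y\<in>cochains1 S. \<exists>z'\<in>carrier (Z2 Q). (\<forall>x\<in>N. y x = \<psi> x) \<and> coboundary S y = pullback2 S proj z' \<and>
      H2_class Q z = H2_class Q z'"
    using y eq by blast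
next
  fix \<alpha>
  assume "\<exists>y\<in>cochains1 S. \<exists>z'\<in>carrier (Z2 Q). (\<forall>x\<in>N. y x = \<psi> x) \<and> coboundary S y = pullback2 S proj z' \<and>
      \<alpha> = H2_class Q z'"
  then obtain y' z' where y': "y' \<in> cochains1 S" "coboundary S y' = pullback2 S proj z'"
    and z': "z' \<in> carrier (Z2 Q)" and eq': "\<And>x. x \<in> N \<Longrightarrow> y' x = \<psi> x" and \<alpha>: "\<alpha> = H2_class Q z'"
    by blast
  have "z' \<in> cochains2 Q" using z' by (simp add: carrier_Z2_iff)
  then show "\<alpha> = H2_class Q z" unfolding \<alpha>
    by (rule transgression_unique[OF y' y _ z]) (simp add: eq eq')
qed

text \<open>An open normal subgroup \<open>U\<close> with \<open>U \<inter> N \<subseteq> ker \<psi>\<close> replaces a continuous section of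
  \<open>S \<rightarrow> S/N\<close>: any section of the finite quotient \<open>S/UN\<close> extends \<open>\<psi>\<close> to \<open>S\<close>.\<close>

lemma extend_invariant_hom:
  assumes \<psi>: "\<psi> \<in> H1N"
  shows "\<exists>y\<in>cochains1 S. \<forall>x\<in>carrier S. \<forall>n\<in>N. y (x \<otimes> n) = y x + \<psi> n"
proof -
  have \<psi>c: "locally_const (subtopology (topol S) N) \<psi>" and \<psi>add: "\<And>x y. x \<in> N \<Longrightarrow> y \<in> N \<Longrightarrow> \<psi> (x \<otimes> y) = \<psi> x + \<psi> y"
    using \<psi> unfolding H1_inv_iff by blast+
  have "openin (subtopology (topol S) N) {x \<in> topspace (subtopology (topol S) N). \<psi> x \<in> {0}}"
    by (rule openin_continuous_map_preimage[OF \<psi>c]) simp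
  then obtain O' where O': "openin (topol S) O'" "{x \<in> topspace (subtopology (topol S) N). \<psi> x \<in> {0}} = O' \<inter> N"
    unfolding openin_subtopology by blast
  have O'_iff: "x \<in> O' \<longleftrightarrow> \<psi> x = 0" if "x \<in> N" for x
  proof -
    have "x \<in> O' \<inter> N \<longleftrightarrow> x \<in> {x \<in> topspace (subtopology (topol S) N). \<psi> x \<in> {0}}"
      unfolding O'(2) ..
    then show ?thesis using that by simp
  qed
  have "\<one> \<in> O'" using O'_iff[OF N_one] H1N_one[OF \<psi>] by simp
  have "\<exists>V. openin (topol S) V \<and> closedin (topol S) V \<and> \<one> \<in> V \<and> V \<subseteq> O'"
    by (rule compact_Hausdorff_totally_disconnected_clopen[OF compact Hausdorff _ O'(1) \<open>\<one> \<in> O'\<close>])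
      (rule totally_disconnected)
  then obtain V where V: "openin (topol S) V" "closedin (topol S) V" "\<one> \<in> V" "V \<subseteq> O'"
    by blast
  \<comment> \<open>The indicator of a clopen set is locally constant, so the elements that leave it
    invariant form an open normal subgroup; it lies in \<open>V\<close> because \<one> does.\<close>
  have "locally_const (topol S) (\<lambda>x. x \<in> V)"
    unfolding locally_const_iff
  proof
    fix x assume x: "x \<in> topspace (topol S)"
    show "\<exists>U. openin (topol S) U \<and> x \<in> U \<and> (\<forall>y\<in>U. (y \<in> V) = (x \<in> V))"
    proof (cases "x \<in> V")
      case True
      then show ?thesis using V(1) by blast
    next
      case False
      then show ?thesis using V(2) x by (intro exI[of _ "topspace (topol S) - V"]) (auto simp: closedin_def)
    qed
  qed
  note inv = open_normal_invariance[OF this]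
  define U where "U = {x \<in> carrier S. \<forall>s\<in>carrier S. \<forall>t\<in>carrier S. (s \<otimes> x \<otimes> t \<in> V) = (s \<otimes> t \<in> V)}"
  have U_normal: "U \<lhd> S" and U_open: "openin (topol S) U" using inv unfolding U_def by blast+
  have U_subgroup: "subgroup U S" using U_normal by (rule normal_imp_subgroup)
  note U_carrier = subgroup.mem_carrier[OF U_subgroup]
  have UN: "\<psi> x = 0" if "x \<in> U" "x \<in> N" for x
  proof -
    have "x \<in> carrier S" "(\<one> \<otimes> x \<otimes> \<one> \<in> V) = (\<one> \<otimes> \<one> \<in> V)" using that(1) unfolding U_def by blast+
    then have "x \<in> V" using V(3) by simp
    then show ?thesis using V(4) O'_iff[OF that(2)] by blast
  qed
  define W where "W = U <#> N"
  interpret W: top_quotient S W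
    unfolding W_def
    by (rule top_quotient.intro[OF top_grp_axioms top_quotient_axioms.intro[OF normal_subgroup_set_mult_closed[OF U_normal normal]]])
  have U_conj: "x \<otimes> u \<otimes> inv x \<in> U" if "x \<in> carrier S" "u \<in> U" for x u
    using normal.inv_op_closed2[OF U_normal that] .
  have swap: "n \<otimes> u = (n \<otimes> u \<otimes> inv n) \<otimes> n" if "n \<in> carrier S" "u \<in> carrier S" for n u
    using that by (simp add: m_assoc)
  have cancel: "inv a \<otimes> (a \<otimes> b) = b" if "a \<in> carrier S" "b \<in> carrier S" for a b
    using that by (simp add: m_assoc[symmetric])
  have U_W: "u \<in> W" if "u \<in> U" for u
    unfolding W_def set_mult_def using that N_one r_one[OF U_carrier[OF that]] by force
  have N_W: "m \<in> W" if "m \<in> N" for m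
    unfolding W_def set_mult_def using that subgroup.one_closed[OF U_subgroup] l_one[OF N_carrier[OF that]] by force
  define r where "r x = (SOME t. t \<in> carrier S \<and> W #> t = W #> x)" for x
  have r: "r x \<in> carrier S \<and> W #> r x = W #> x" if "x \<in> carrier S" for x
    unfolding r_def by (rule someI[of _ x]) (simp add: that)
  \<comment> \<open>In the decomposition of \<open>x\<close> along its chosen representative modulo
    \<open>W\<close>, the factor \<open>n\<close> is determined up to an element of
    \<open>U \<inter> N\<close>. There \<psi> vanishes, so the value \<psi>(n) depends on
    \<open>x\<close> only.\<close>
  define R where "R x n \<longleftrightarrow> n \<in> N \<and> (\<exists>u\<in>U. x = r x \<otimes> (u \<otimes> n))" for x n
  have R_ex: "\<exists>n. R x n" if x: "x \<in> carrier S" for x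
  proof -
    obtain w where "w \<in> W" "x = r x \<otimes> w" using W.proj_eq_iff[of "r x" x] r[OF x] x by blast
    then show ?thesis unfolding W_def set_mult_def R_def by blast
  qed
  have R_unique: "\<psi> n = \<psi> n'" if x: "x \<in> carrier S" and n: "R x n" and n': "R x n'" for x n n'
  proof -
    obtain u u' where u: "u \<in> U" "n \<in> N" "x = r x \<otimes> (u \<otimes> n)" "u' \<in> U" "n' \<in> N" "x = r x \<otimes> (u' \<otimes> n')"
      using n n' unfolding R_def by blast
    have c: "u \<in> carrier S" "n \<in> carrier S" "u' \<in> carrier S" "n' \<in> carrier S" "r x \<in> carrier S"
      using u U_carrier r[OF x] by auto
    have e: "r x \<otimes> (u \<otimes> n) = r x \<otimes> (u' \<otimes> n')" by (rule trans[OF u(3)[symmetric] u(6)])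
    have "inv (r x) \<otimes> (r x \<otimes> (u \<otimes> n)) = inv (r x) \<otimes> (r x \<otimes> (u' \<otimes> n'))" unfolding e ..
    then have "u \<otimes> n = u' \<otimes> n'" using c by (simp add: cancel)
    then have "inv u' \<otimes> (u \<otimes> n) = inv u' \<otimes> (u' \<otimes> n')" by simp
    then have n': "n' = (inv u' \<otimes> u) \<otimes> n" using c by (simp add: m_assoc[symmetric])
    then have "n' \<otimes> inv n = inv u' \<otimes> u" using c by (simp add: m_assoc)
    then have "inv u' \<otimes> u \<in> N" using N_mult[OF u(5) subgroup.m_inv_closed[OF N_subgroup u(2)]] by simp
    moreover have "inv u' \<otimes> u \<in> U"
      using u subgroup.m_closed[OF U_subgroup] subgroup.m_inv_closed[OF U_subgroup] by blast
    ultimately show ?thesis using \<psi>add[of "inv u' \<otimes> u" n] UN u(2) unfolding n' by simp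
  qed
  define y0 where "y0 x = \<psi> (SOME n. R x n)" for x
  have y0: "y0 x = \<psi> n" if "x \<in> carrier S" "R x n" for x n
    unfolding y0_def by (rule R_unique[OF that(1) _ that(2)], rule someI_ex[OF R_ex[OF that(1)]])
  have rW: "r (x \<otimes> w) = r x" if "x \<in> carrier S" "w \<in> W" for x w
    unfolding r_def W.proj_mult_N[OF that] ..
  have y0_N: "y0 (x \<otimes> m) = y0 x + \<psi> m" if x: "x \<in> carrier S" and m: "m \<in> N" for x m
  proof -
    obtain n where n: "R x n" using R_ex[OF x] by blast
    then obtain u where u: "u \<in> U" "n \<in> N" "x = r x \<otimes> (u \<otimes> n)" unfolding R_def by blast
    have c: "u \<in> carrier S" "n \<in> carrier S" "m \<in> carrier S" "r x \<in> carrier S"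
      using u m U_carrier r[OF x] by auto
    have "x \<otimes> m = r x \<otimes> (u \<otimes> (n \<otimes> m))" by (subst u(3)) (use c in \<open>simp add: m_assoc\<close>)
    then have "R (x \<otimes> m) (n \<otimes> m)"
      unfolding R_def rW[OF x N_W[OF m]] using N_mult[OF u(2) m] u(1) by blast
    then show ?thesis using y0[OF x n] y0[of "x \<otimes> m"] x c(3) \<psi>add[OF u(2) m] by simp
  qed
  \<comment> \<open>Normality of \<open>U\<close> moves \<open>v\<close> to the left of
    \<open>n\<close>, where \<open>u\<close> absorbs it. Invariance under the open subgroup
    \<open>U\<close> then gives local constancy.\<close>
  have y0_U: "y0 (x \<otimes> v) = y0 x" if x: "x \<in> carrier S" and v: "v \<in> U" for x v
  proof -
    obtain n where n: "R x n" using R_ex[OF x] by blast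
    then obtain u where u: "u \<in> U" "n \<in> N" "x = r x \<otimes> (u \<otimes> n)" unfolding R_def by blast
    have c: "u \<in> carrier S" "n \<in> carrier S" "v \<in> carrier S" "r x \<in> carrier S"
      using u v U_carrier r[OF x] by auto
    have "x \<otimes> v = r x \<otimes> (u \<otimes> (n \<otimes> v))" by (subst u(3)) (use c in \<open>simp add: m_assoc\<close>)
    also have "\<dots> = r x \<otimes> ((u \<otimes> (n \<otimes> v \<otimes> inv n)) \<otimes> n)"
      by (subst swap[OF c(2,3)]) (use c in \<open>simp add: m_assoc\<close>)
    finally have "R (x \<otimes> v) n"
      unfolding R_def rW[OF x U_W[OF v]]
      using u(2) subgroup.m_closed[OF U_subgroup u(1) U_conj[OF c(2) v]] by blast
    then show ?thesis using y0[OF x n] y0[of "x \<otimes> v"] x c(3) by simp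
  qed
  define y where "y x = (if x \<in> carrier S then y0 x else 0)" for x
  have "locally_const (topol S) y"
    unfolding locally_const_iff
  proof
    fix x assume "x \<in> topspace (topol S)"
    then have x: "x \<in> carrier S" by simp
    have cont: "continuous_map (topol S) (topol S) (\<lambda>t. inv x \<otimes> t)"
      using x by (intro continuous_mult' continuous_map_id[unfolded id_def]) auto
    let ?T = "{t \<in> topspace (topol S). inv x \<otimes> t \<in> U}"
    have "openin (topol S) ?T" by (rule openin_continuous_map_preimage[OF cont U_open])
    moreover have "x \<in> ?T" using x subgroup.one_closed[OF U_subgroup] by simp
    moreover have "y t = y x" if t: "t \<in> ?T" for t
    proof -
      have "t = x \<otimes> (inv x \<otimes> t)" using x t by (simp add: m_assoc[symmetric])
      then show ?thesis using y0_U[OF x, of "inv x \<otimes> t"] t x by (simp add: y_def)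
    qed
    ultimately show "\<exists>U. openin (topol S) U \<and> x \<in> U \<and> (\<forall>t\<in>U. y t = y x)" by blast
  qed
  then have "y \<in> cochains1 S" by (simp add: cochains1_iff y_def)
  moreover have "y (x \<otimes> n) = y x + \<psi> n" if "x \<in> carrier S" "n \<in> N" for x n
    using y0_N[OF that] that by (simp add: y_def)
  ultimately show ?thesis by blast
qed

text \<open>Right multiplication by \<open>N\<close> changes the extension of \<psi> by values of
  \<psi>. Together with the conjugation invariance of \<psi>, this makes its coboundary a function
  of cosets, which is the required cocycle on S/N.\<close>

lemma transgression_witness:
  assumes \<psi>: "\<psi> \<in> H1N"
  shows "\<exists>y\<in>cochains1 S. \<exists>z\<in>carrier (Z2 Q). (\<forall>x\<in>N. y x = \<psi> x) \<and>
    coboundary S y = pullback2 S proj z \<and> trg \<psi> = H2_class Q z"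
proof -
  have \<psi>add: "\<psi> (x \<otimes> y) = \<psi> x + \<psi> y" if "x \<in> N" "y \<in> N" for x y
    using \<psi> that unfolding H1_inv_iff by blast
  have \<psi>inv: "\<psi> (inv \<sigma> \<otimes> x \<otimes> \<sigma>) = \<psi> x" if "\<sigma> \<in> carrier S" "x \<in> N" for \<sigma> x
    using \<psi> that unfolding H1_inv_iff by blast
  obtain y1 where y1: "y1 \<in> cochains1 S" "\<And>x n. x \<in> carrier S \<Longrightarrow> n \<in> N \<Longrightarrow> y1 (x \<otimes> n) = y1 x + \<psi> n"
    using extend_invariant_hom[OF \<psi>] by blast
  \<comment> \<open>Subtracting the value at \<one> turns equivariance under \<open>N\<close> into
    agreement with \<psi> on \<open>N\<close>.\<close>
  define y where "y x = y1 x - (if x \<in> carrier S then y1 \<one> else 0)" for x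
  have "(\<lambda>x. if x \<in> carrier S then y1 \<one> else 0) \<in> cochains1 S"
    unfolding cochains1_iff using locally_const_cong[OF locally_const_const[of "topol S" "y1 \<one>"]] by simp
  then have y: "y \<in> cochains1 S" unfolding y_def[abs_def] by (rule cochains1_diff[OF y1(1)])
  have y_mult: "y (x \<otimes> n) = y x + \<psi> n" if "x \<in> carrier S" "n \<in> N" for x n
    using y1(2)[OF that] that by (simp add: y_def)
  have y_N: "y n = \<psi> n" if "n \<in> N" for n
    using y_mult[OF one_closed that] that by (simp add: y_def)
  have "\<exists>z\<in>cochains2 Q. pullback2 S proj z = coboundary S y"
  proof (rule descend2)
    show "locally_const (prod_topology (topol S) (topol S)) (coboundary S y)"
      using coboundary_in_Z2[OF y] by (simp add: carrier_Z2_iff cochains2_iff)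
    show "coboundary S y p = 0" if "p \<notin> carrier S \<times> carrier S" for p by (rule coboundary_outside[OF that])
    fix x n x' n' assume xn: "x \<in> carrier S" "n \<in> N" "x' \<in> carrier S" "n' \<in> N"
    have c: "n \<in> carrier S" "n' \<in> carrier S" using xn by auto
    \<comment> \<open>The factor \<open>n\<close> passes to the right of \<open>x'\<close> as a
      conjugate, on which \<psi> has the same value.\<close>
    have "x \<otimes> n \<otimes> (x' \<otimes> n') = x \<otimes> (x' \<otimes> inv x') \<otimes> n \<otimes> (x' \<otimes> n')" using xn c by simp
    also have "\<dots> = x \<otimes> x' \<otimes> ((inv x' \<otimes> n \<otimes> x') \<otimes> n')"
      using xn c by (simp only: m_assoc m_closed inv_closed)
    finally have e: "x \<otimes> n \<otimes> (x' \<otimes> n') = x \<otimes> x' \<otimes> ((inv x' \<otimes> n \<otimes> x') \<otimes> n')" .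
    have "y (x \<otimes> n \<otimes> (x' \<otimes> n')) = y (x \<otimes> x') + (\<psi> n + \<psi> n')"
      unfolding e using xn N_conj by (simp add: y_mult N_mult \<psi>add \<psi>inv)
    then show "coboundary S y (x \<otimes> n, x' \<otimes> n') = coboundary S y (x, x')"
      using xn c by (simp add: coboundary_apply y_mult)
  qed
  then obtain z where z: "z \<in> cochains2 Q" "pullback2 S proj z = coboundary S y" by blast
  have "z \<in> carrier (Z2 Q)" by (rule Z2_of_coboundary[OF y z(2)[symmetric] z(1)])
  moreover have "trg \<psi> = H2_class Q z" by (rule transgression_eqI[OF y z(2)[symmetric] z(1) y_N])
  ultimately show ?thesis using y z(2)[symmetric] y_N by blast
qed

text \<open>If the classes agree, the difference of the two cochains, corrected by the pullback of a
  cochain \<open>v\<close> on S/N, is a homomorphism on \<open>S\<close> and hence vanishes on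
  \<open>N\<close>. So \<psi> and \<psi>' differ on \<open>N\<close> by the constant value of
  \<open>v\<close> at the identity coset, and evaluation at \<one> shows that it is 0.\<close>

lemma transgression_inj: "inj_on trg H1N"
proof (rule inj_onI)
  fix \<psi> \<psi>' assume \<psi>: "\<psi> \<in> H1N" and \<psi>': "\<psi>' \<in> H1N" and eq: "trg \<psi> = trg \<psi>'"
  obtain y z where y: "y \<in> cochains1 S" "z \<in> carrier (Z2 Q)" "\<And>x. x \<in> N \<Longrightarrow> y x = \<psi> x" "coboundary S y = pullback2 S proj z"
    "trg \<psi> = H2_class Q z"
    using transgression_witness[OF \<psi>] by blast
  obtain y' z' where y': "y' \<in> cochains1 S" "z' \<in> carrier (Z2 Q)" "\<And>x. x \<in> N \<Longrightarrow> y' x = \<psi>' x" "coboundary S y' = pullback2 S proj z'"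
    "trg \<psi>' = H2_class Q z'"
    using transgression_witness[OF \<psi>'] by blast
  obtain v where v: "v \<in> cochains1 Q" "\<And>p. z p = z' p + coboundary Q v p"
    using Q.H2_class_eqD[of z z'] eq y(5) y'(5) by auto
  define d where "d x = y x - (y' x + pullback1 S proj v x)" for x
  have d: "d \<in> cochains1 S" unfolding d_def
    by (intro cochains1_diff cochains1_add y(1) y'(1) proj.pullback1_cochain v(1))
  have "z = (\<lambda>p. z' p + coboundary Q v p)" using v(2) by (rule ext)
  then have "coboundary S d = (\<lambda>p. 0)"
    unfolding d_def coboundary_diff coboundary_add proj.coboundary_pullback1 y(4) y'(4)
    by (simp add: proj.pullback2_add)
  then have d0: "d x = 0" if "x \<in> N" for x using hom_vanishes_on_N[OF d _ that] by blast
  have p: "proj x = proj \<one>" if "x \<in> N" for x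
    using coset_join2[OF _ N_subgroup] that N_one by simp
  have const: "\<psi> x = \<psi>' x + v (proj \<one>)" if "x \<in> N" for x
    using d0[OF that] that by (simp add: d_def y(3) y'(3) pullback1_def p)
  have "v (proj \<one>) = 0" using const[OF N_one] H1N_one[OF \<psi>] H1N_one[OF \<psi>'] by simp
  then have "\<psi> x = \<psi>' x" if "x \<in> N" for x using const[OF that] by simp
  moreover have "\<psi> x = \<psi>' x" if "x \<notin> N" for x using \<psi> \<psi>' that unfolding H1_inv_iff by simp
  ultimately show "\<psi> = \<psi>'" by blast
qed

text \<open>An inflated coboundary does not distinguish x \<in> N from \<one>, so \<open>y\<close>
  is additive whenever one factor lies in \<open>N\<close>. Evaluating both sides of s (s^-1 x s) =
  x s gives conjugation invariance.\<close>

lemma restriction_invariant: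
  fixes y :: "'a \<Rightarrow> 'm mod_ring"
  assumes y: "y \<in> cochains1 S" "coboundary S y = pullback2 S proj z" "y \<one> = 0"
  shows "(\<lambda>x. if x \<in> N then y x else 0) \<in> H1N"
proof -
  have p: "proj x = proj \<one>" if "x \<in> N" for x
    using coset_join2[OF _ N_subgroup] that N_one by simp
  have r: "y (s \<otimes> x) = y s + y x" if "s \<in> carrier S" "x \<in> N" for s x
  proof -
    have "coboundary S y (s, x) = coboundary S y (s, \<one>)" unfolding y(2) using that p[OF that(2)] by (simp add: pullback2_apply)
    then show ?thesis using that y(3) by (simp add: coboundary_apply)
  qed
  have l: "y (x \<otimes> s) = y x + y s" if "s \<in> carrier S" "x \<in> N" for s x
  proof -
    have "coboundary S y (x, s) = coboundary S y (\<one>, s)" unfolding y(2) using that p[OF that(2)] by (simp add: pullback2_apply)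
    then show ?thesis using that y(3) by (simp add: coboundary_apply)
  qed
  have c: "y (inv s \<otimes> x \<otimes> s) = y x" if s: "s \<in> carrier S" and x: "x \<in> N" for s x
  proof -
    have "s \<otimes> (inv s \<otimes> x \<otimes> s) = x \<otimes> s" using s x by (simp add: m_assoc[symmetric])
    then show ?thesis using r[OF s N_conj[OF s x]] l[OF s x] by simp
  qed
  have "locally_const (subtopology (topol S) N) y"
    using y(1) by (intro continuous_map_from_subtopology) (simp add: cochains1_iff)
  then have "locally_const (subtopology (topol S) N) (\<lambda>x. if x \<in> N then y x else 0)"
    by (rule locally_const_cong) simp
  then show ?thesis unfolding H1_inv_iff using N_mult N_conj by (simp add: r c)
qed

text \<open>Freeness of \<open>S\<close> kills the inflated class. The coboundary of a constant
  cochain is then subtracted to reach \<open>y \<one> = 0\<close>, as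
  \<open>restriction_invariant\<close> demands.\<close>

lemma H2_witness:
  fixes \<alpha> :: "('a set \<times> 'a set \<Rightarrow> 'm mod_ring) set"
  assumes "\<alpha> \<in> carrier (H2 Q)"
  shows "\<exists>y\<in>cochains1 S. \<exists>z\<in>carrier (Z2 Q). \<alpha> = H2_class Q z \<and> coboundary S y = pullback2 S proj z \<and> y \<one> = 0"
proof -
  obtain z0 where z0: "z0 \<in> carrier (Z2 Q)" "\<alpha> = H2_class Q z0" using assms by (rule Q.H2_cases)
  obtain y0 where y0: "y0 \<in> cochains1 S" "coboundary S y0 = pullback2 S proj z0"
    using Z2_is_coboundary[OF proj.pullback2_Z2[OF z0(1)]] by blast
  define k where "k q = (if q \<in> carrier Q then y0 \<one> else 0)" for q
  have k: "k \<in> cochains1 Q"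
    unfolding cochains1_iff k_def
    using locally_const_cong[OF locally_const_const[of "topol Q" "y0 \<one>"]] by (simp add: topspace_Q)
  define z where "z p = z0 p - coboundary Q k p" for p
  define y where "y x = y0 x - pullback1 S proj k x" for x
  have z: "z \<in> carrier (Z2 Q)" unfolding z_def[abs_def] by (rule Q.Z2_diff_closed[OF z0(1) Q.coboundary_in_Z2[OF k]])
  have "\<alpha> = H2_class Q z" unfolding z0(2) by (rule Q.H2_class_eqI[OF k]) (simp add: z_def)
  moreover have "y \<in> cochains1 S" unfolding y_def[abs_def] by (rule cochains1_diff[OF y0(1) proj.pullback1_cochain[OF k]])
  moreover have "coboundary S y = pullback2 S proj z"
  proof -
    have "pullback2 S proj z0 = (\<lambda>p. pullback2 S proj z p + pullback2 S proj (coboundary Q k) p)"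
      unfolding proj.pullback2_add[symmetric] by (simp add: z_def)
    then show ?thesis unfolding y_def[abs_def] coboundary_diff y0(2) proj.coboundary_pullback1 by simp
  qed
  moreover have "y \<one> = 0" by (simp add: y_def pullback1_def k_def proj_closed)
  ultimately show ?thesis using z by blast
qed

lemma transgression_surj:
  assumes "\<alpha> \<in> carrier (H2 Q)"
  shows "\<exists>\<psi>\<in>H1N. trg \<psi> = \<alpha>"
proof -
  obtain y z where y: "y \<in> cochains1 S" "z \<in> carrier (Z2 Q)" "\<alpha> = H2_class Q z" "coboundary S y = pullback2 S proj z" "y \<one> = 0"
    using H2_witness[OF assms] by blast
  show ?thesis
  proof (rule bexI)
    show "(\<lambda>x. if x \<in> N then y x else 0) \<in> H1N" by (rule restriction_invariant[OF y(1,4,5)])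
    show "trg (\<lambda>x. if x \<in> N then y x else 0) = \<alpha>"
      unfolding y(3) by (rule transgression_eqI[OF y(1,4)]) (use y(2) in \<open>simp_all add: carrier_Z2_iff\<close>)
  qed
qed

lemma transgression_closed: "\<psi> \<in> H1N \<Longrightarrow> trg \<psi> \<in> carrier (H2 Q)"
  using transgression_witness Q.H2_class_closed by metis

lemma transgression_add:
  assumes \<psi>: "\<psi> \<in> H1N" and \<psi>': "\<psi>' \<in> H1N"
  shows "trg (\<lambda>x. \<psi> x + \<psi>' x) = trg \<psi> \<otimes>\<^bsub>H2 Q\<^esub> trg \<psi>'"
proof -
  obtain y z where y: "y \<in> cochains1 S" "z \<in> carrier (Z2 Q)" "\<And>x. x \<in> N \<Longrightarrow> y x = \<psi> x" "coboundary S y = pullback2 S proj z"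
    "trg \<psi> = H2_class Q z"
    using transgression_witness[OF \<psi>] by blast
  obtain y' z' where y': "y' \<in> cochains1 S" "z' \<in> carrier (Z2 Q)" "\<And>x. x \<in> N \<Longrightarrow> y' x = \<psi>' x" "coboundary S y' = pullback2 S proj z'"
    "trg \<psi>' = H2_class Q z'"
    using transgression_witness[OF \<psi>'] by blast
  show ?thesis
    unfolding y(5) y'(5) Q.H2_mult[OF y(2) y'(2)]
  proof (rule transgression_eqI[OF cochains1_add[OF y(1) y'(1)]])
    show "coboundary S (\<lambda>x. y x + y' x) = pullback2 S proj (\<lambda>p. z p + z' p)"
      unfolding coboundary_add proj.pullback2_add y(4) y'(4) ..
    show "(\<lambda>p. z p + z' p) \<in> cochains2 Q" using Q.Z2_add_closed[OF y(2) y'(2)] by (simp add: carrier_Z2_iff)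
    show "y x + y' x = \<psi> x + \<psi>' x" if "x \<in> N" for x using y(3) y'(3) that by simp
  qed
qed

end

section \<open>Evaluation of the transgression pairing\<close>

locale closed_transgression_setup = transgression_setup A S N ty
  for A :: "'a set" and S :: "'a top_group" (structure) and N and ty :: "'m::nontriv itself" +
  assumes N_closed: "closedin (topol S) N"
begin

text \<open>The kernel of \<psi> in the closed subgroup \<open>N\<close> is a closed subgroup of
  \<open>S\<close>. It contains m-th powers because m kills the values, and commutators because
  \<psi> is invariant.\<close>

lemma power_commutator_vanishing:
  assumes \<psi>: "\<psi> \<in> H1N" and p: "p \<in> power_commutator_subgroup CARD('m) S N"
  shows "p \<in> N" "\<psi> p = 0"
proof -
  have \<psi>c: "locally_const (subtopology (topol S) N) \<psi>"
    and \<psi>add: "\<And>x y. x \<in> N \<Longrightarrow> y \<in> N \<Longrightarrow> \<psi> (x \<otimes> y) = \<psi> x + \<psi> y"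
    and \<psi>inv: "\<And>\<sigma> x. \<sigma> \<in> carrier S \<Longrightarrow> x \<in> N \<Longrightarrow> \<psi> (inv \<sigma> \<otimes> x \<otimes> \<sigma>) = \<psi> x"
    using \<psi> unfolding H1_inv_iff by blast+
  let ?K = "{x \<in> N. \<psi> x = 0}"
  let ?X = "{x [^] CARD('m) | x. x \<in> N} \<union> {\<sigma> \<otimes> x \<otimes> inv \<sigma> \<otimes> inv x | \<sigma> x. \<sigma> \<in> carrier S \<and> x \<in> N}"
  have \<psi>_minv: "\<psi> (inv x) = - \<psi> x" if "x \<in> N" for x
    using \<psi>add[OF subgroup.m_inv_closed[OF N_subgroup that] that] that H1N_one[OF \<psi>]
    by (simp add: eq_neg_iff_add_eq_0)
  have sub: "subgroup ?K S"
  proof (rule subgroupI)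
    show "?K \<noteq> {}" using N_one H1N_one[OF \<psi>] by blast
  qed (auto simp: \<psi>_minv subgroup.m_inv_closed[OF N_subgroup] N_mult \<psi>add)
  have pow: "x [^] k \<in> N \<and> \<psi> (x [^] k) = of_nat k * \<psi> x" if "x \<in> N" for x and k :: nat
  proof (induction k)
    case 0
    show ?case using N_one H1N_one[OF \<psi>] by simp
  next
    case (Suc k)
    then show ?case using that by (simp add: N_mult \<psi>add algebra_simps)
  qed
  have "?X \<subseteq> ?K"
  proof
    fix g assume "g \<in> ?X"
    then consider x where "x \<in> N" "g = x [^] CARD('m)"
      | \<sigma> x where "\<sigma> \<in> carrier S" "x \<in> N" "g = \<sigma> \<otimes> x \<otimes> inv \<sigma> \<otimes> inv x" by blast
    then show "g \<in> ?K"
    proof cases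
      case 1
      then show ?thesis using pow[OF 1(1), of "CARD('m)"] by simp
    next
      case 2
      have c: "\<sigma> \<otimes> x \<otimes> inv \<sigma> \<in> N" "\<psi> (\<sigma> \<otimes> x \<otimes> inv \<sigma>) = \<psi> x"
        using N_conj[OF inv_closed[OF 2(1)] 2(2)] \<psi>inv[OF inv_closed[OF 2(1)] 2(2)] 2(1) by simp_all
      have i: "inv x \<in> N" by (rule subgroup.m_inv_closed[OF N_subgroup 2(2)])
      show ?thesis unfolding 2(3) using N_mult[OF c(1) i] \<psi>add[OF c(1) i] c(2) \<psi>_minv[OF 2(2)] by simp
    qed
  qed
  then have "generate S ?X \<subseteq> ?K" by (rule generate_subgroup_incl[OF _ sub])
  moreover have "closedin (topol S) ?K"
  proof -
    have "closedin (subtopology (topol S) N) {x \<in> topspace (subtopology (topol S) N). \<psi> x \<in> {0}}"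
      by (rule closedin_continuous_map_preimage[OF \<psi>c]) simp
    then have "closedin (topol S) {x \<in> topspace (subtopology (topol S) N). \<psi> x \<in> {0}}"
      by (rule closedin_trans_full[OF _ N_closed])
    moreover have "{x \<in> topspace (subtopology (topol S) N). \<psi> x \<in> {0}} = ?K"
      using N_subset by auto
    ultimately show ?thesis by simp
  qed
  ultimately have "power_commutator_subgroup CARD('m) S N \<subseteq> ?K"
    unfolding power_commutator_subgroup_def by (rule closure_of_minimal)
  then show "p \<in> N" "\<psi> p = 0" using p by blast+
qed

text \<open>Injectivity of the transgression recovers \<psi>, which is constant on the coset by
  \<open>power_commutator_vanishing\<close>; the coset contains \<sigma>, so the definite
  description has exactly one solution.\<close>

lemma trg_pairing_eq:
  assumes \<psi>: "\<psi> \<in> H1N" and \<sigma>: "\<sigma> \<in> N"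
  shows "trg_pairing S N (power_commutator_subgroup CARD('m) S N #> \<sigma>) (trg \<psi>) = \<psi> \<sigma>"
proof -
  let ?P = "power_commutator_subgroup CARD('m) S N"
  let ?X = "{x [^] CARD('m) | x. x \<in> N} \<union> {\<sigma> \<otimes> x \<otimes> inv \<sigma> \<otimes> inv x | \<sigma> x. \<sigma> \<in> carrier S \<and> x \<in> N}"
  have i: "inv_into H1N trg (trg \<psi>) = \<psi>" by (rule inv_into_f_f[OF transgression_inj \<psi>])
  have "?X \<subseteq> carrier S" by auto
  then have "generate S ?X \<subseteq> topspace (topol S)" using generate_incl by auto
  then have "\<one> \<in> ?P"
    unfolding power_commutator_subgroup_def using closure_of_subset generate.one by blast
  then have "\<sigma> \<in> ?P #> \<sigma>" unfolding r_coset_def using \<sigma> by force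
  moreover have "\<psi> \<tau> = \<psi> \<sigma>" if "\<tau> \<in> ?P #> \<sigma>" for \<tau>
  proof -
    obtain p where "p \<in> ?P" "\<tau> = p \<otimes> \<sigma>" using \<open>\<tau> \<in> ?P #> \<sigma>\<close> unfolding r_coset_def by blast
    moreover have "\<psi> (p \<otimes> \<sigma>) = \<psi> p + \<psi> \<sigma>" if "p \<in> N" using \<psi> \<sigma> that unfolding H1_inv_iff by blast
    ultimately show ?thesis using power_commutator_vanishing[OF \<psi>] by simp
  qed
  ultimately show ?thesis
    unfolding trg_pairing_def i
  proof (intro the_equality ballI)
    fix r assume "\<sigma> \<in> ?P #> \<sigma>" "\<forall>\<tau>\<in>?P #> \<sigma>. \<psi> \<tau> = r"
    then have "\<psi> \<sigma> = r" by blast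
    then show "r = \<psi> \<sigma>" ..
  qed
qed

end

subsection \<open>Unitriangular representations\<close>

lemma sum_triangle_swap:
  fixes g :: "nat \<Rightarrow> nat \<Rightarrow> 'b::comm_monoid_add"
  shows "(\<Sum>r = 1..<n. \<Sum>s = 1..<r. g s r) = (\<Sum>s = 1..<n. \<Sum>r = Suc s..<n. g s r)"
proof -
  have "(\<Sum>r = 1..<n. \<Sum>s = 1..<r. g s r) = (\<Sum>(r, s)\<in>(SIGMA r:{1..<n}. {1..<r}). g s r)"
    by (simp add: sum.Sigma)
  also have "\<dots> = (\<Sum>(s, r)\<in>(SIGMA s:{1..<n}. {Suc s..<n}). g s r)"
    by (rule sum.reindex_bij_witness[where i = prod.swap and j = prod.swap]) auto
  also have "\<dots> = (\<Sum>s = 1..<n. \<Sum>r = Suc s..<n. g s r)"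
    by (simp add: sum.Sigma)
  finally show ?thesis .
qed

lemma massey_cochain_apply: "massey_cochain c i j (x, y) = - (\<Sum>r = i..<j. c i r x * c (r + 1) j y)"
  by (simp add: massey_cochain_def cup_def)

context top_grp
begin

lemma defining_system_cochain:
  "defining_system G n c \<Longrightarrow> 1 \<le> i \<Longrightarrow> i \<le> j \<Longrightarrow> j \<le> n \<Longrightarrow> (i, j) \<noteq> (1, n) \<Longrightarrow> c i j \<in> cochains1 G"
  unfolding defining_system_def by blast

lemma defining_system_mult:
  assumes "defining_system G n c" "1 \<le> i" "i \<le> j" "j \<le> n" "(i, j) \<noteq> (1, n)" "x \<in> carrier G" "y \<in> carrier G"
  shows "c i j (x \<otimes> y) = c i j x + c i j y + (\<Sum>r = i..<j. c i r x * c (r + 1) j y)"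
proof -
  have "coboundary G (c i j) = massey_cochain c i j"
    using assms(1-5) unfolding defining_system_def by blast
  then have "coboundary G (c i j) (x, y) = massey_cochain c i j (x, y)" by simp
  then have "c i j x + c i j y - c i j (x \<otimes> y) = - (\<Sum>r = i..<j. c i r x * c (r + 1) j y)"
    using assms(6,7) by (simp add: coboundary_apply massey_cochain_apply)
  then show ?thesis by (simp add: algebra_simps)
qed

text \<open>Expanding the entries at products by their defining equations leaves on both sides of
  the cocycle identity the same sum, over pairs of cuts s < r below n, of products of three
  entries.\<close>

lemma massey_cochain_in_Z2:
  assumes c: "defining_system G n c"
  shows "massey_cochain c 1 n \<in> carrier (Z2 G)"
  unfolding carrier_Z2_iff
proof (intro conjI ballI)
  let ?X = "prod_topology (topol G) (topol G)"
  have c1: "c 1 r \<in> cochains1 G" "c (r + 1) n \<in> cochains1 G" if "r \<in> {1..<n}" for r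
    using that by (intro defining_system_cochain[OF c]; simp)+
  have lc: "locally_const (topol G) (c 1 r)" "locally_const (topol G) (c (r + 1) n)" if "r \<in> {1..<n}" for r
    using c1[OF that] by (simp_all add: cochains1_iff)
  have "locally_const ?X (\<lambda>p. - (\<Sum>r = 1..<n. c 1 r (fst p) * c (r + 1) n (snd p)))"
    by (intro locally_const_uminus locally_const_sum locally_const_mult
        locally_const_compose[OF continuous_map_fst lc(1)] locally_const_compose[OF continuous_map_snd lc(2)])
  then have "locally_const ?X (massey_cochain c 1 n)"
    by (rule locally_const_cong) (simp add: massey_cochain_def cup_def case_prod_beta')
  moreover have "massey_cochain c 1 n p = 0" if "p \<notin> carrier G \<times> carrier G" for p
  proof -
    obtain x y where p: "p = (x, y)" by (cases p)
    have "c 1 r x * c (r + 1) n y = 0" if r: "r \<in> {1..<n}" for r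
      using cochains1_outside[OF c1(1)[OF r], of x] cochains1_outside[OF c1(2)[OF r], of y]
        \<open>p \<notin> carrier G \<times> carrier G\<close> by (auto simp: p)
    then show ?thesis by (simp add: p massey_cochain_apply)
  qed
  ultimately show "massey_cochain c 1 n \<in> cochains2 G" by (simp add: cochains2_iff)
  fix x y t assume xyt: "x \<in> carrier G" "y \<in> carrier G" "t \<in> carrier G"
  let ?T = "\<lambda>x y. \<Sum>r = 1..<n. c 1 r x * c (r + 1) n y"
  have "?T (x \<otimes> y) t = (\<Sum>r = 1..<n. (c 1 r x + c 1 r y + (\<Sum>s = 1..<r. c 1 s x * c (s + 1) r y)) * c (r + 1) n t)"
    by (rule sum.cong[OF refl], subst defining_system_mult[OF c _ _ _ _ xyt(1,2)]) auto
  also have "\<dots> = ?T x t + ?T y t + (\<Sum>r = 1..<n. \<Sum>s = 1..<r. c 1 s x * c (s + 1) r y * c (r + 1) n t)"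
    by (simp add: distrib_right sum.distrib sum_distrib_right)
  finally have l: "?T (x \<otimes> y) t = ?T x t + ?T y t + (\<Sum>s = 1..<n. \<Sum>r = Suc s..<n. c 1 s x * c (s + 1) r y * c (r + 1) n t)"
    unfolding sum_triangle_swap .
  have "?T x (y \<otimes> t) = (\<Sum>s = 1..<n. c 1 s x * (c (s + 1) n y + c (s + 1) n t + (\<Sum>r = s + 1..<n. c (s + 1) r y * c (r + 1) n t)))"
    by (rule sum.cong[OF refl], subst defining_system_mult[OF c _ _ _ _ xyt(2,3)]) auto
  also have "\<dots> = ?T x y + ?T x t + (\<Sum>s = 1..<n. \<Sum>r = Suc s..<n. c 1 s x * c (s + 1) r y * c (r + 1) n t)"
    by (simp add: distrib_left sum.distrib sum_distrib_left mult.assoc)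
  finally have "?T x y + ?T (x \<otimes> y) t = ?T y t + ?T x (y \<otimes> t)" unfolding l by (simp add: algebra_simps)
  then have "- ?T x y + - ?T (x \<otimes> y) t = - ?T y t + - ?T x (y \<otimes> t)"
    by (simp only: minus_add_distrib[symmetric])
  then show "massey_cochain c 1 n (x, y) + massey_cochain c 1 n (x \<otimes> y, t) =
      massey_cochain c 1 n (y, t) + massey_cochain c 1 n (x, y \<otimes> t)"
    unfolding massey_cochain_apply .
qed

end

text \<open>Congruence modulo the series of order at least \<open>k\<close>; the filtration step S_k
  is the preimage of the class of 1.\<close>

definition agree_below :: "nat \<Rightarrow> ('a list \<Rightarrow> 'r) \<Rightarrow> ('a list \<Rightarrow> 'r) \<Rightarrow> bool" where
  "agree_below k f g \<longleftrightarrow> (\<forall>w. length w < k \<longrightarrow> f w = g w)"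

lemma agree_below_convolution:
  fixes f g :: "'a list \<Rightarrow> 'r::comm_ring_1"
  assumes "agree_below k f f'" "agree_below k g g'"
  shows "agree_below k (convolution f g) (convolution f' g')"
  unfolding agree_below_def
proof (intro allI impI)
  fix w :: "'a list" assume "length w < k"
  then show "convolution f g w = convolution f' g' w"
    using assms unfolding convolution_def agree_below_def by (intro sum.cong) auto
qed

lemma agree_below_refl: "agree_below k f f"
  by (simp add: agree_below_def)

lemma agree_below_sym: "agree_below k f g \<Longrightarrow> agree_below k g f"
  by (simp add: agree_below_def)

lemma convolution_split:
  assumes "w \<noteq> []"
  shows "convolution f g w = f [] * g w + f w * g [] + (\<Sum>i = 1..<length w. f (take i w) * g (drop i w))"
proof -
  have "{..length w} = insert 0 (insert (length w) {1..<length w})" by auto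
  then show ?thesis using assms unfolding convolution_def by (simp add: algebra_simps)
qed

section \<open>The Magnus filtration\<close>

context free_profinite
begin

abbreviation \<Lambda> :: "'m::nontriv itself \<Rightarrow> 'a \<Rightarrow> 'a list \<Rightarrow> 'm mod_ring" where
  "\<Lambda> ty \<equiv> magnus A S"

lemma magnus_filtration_iff:
  fixes ty :: "'m::nontriv itself"
  shows "\<sigma> \<in> magnus_filtration ty A S k \<longleftrightarrow> \<sigma> \<in> carrier S \<and> agree_below k (\<Lambda> ty \<sigma>) series_one"
proof -
  have "(\<forall>w\<in>lists A. 1 \<le> length w \<and> length w < k \<longrightarrow> \<Lambda> ty \<sigma> w = 0) \<longleftrightarrow> agree_below k (\<Lambda> ty \<sigma>) series_one"
    if \<sigma>: "\<sigma> \<in> carrier S"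
  proof
    assume l: "\<forall>w\<in>lists A. 1 \<le> length w \<and> length w < k \<longrightarrow> \<Lambda> ty \<sigma> w = 0"
    show "agree_below k (\<Lambda> ty \<sigma>) series_one"
      unfolding agree_below_def
    proof (intro allI impI)
      fix w :: "'a list" assume w: "length w < k"
      show "\<Lambda> ty \<sigma> w = series_one w"
      proof (cases "w = []")
        case True
        then show ?thesis using \<sigma> by simp
      next
        case False
        then have "1 \<le> length w" by (simp add: Suc_le_eq)
        then have "\<Lambda> ty \<sigma> w = 0" using l w magnus_outside[OF \<sigma>, of w] by blast
        then show ?thesis using False by (simp add: series_one_def)
      qed
    qed
  next
    assume "agree_below k (\<Lambda> ty \<sigma>) series_one"
    then show "\<forall>w\<in>lists A. 1 \<le> length w \<and> length w < k \<longrightarrow> \<Lambda> ty \<sigma> w = 0"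
      unfolding agree_below_def by (auto simp: series_one_def)
  qed
  then show ?thesis unfolding magnus_filtration_def by blast
qed

text \<open>Convolution respects congruence modulo order \<open>k\<close>, so the truncated Magnus
  map is still multiplicative and the filtration step is its kernel.\<close>

lemma magnus_filtration_normal: "magnus_filtration (ty :: 'm::nontriv itself) A S k \<lhd> S"
  unfolding normal_inv_iff
proof (intro conjI ballI)
  let ?T = "magnus_filtration ty A S k"
  show "subgroup ?T S"
  proof (rule subgroupI)
    show "?T \<subseteq> carrier S" by (auto simp: magnus_filtration_iff)
    have "\<one> \<in> ?T" by (simp add: magnus_filtration_iff magnus_one agree_below_refl)
    then show "?T \<noteq> {}" by blast
    fix a assume a: "a \<in> ?T"
    then have ac: "a \<in> carrier S" "agree_below k (\<Lambda> ty a) series_one" by (auto simp: magnus_filtration_iff)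
    have "agree_below k (convolution (\<Lambda> ty (inv a)) series_one) (convolution (\<Lambda> ty (inv a)) (\<Lambda> ty a))"
      by (rule agree_below_convolution[OF agree_below_refl agree_below_sym[OF ac(2)]])
    also have "convolution (\<Lambda> ty (inv a)) (\<Lambda> ty a) = series_one"
      using ac(1) by (simp add: magnus_mult[symmetric] magnus_one)
    finally show "inv a \<in> ?T" using ac(1) by (simp add: magnus_filtration_iff)
    fix b assume b: "b \<in> ?T"
    then have bc: "b \<in> carrier S" "agree_below k (\<Lambda> ty b) series_one" by (auto simp: magnus_filtration_iff)
    have "agree_below k (convolution (\<Lambda> ty a) (\<Lambda> ty b)) (convolution series_one series_one)"
      by (rule agree_below_convolution[OF ac(2) bc(2)])
    then show "a \<otimes> b \<in> ?T" using ac bc by (simp add: magnus_filtration_iff magnus_mult)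
  qed
  fix x h assume x: "x \<in> carrier S" and "h \<in> ?T"
  then have h: "h \<in> carrier S" "agree_below k (\<Lambda> ty h) series_one" by (auto simp: magnus_filtration_iff)
  have "agree_below k (convolution (convolution (\<Lambda> ty x) (\<Lambda> ty h)) (\<Lambda> ty (inv x)))
      (convolution (convolution (\<Lambda> ty x) series_one) (\<Lambda> ty (inv x)))"
    by (intro agree_below_convolution agree_below_refl h(2))
  also have "convolution (convolution (\<Lambda> ty x) series_one) (\<Lambda> ty (inv x)) = series_one"
    using x by (simp add: magnus_mult[symmetric] magnus_one)
  finally show "x \<otimes> h \<otimes> inv x \<in> ?T"
    using x h(1) by (simp add: magnus_filtration_iff magnus_mult)
qed

lemma magnus_mult_filtration:
  fixes ty :: "'m::nontriv itself"
  assumes "x \<in> carrier S" "t \<in> magnus_filtration ty A S k" "length w < k"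
  shows "\<Lambda> ty (x \<otimes> t) w = \<Lambda> ty x w" "\<Lambda> ty (t \<otimes> x) w = \<Lambda> ty x w"
proof -
  have t: "t \<in> carrier S" "agree_below k (\<Lambda> ty t) series_one" using assms(2) by (auto simp: magnus_filtration_iff)
  have "agree_below k (convolution (\<Lambda> ty x) (\<Lambda> ty t)) (convolution (\<Lambda> ty x) series_one)"
    "agree_below k (convolution (\<Lambda> ty t) (\<Lambda> ty x)) (convolution series_one (\<Lambda> ty x))"
    by (intro agree_below_convolution agree_below_refl t(2))+
  then show "\<Lambda> ty (x \<otimes> t) w = \<Lambda> ty x w" "\<Lambda> ty (t \<otimes> x) w = \<Lambda> ty x w"
    using assms(1,3) t(1) by (simp_all add: magnus_mult agree_below_def)
qed

lemma magnus_filtration_zero: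
  fixes ty :: "'m::nontriv itself"
  assumes "\<sigma> \<in> magnus_filtration ty A S k" "length w < k" "w \<noteq> []"
  shows "\<Lambda> ty \<sigma> w = 0"
  using assms by (simp add: magnus_filtration_iff agree_below_def series_one_def)

text \<open>Each mixed term of the product formula contains the coefficient of \<open>t\<close> at a
  nonempty proper suffix of \<open>w\<close>, which is 0.\<close>

lemma magnus_filtration_additive:
  fixes ty :: "'m::nontriv itself"
  assumes x: "x \<in> carrier S" and t: "t \<in> magnus_filtration ty A S k" and w: "length w = k" "w \<noteq> []"
  shows "\<Lambda> ty (x \<otimes> t) w = \<Lambda> ty x w + \<Lambda> ty t w"
proof -
  have tc: "t \<in> carrier S" using t by (simp add: magnus_filtration_iff)
  have "(\<Sum>i = 1..<length w. \<Lambda> ty x (take i w) * \<Lambda> ty t (drop i w)) = 0"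
  proof (rule sum.neutral, intro ballI)
    fix i assume "i \<in> {1..<length w}"
    then have "\<Lambda> ty t (drop i w) = 0" using w by (intro magnus_filtration_zero[OF t]) auto
    then show "\<Lambda> ty x (take i w) * \<Lambda> ty t (drop i w) = 0" by simp
  qed
  then show ?thesis using x tc by (simp add: magnus_mult convolution_split[OF w(2)] add.commute)
qed

end

text \<open>Rows and columns of matrices are indexed by \<open>0, \<dots>, n\<close>.\<close>

abbreviation kronecker :: "nat \<Rightarrow> nat \<Rightarrow> 'r::zero_neq_one" where
  "kronecker p q \<equiv> (if p = q then 1 else 0)"

text \<open>\<open>R_one\<close> excludes maps that send \<one> to an idempotent matrix other than
  the identity, which multiplicativity alone would allow.\<close>

locale matrix_representation = free_profinite A S for A :: "'a set" and S :: "'a top_group" (structure) +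
  fixes n :: nat and R :: "nat \<Rightarrow> nat \<Rightarrow> 'a \<Rightarrow> 'm::nontriv mod_ring"
  assumes R_cont: "p \<le> n \<Longrightarrow> q \<le> n \<Longrightarrow> locally_const (topol S) (R p q)"
    and R_mult: "p \<le> n \<Longrightarrow> q \<le> n \<Longrightarrow> x \<in> carrier S \<Longrightarrow> y \<in> carrier S \<Longrightarrow>
      R p q (x \<otimes> y) = (\<Sum>r\<le>n. R p r x * R r q y)"
    and R_one: "p \<le> n \<Longrightarrow> q \<le> n \<Longrightarrow> R p q \<one> = kronecker p q"

lemma matrix_representation_eqI:
  fixes R T :: "nat \<Rightarrow> nat \<Rightarrow> 'a \<Rightarrow> 'm::nontriv mod_ring"
  assumes "matrix_representation A S n R" "matrix_representation A S n T"
    and eq: "\<And>p q a. p \<le> n \<Longrightarrow> q \<le> n \<Longrightarrow> a \<in> A \<Longrightarrow> R p q a = T p q a"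
    and pq: "p \<le> n" "q \<le> n" and x: "x \<in> carrier S"
  shows "R p q x = T p q x"
proof -
  interpret R: matrix_representation A S n R by fact
  interpret T: matrix_representation A S n T by fact
  have "\<forall>p\<le>n. \<forall>q\<le>n. R p q y = T p q y" if "y \<in> generate S A" for y
    using that
  proof induction
    case (inv h)
    then have h: "h \<in> carrier S" "inv\<^bsub>S\<^esub> h \<in> carrier S" using R.basis_subset by auto
    show ?case
    proof (intro allI impI)
      fix p q assume pq: "p \<le> n" "q \<le> n"
      \<comment> \<open>For g = h^-1: T(g) = T(g) R(h) R(g) = T(g) T(h) R(g) = R(g), using R(h) =
        T(h) for the basis element \<open>h\<close>.\<close>
      have "T p q (inv\<^bsub>S\<^esub> h) = (\<Sum>r\<le>n. T p r (inv\<^bsub>S\<^esub> h) * kronecker r q)"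
        using pq by (simp add: if_distrib[of "times _"] cong: if_cong)
      also have "\<dots> = (\<Sum>r\<le>n. T p r (inv\<^bsub>S\<^esub> h) * (\<Sum>s\<le>n. R r s h * R s q (inv\<^bsub>S\<^esub> h)))"
      proof (rule sum.cong[OF refl])
        fix r assume "r \<in> {..n}"
        then have "(\<Sum>s\<le>n. R r s h * R s q (inv\<^bsub>S\<^esub> h)) = kronecker r q"
          using R.R_mult[of r q h "inv\<^bsub>S\<^esub> h"] R.R_one[of r q] pq h by simp
        then show "T p r (inv\<^bsub>S\<^esub> h) * kronecker r q = T p r (inv\<^bsub>S\<^esub> h) * (\<Sum>s\<le>n. R r s h * R s q (inv\<^bsub>S\<^esub> h))"
          by (simp only:)
      qed
      also have "\<dots> = (\<Sum>r\<le>n. \<Sum>s\<le>n. T p r (inv\<^bsub>S\<^esub> h) * T r s h * R s q (inv\<^bsub>S\<^esub> h))"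
        using eq inv by (simp add: sum_distrib_left mult.assoc)
      also have "\<dots> = (\<Sum>s\<le>n. \<Sum>r\<le>n. T p r (inv\<^bsub>S\<^esub> h) * T r s h * R s q (inv\<^bsub>S\<^esub> h))"
        by (rule sum.swap)
      also have "\<dots> = (\<Sum>s\<le>n. kronecker p s * R s q (inv\<^bsub>S\<^esub> h))"
      proof (rule sum.cong[OF refl])
        fix s assume "s \<in> {..n}"
        then have "(\<Sum>r\<le>n. T p r (inv\<^bsub>S\<^esub> h) * T r s h) = kronecker p s"
          using T.R_mult[of p s "inv\<^bsub>S\<^esub> h" h] T.R_one[of p s] pq h by simp
        then show "(\<Sum>r\<le>n. T p r (inv\<^bsub>S\<^esub> h) * T r s h * R s q (inv\<^bsub>S\<^esub> h)) = kronecker p s * R s q (inv\<^bsub>S\<^esub> h)"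
          by (simp only: sum_distrib_right[symmetric])
      qed
      also have "\<dots> = R p q (inv\<^bsub>S\<^esub> h)"
        using pq by (simp add: if_distrib[of "\<lambda>c. c * _"] cong: if_cong)
      finally show "R p q (inv\<^bsub>S\<^esub> h) = T p q (inv\<^bsub>S\<^esub> h)" by simp
    qed
  next
    case (eng h1 h2)
    then have "h1 \<in> carrier S" "h2 \<in> carrier S" using R.generate_in_carrier[OF R.basis_subset] by auto
    then show ?case using eng.IH by (simp add: R.R_mult T.R_mult)
  qed (simp_all add: eq R.R_one T.R_one)
  then have gen: "R p q y = T p q y" if "y \<in> generate S A" for y
    using that pq by blast
  have cl: "x \<in> Abstract_Topology.closure_of (topol S) (generate S A)"
    using x R.basis_dense by simp
  show ?thesis
    by (rule locally_const_eq_on_closure[OF R.R_cont[OF pq] T.R_cont[OF pq] cl gen])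
qed

locale unitriangular_representation = matrix_representation +
  assumes R_lower: "p \<le> n \<Longrightarrow> q \<le> n \<Longrightarrow> q < p \<Longrightarrow> x \<in> carrier S \<Longrightarrow> R p q x = 0"
    and R_diag: "p \<le> n \<Longrightarrow> x \<in> carrier S \<Longrightarrow> R p p x = 1"
    and n_pos: "0 < n"
begin

definition gen_matrix :: "'a \<Rightarrow> nat \<Rightarrow> nat \<Rightarrow> 'b mod_ring" where
  "gen_matrix a p q = R p q a - kronecker p q"

fun word_matrix :: "'a list \<Rightarrow> nat \<Rightarrow> nat \<Rightarrow> 'b mod_ring" where
  "word_matrix [] p q = kronecker p q"
| "word_matrix (a # v) p q = (\<Sum>r\<le>n. gen_matrix a p r * word_matrix v r q)"

lemma gen_matrix_strict:
  assumes "a \<in> A" "p \<le> n" "q \<le> n" "q \<le> p"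
  shows "gen_matrix a p q = 0"
proof -
  have "a \<in> carrier S" using assms(1) basis_subset by blast
  then show ?thesis using assms R_lower[of p q a] R_diag[of p a] by (cases "q = p") (auto simp: gen_matrix_def)
qed

text \<open>Each letter moves at least one step to the right of the diagonal. So words of more than
  \<open>n\<close> letters contribute nothing, which makes the substitution of matrices for the
  variables a finite sum.\<close>

lemma word_matrix_strict:
  "v \<in> lists A \<Longrightarrow> p \<le> n \<Longrightarrow> q \<le> n \<Longrightarrow> q < p + length v \<Longrightarrow> word_matrix v p q = 0"
proof (induction v arbitrary: p)
  case (Cons a v)
  have "gen_matrix a p r * word_matrix v r q = 0" if "r \<le> n" for r
  proof (cases "r \<le> p")
    case True
    then show ?thesis using gen_matrix_strict[of a p r] Cons.prems that by simp
  next
    case False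
    then have "word_matrix v r q = 0" using Cons.prems that by (intro Cons.IH) auto
    then show ?thesis by simp
  qed
  then show ?case by simp
qed auto

lemma word_matrix_append:
  "p \<le> n \<Longrightarrow> word_matrix (u @ v) p q = (\<Sum>r\<le>n. word_matrix u p r * word_matrix v r q)"
proof (induction u arbitrary: p)
  case Nil
  then show ?case by (simp add: if_distrib[of "\<lambda>c. c * _"] cong: if_cong)
next
  case (Cons a u)
  have "word_matrix ((a # u) @ v) p q = (\<Sum>s\<le>n. gen_matrix a p s * (\<Sum>r\<le>n. word_matrix u s r * word_matrix v r q))"
    using Cons.IH by simp
  also have "\<dots> = (\<Sum>s\<le>n. \<Sum>r\<le>n. gen_matrix a p s * word_matrix u s r * word_matrix v r q)"
    by (simp add: sum_distrib_left mult.assoc)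
  also have "\<dots> = (\<Sum>r\<le>n. \<Sum>s\<le>n. gen_matrix a p s * word_matrix u s r * word_matrix v r q)"
    by (rule sum.swap)
  finally show ?case by (simp add: sum_distrib_right)
qed

text \<open>The letters not represented by the identity matrix. They are finite in number because
  the entries are locally constant and the basis converges to 1.\<close>

definition gen_support :: "'a set" where
  "gen_support = {a \<in> A. \<exists>p\<le>n. \<exists>q\<le>n. gen_matrix a p q \<noteq> 0}"

lemma finite_gen_support: "finite gen_support"
proof -
  have "gen_support \<subseteq> (\<Union>p\<in>{..n}. \<Union>q\<in>{..n}. {a \<in> A. R p q a \<noteq> R p q \<one>})"
  proof
    fix a assume "a \<in> gen_support"
    then obtain p q where a: "a \<in> A" "p \<le> n" "q \<le> n" "gen_matrix a p q \<noteq> 0"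
      unfolding gen_support_def by blast
    then have "R p q a \<noteq> R p q \<one>" using R_one[of p q] by (simp add: gen_matrix_def)
    then show "a \<in> (\<Union>p\<in>{..n}. \<Union>q\<in>{..n}. {a \<in> A. R p q a \<noteq> R p q \<one>})" using a by blast
  qed
  moreover have "finite (\<Union>p\<in>{..n}. \<Union>q\<in>{..n}. {a \<in> A. R p q a \<noteq> R p q \<one>})"
    using R_cont by (intro finite_UN_I finite_basis_support) auto
  ultimately show ?thesis by (rule finite_subset)
qed

definition support_words :: "'a list set" where
  "support_words = {v \<in> lists gen_support. length v \<le> n}"

lemma finite_support_words: "finite support_words"
proof -
  have "support_words = {v. set v \<subseteq> gen_support \<and> length v \<le> n}" by (auto simp: support_words_def)
  then show ?thesis using finite_lists_length_le[OF finite_gen_support] by simp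
qed

lemma support_words_lists: "v \<in> support_words \<Longrightarrow> v \<in> lists A"
  unfolding support_words_def gen_support_def by auto

text \<open>The image of the Magnus series under the substitution of \<open>gen_matrix a\<close> for
  X_a, with the vanishing terms left out.\<close>

definition expansion :: "nat \<Rightarrow> nat \<Rightarrow> 'a \<Rightarrow> 'b mod_ring" where
  "expansion p q x = (\<Sum>v\<in>support_words. magnus A S x v * word_matrix v p q)"

lemma expansion_mult:
  assumes pq: "p \<le> n" "q \<le> n" and xy: "x \<in> carrier S" "y \<in> carrier S"
  shows "expansion p q (x \<otimes> y) = (\<Sum>r\<le>n. expansion p r x * expansion r q y)"
proof -
  let ?g = "\<lambda>u v. magnus A S x u * magnus A S y v * word_matrix (u @ v) p q"
  have "expansion p q (x \<otimes> y) = (\<Sum>w\<in>support_words. \<Sum>i\<le>length w. ?g (take i w) (drop i w))"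
    unfolding expansion_def by (simp add: magnus_mult[OF xy] convolution_def sum_distrib_right)
  also have "\<dots> = (\<Sum>(w, i)\<in>(SIGMA w:support_words. {..length w}). ?g (take i w) (drop i w))"
    by (rule sum.Sigma) (simp_all add: finite_support_words)
  also have "\<dots> = (\<Sum>(u, v)\<in>{(u, v). u \<in> support_words \<and> v \<in> support_words \<and> length u + length v \<le> n}. ?g u v)"
    by (rule sum.reindex_bij_witness[where i = "\<lambda>(u, v). (u @ v, length u)" and j = "\<lambda>(w, i). (take i w, drop i w)"])
      (auto simp: support_words_def dest: in_set_takeD in_set_dropD)
  \<comment> \<open>Pairs of total length above \<open>n\<close> are added back at no cost: the
    matrix of \<open>u @ v\<close> is 0 for them.\<close>
  also have "\<dots> = (\<Sum>(u, v)\<in>support_words \<times> support_words. ?g u v)"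
  proof (rule sum.mono_neutral_left)
    show "finite (support_words \<times> support_words)" using finite_support_words by simp
    show "\<forall>w\<in>support_words \<times> support_words - {(u, v). u \<in> support_words \<and> v \<in> support_words \<and> length u + length v \<le> n}.
        (case w of (u, v) \<Rightarrow> ?g u v) = 0"
    proof (intro ballI)
      fix w assume "w \<in> support_words \<times> support_words - {(u, v). u \<in> support_words \<and> v \<in> support_words \<and> length u + length v \<le> n}"
      then obtain u v where w: "w = (u, v)" "u \<in> support_words" "v \<in> support_words" "n < length u + length v"
        by fastforce
      have "word_matrix (u @ v) p q = 0"
        using w pq support_words_lists by (intro word_matrix_strict) auto
      then show "(case w of (u, v) \<Rightarrow> ?g u v) = 0" by (simp add: w(1))
    qed
  qed auto
  also have "\<dots> = (\<Sum>u\<in>support_words. \<Sum>v\<in>support_words. ?g u v)"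
    by (simp add: sum.cartesian_product)
  also have "\<dots> = (\<Sum>u\<in>support_words. \<Sum>v\<in>support_words. \<Sum>r\<le>n.
      (magnus A S x u * word_matrix u p r) * (magnus A S y v * word_matrix v r q))"
    unfolding word_matrix_append[OF pq(1)] by (simp add: sum_distrib_left mult_ac)
  also have "\<dots> = (\<Sum>u\<in>support_words. \<Sum>r\<le>n. \<Sum>v\<in>support_words.
      (magnus A S x u * word_matrix u p r) * (magnus A S y v * word_matrix v r q))"
    by (rule sum.cong[OF refl], rule sum.swap)
  also have "\<dots> = (\<Sum>r\<le>n. \<Sum>u\<in>support_words. \<Sum>v\<in>support_words.
      (magnus A S x u * word_matrix u p r) * (magnus A S y v * word_matrix v r q))"
    by (rule sum.swap)
  also have "\<dots> = (\<Sum>r\<le>n. expansion p r x * expansion r q y)"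
    unfolding expansion_def sum_product ..
  finally show ?thesis .
qed

lemma Nil_support_words: "[] \<in> support_words"
  by (simp add: support_words_def)

lemma expansion_one: "expansion p q \<one> = kronecker p q"
proof -
  have "expansion p q \<one> = (\<Sum>v\<in>{[]}. magnus A S \<one> v * word_matrix v p q)"
    unfolding expansion_def
    by (rule sum.mono_neutral_right) (simp_all add: finite_support_words Nil_support_words magnus_one series_one_def)
  then show ?thesis by (simp add: magnus_one)
qed

text \<open>The series 1 + X_a leaves only the words \<open>[]\<close> and \<open>[a]\<close>, that
  is, the identity plus \<open>gen_matrix a\<close>. Positivity of \<open>n\<close> keeps one-letter
  words within the length bound.\<close>

lemma expansion_gen:
  assumes a: "a \<in> A" and pq: "p \<le> n" "q \<le> n"
  shows "expansion p q a = R p q a"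
proof -
  have M: "word_matrix [a] p q = gen_matrix a p q"
    using pq by (simp add: if_distrib[of "times _"] cong: if_cong)
  have s: "expansion p q a = (\<Sum>v\<in>{[], [a]} \<inter> support_words. word_matrix v p q)"
  proof -
    have "expansion p q a = (\<Sum>v\<in>{[], [a]} \<inter> support_words. magnus A S a v * word_matrix v p q)"
      unfolding expansion_def
      by (rule sum.mono_neutral_right) (auto simp: finite_support_words magnus_properties(3)[OF a])
    also have "\<dots> = (\<Sum>v\<in>{[], [a]} \<inter> support_words. word_matrix v p q)"
      by (rule sum.cong[OF refl]) (auto simp: magnus_properties(3)[OF a])
    finally show ?thesis .
  qed
  show ?thesis
  proof (cases "a \<in> gen_support")
    case True
    then have "{[], [a]} \<inter> support_words = {[], [a]}"
      using n_pos by (auto simp: support_words_def Suc_le_eq)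
    then have "expansion p q a = word_matrix [] p q + word_matrix [a] p q" by (simp add: s)
    then show ?thesis unfolding M by (simp add: gen_matrix_def)
  next
    case False
    then have "{[], [a]} \<inter> support_words = {[]}" by (auto simp: support_words_def)
    then have "expansion p q a = kronecker p q" by (simp add: s)
    moreover have "gen_matrix a p q = 0" using False a pq by (auto simp: gen_support_def)
    ultimately show ?thesis by (simp add: gen_matrix_def)
  qed
qed

lemma matrix_representation_expansion: "matrix_representation A S n expansion"
proof unfold_locales
  show "locally_const (topol S) (expansion p q)" for p q
    unfolding expansion_def[abs_def]
    by (intro locally_const_sum locally_const_mult locally_const_const locally_const_magnus)
qed (rule expansion_mult expansion_one; assumption)+

text \<open>On S_n the coefficients at nonempty words shorter than \<open>n\<close> vanish, and the
  empty word contributes the identity matrix, whose corner entry is 0 because n > 0.\<close>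

lemma corner_expansion:
  fixes ty :: "'b itself"
  shows "\<exists>F d. finite F \<and> F \<subseteq> {w \<in> lists A. length w = n} \<and>
     (\<forall>x\<in>magnus_filtration ty A S n. R 0 n x = (\<Sum>w\<in>F. d w * magnus A S x w))"
proof (intro exI conjI ballI)
  let ?F = "{w \<in> support_words. length w = n}"
  show "finite ?F" using finite_support_words by simp
  show "?F \<subseteq> {w \<in> lists A. length w = n}" using support_words_lists by blast
  fix x assume x: "x \<in> magnus_filtration ty A S n"
  then have xc: "x \<in> carrier S" by (simp add: magnus_filtration_iff)
  have "R 0 n x = expansion 0 n x"
    by (rule matrix_representation_eqI[OF matrix_representation_axioms matrix_representation_expansion _ _ _ xc])
      (simp_all add: expansion_gen)
  also have "\<dots> = (\<Sum>v\<in>?F. magnus A S x v * word_matrix v 0 n)"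
    unfolding expansion_def
  proof (rule sum.mono_neutral_right[OF finite_support_words])
    show "\<forall>v\<in>support_words - ?F. magnus A S x v * word_matrix v 0 n = 0"
    proof
      fix v assume v: "v \<in> support_words - ?F"
      then have "length v < n" by (auto simp: support_words_def)
      then show "magnus A S x v * word_matrix v 0 n = 0"
        using magnus_filtration_zero[OF x, of v] n_pos by (cases "v = []") auto
    qed
  qed auto
  finally show "R 0 n x = (\<Sum>w\<in>?F. word_matrix w 0 n * magnus A S x w)" by (simp only: mult.commute)
qed

end

subsection \<open>Massey products\<close>

locale massey_setup = closed_transgression_setup A S N ty
  for A :: "'a set" and S :: "'a top_group" (structure) and N and ty :: "'m::nontriv itself" +
  fixes n :: nat
  assumes n2: "2 \<le> n" and Nn: "N \<subseteq> magnus_filtration ty A S n"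
begin

abbreviation words :: "'a list set" where "words \<equiv> {w \<in> lists A. length w = n}"

lemma n_pos: "0 < n" using n2 by simp

lemma words_not_Nil: "w \<in> words \<Longrightarrow> w \<noteq> []" using n_pos by auto

lemma magnus_add_N:
  assumes "x \<in> carrier S" "\<nu> \<in> N" "w \<in> words"
  shows "\<Lambda> ty (x \<otimes> \<nu>) w = \<Lambda> ty x w + \<Lambda> ty \<nu> w"
  using assms Nn words_not_Nil by (intro magnus_filtration_additive[where k = n]) auto

text \<open>A combination of coefficients is used twice: on all of \<open>S\<close>, as a cochain
  that computes a transgression, and on \<open>N\<close> as \<open>combo\<close>, the homomorphism
  that is transgressed.\<close>

definition combo_ext :: "('a list \<Rightarrow> 'm mod_ring) \<Rightarrow> 'a list set \<Rightarrow> 'a \<Rightarrow> 'm mod_ring" where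
  "combo_ext d F x = (if x \<in> carrier S then \<Sum>w\<in>F. d w * \<Lambda> ty x w else 0)"

definition combo :: "('a list \<Rightarrow> 'm mod_ring) \<Rightarrow> 'a list set \<Rightarrow> 'a \<Rightarrow> 'm mod_ring" where
  "combo d F x = (if x \<in> N then \<Sum>w\<in>F. d w * \<Lambda> ty x w else 0)"

text \<open>The span \<open>E\<close> of the overview. Finite subsets appear because
  \<open>words\<close> is infinite when \<open>A\<close> is.\<close>

definition combos :: "('a \<Rightarrow> 'm mod_ring) set" where
  "combos = {combo d F |d F. finite F \<and> F \<subseteq> words}"

lemma combo_ext_cochain: "combo_ext d F \<in> cochains1 S"
proof -
  have "locally_const (topol S) (\<lambda>x. \<Sum>w\<in>F. d w * \<Lambda> ty x w)"
    by (intro locally_const_sum locally_const_mult locally_const_const locally_const_magnus)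
  then have "locally_const (topol S) (combo_ext d F)" by (rule locally_const_cong) (simp add: combo_ext_def)
  then show ?thesis by (simp add: cochains1_iff combo_ext_def)
qed

lemma combo_ext_eq_combo: "x \<in> N \<Longrightarrow> combo_ext d F x = combo d F x"
  by (simp add: combo_ext_def combo_def)

lemma combo_ext_one: "F \<subseteq> words \<Longrightarrow> combo_ext d F \<one> = 0"
  unfolding combo_ext_def using words_not_Nil by (auto intro!: sum.neutral simp: magnus_one series_one_def)

text \<open>Only coefficients at proper nonempty prefixes and suffixes survive. As N \<le> S_n,
  these are constant on cosets of \<open>N\<close>, so the coboundary descends to S/N although the
  cochain itself need not.\<close>

lemma coboundary_combo_ext:
  assumes F: "F \<subseteq> words" and xy: "x \<in> carrier S" "y \<in> carrier S"
  shows "coboundary S (combo_ext d F) (x, y) = - (\<Sum>w\<in>F. d w * (\<Sum>i = 1..<n. \<Lambda> ty x (take i w) * \<Lambda> ty y (drop i w)))"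
proof -
  have "(\<Sum>w\<in>F. d w * \<Lambda> ty (x \<otimes> y) w) =
      (\<Sum>w\<in>F. d w * \<Lambda> ty x w + d w * \<Lambda> ty y w + d w * (\<Sum>i = 1..<n. \<Lambda> ty x (take i w) * \<Lambda> ty y (drop i w)))"
  proof (rule sum.cong[OF refl])
    fix w assume "w \<in> F"
    then have w: "w \<noteq> []" "length w = n" using F words_not_Nil by auto
    show "d w * \<Lambda> ty (x \<otimes> y) w =
        d w * \<Lambda> ty x w + d w * \<Lambda> ty y w + d w * (\<Sum>i = 1..<n. \<Lambda> ty x (take i w) * \<Lambda> ty y (drop i w))"
      by (simp add: magnus_mult xy convolution_split[OF w(1)] w(2) distrib_left)
  qed
  then show ?thesis using xy by (simp add: coboundary_apply combo_ext_def sum.distrib)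
qed

lemma combo_ext_witness:
  assumes F: "F \<subseteq> words"
  shows "\<exists>z\<in>cochains2 Q. pullback2 S proj z = coboundary S (combo_ext d F)"
proof (rule descend2)
  show "locally_const (prod_topology (topol S) (topol S)) (coboundary S (combo_ext d F))"
    using coboundary_in_Z2[OF combo_ext_cochain] by (simp add: carrier_Z2_iff cochains2_iff)
  show "coboundary S (combo_ext d F) p = 0" if "p \<notin> carrier S \<times> carrier S" for p by (rule coboundary_outside[OF that])
  fix x \<nu> x' \<nu>' assume x: "x \<in> carrier S" "\<nu> \<in> N" "x' \<in> carrier S" "\<nu>' \<in> N"
  have c: "x \<otimes> \<nu> \<in> carrier S" "x' \<otimes> \<nu>' \<in> carrier S" using x by auto
  have "(\<Sum>w\<in>F. d w * (\<Sum>i = 1..<n. \<Lambda> ty (x \<otimes> \<nu>) (take i w) * \<Lambda> ty (x' \<otimes> \<nu>') (drop i w))) =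
      (\<Sum>w\<in>F. d w * (\<Sum>i = 1..<n. \<Lambda> ty x (take i w) * \<Lambda> ty x' (drop i w)))"
  proof (rule sum.cong[OF refl])
    fix w assume "w \<in> F"
    then have w: "length w = n" using F by auto
    have "\<Lambda> ty (x \<otimes> \<nu>) (take i w) * \<Lambda> ty (x' \<otimes> \<nu>') (drop i w) = \<Lambda> ty x (take i w) * \<Lambda> ty x' (drop i w)"
      if "i \<in> {1..<n}" for i
    proof -
      have "\<nu> \<in> magnus_filtration ty A S n" "\<nu>' \<in> magnus_filtration ty A S n" using x Nn by auto
      moreover have "length (take i w) < n" "length (drop i w) < n" using w that by auto
      ultimately show ?thesis using x by (simp add: magnus_mult_filtration(1)[where k = n])
    qed
    then have "(\<Sum>i = 1..<n. \<Lambda> ty (x \<otimes> \<nu>) (take i w) * \<Lambda> ty (x' \<otimes> \<nu>') (drop i w)) =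
        (\<Sum>i = 1..<n. \<Lambda> ty x (take i w) * \<Lambda> ty x' (drop i w))"
      by (rule sum.cong[OF refl])
    then show "d w * (\<Sum>i = 1..<n. \<Lambda> ty (x \<otimes> \<nu>) (take i w) * \<Lambda> ty (x' \<otimes> \<nu>') (drop i w)) =
        d w * (\<Sum>i = 1..<n. \<Lambda> ty x (take i w) * \<Lambda> ty x' (drop i w))"
      by (rule arg_cong)
  qed
  then show "coboundary S (combo_ext d F) (x \<otimes> \<nu>, x' \<otimes> \<nu>') = coboundary S (combo_ext d F) (x, x')"
    by (simp only: coboundary_combo_ext[OF F c] coboundary_combo_ext[OF F x(1,3)])
qed

lemma combo_invariant:
  assumes F: "F \<subseteq> words"
  shows "combo d F \<in> H1N"
proof -
  obtain z where "pullback2 S proj z = coboundary S (combo_ext d F)" using combo_ext_witness[OF F] by blast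
  from restriction_invariant[OF combo_ext_cochain this[symmetric] combo_ext_one[OF F]]
  have "(\<lambda>x. if x \<in> N then combo_ext d F x else 0) \<in> H1N" .
  moreover have "(\<lambda>x. if x \<in> N then combo_ext d F x else 0) = combo d F"
    by (rule ext) (simp add: combo_ext_def combo_def)
  ultimately show ?thesis by simp
qed

lemma combos_invariant: "\<psi> \<in> combos \<Longrightarrow> \<psi> \<in> H1N"
  unfolding combos_def using combo_invariant by blast

lemma combos_subgroup: "coordinate_subgroup combos"
proof
  have "combo (\<lambda>_. 0) {} = (\<lambda>_. 0)" by (rule ext) (simp add: combo_def)
  then show "(\<lambda>_. 0) \<in> combos" unfolding combos_def by (metis (mono_tags, lifting) empty_subsetI finite.emptyI mem_Collect_eq)
  fix f g assume "f \<in> combos" "g \<in> combos"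
  then obtain d F d' F' where f: "f = combo d F" "finite F" "F \<subseteq> words" and g: "g = combo d' F'" "finite F'" "F' \<subseteq> words"
    unfolding combos_def by blast
  let ?d = "\<lambda>w. (if w \<in> F then d w else 0) + (if w \<in> F' then d' w else 0)"
  have "(\<lambda>x. f x + g x) = combo ?d (F \<union> F')"
  proof
    fix x
    have "(\<Sum>w\<in>F. d w * \<Lambda> ty x w) = (\<Sum>w\<in>F \<union> F'. (if w \<in> F then d w else 0) * \<Lambda> ty x w)"
      by (rule sum.mono_neutral_cong_left) (use f g in auto)
    moreover have "(\<Sum>w\<in>F'. d' w * \<Lambda> ty x w) = (\<Sum>w\<in>F \<union> F'. (if w \<in> F' then d' w else 0) * \<Lambda> ty x w)"
      by (rule sum.mono_neutral_cong_left) (use f g in auto)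
    ultimately show "f x + g x = combo ?d (F \<union> F') x"
      by (simp add: f(1) g(1) combo_def distrib_right sum.distrib)
  qed
  then show "(\<lambda>x. f x + g x) \<in> combos"
    unfolding combos_def using f g by blast
qed

sublocale combos: coordinate_subgroup combos by (rule combos_subgroup)

text \<open>With entries the coefficients at the subwords of \<open>w\<close>, the product formula
  for the Magnus map becomes the defining equations. The scalar \<open>a\<close> is put into the
  first row: every product with an entry of that row contains exactly one, so the system scales
  consistently and multiples of a Massey product are obtained as Massey products.\<close>

lemma word_massey:
  assumes w: "w \<in> words"
  shows "\<exists>c. defining_system Q n c \<and> trg (combo (\<lambda>_. a) {w}) = H2_class Q (massey_cochain c 1 n)"
proof -
  have lw: "length w = n" using w by simp
  \<comment> \<open>The letters of \<open>w\<close> in positions i to j, counted from 1.\<close>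
  define sub where "sub i j = take (j + 1 - i) (drop (i - 1) w)" for i j :: nat
  define Y where "Y i j x = (if x \<in> carrier S then (if i = 1 then a else 1) * \<Lambda> ty x (sub i j) else 0)" for i j :: nat and x
  have Y_cochain: "Y i j \<in> cochains1 S" for i j
  proof -
    have "locally_const (topol S) (\<lambda>x. (if i = 1 then a else 1) * \<Lambda> ty x (sub i j))"
      by (intro locally_const_mult locally_const_const locally_const_magnus)
    then have "locally_const (topol S) (Y i j)" by (rule locally_const_cong) (simp add: Y_def)
    then show ?thesis by (simp add: cochains1_iff Y_def)
  qed
  have Y_mult: "Y i j (x \<otimes> y) = Y i j x + Y i j y + (\<Sum>r = i..<j. Y i r x * Y (r + 1) j y)"
    if ij: "1 \<le> i" "i \<le> j" "j \<le> n" and xy: "x \<in> carrier S" "y \<in> carrier S" for i j x y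
  proof -
    have ls: "length (sub i j) = j + 1 - i" using ij lw by (simp add: sub_def)
    then have ne: "sub i j \<noteq> []" using ij by (metis Suc_eq_plus1 Suc_diff_le list.size(3) nat.distinct(1))
    have "(\<Sum>k = 1..<length (sub i j). \<Lambda> ty x (take k (sub i j)) * \<Lambda> ty y (drop k (sub i j))) =
        (\<Sum>r = i..<j. \<Lambda> ty x (sub i r) * \<Lambda> ty y (sub (r + 1) j))"
    \<comment> \<open>A prefix of length k of the subword ends at position r = k + i - 1.\<close>
    proof (rule sum.reindex_bij_witness[where i = "\<lambda>r. r + 1 - i" and j = "\<lambda>k. k + i - 1"])
      fix k assume k: "k \<in> {1..<length (sub i j)}"
      show "k + i - 1 + 1 - i = k" using k ij by simp
      show "k + i - 1 \<in> {i..<j}" using k ls ij by auto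
      have e: "k + i - 1 + 1 - i = k" "j + 1 - i - k = j + 1 - (k + i - 1 + 1)" "k + (i - 1) = k + i - 1 + 1 - 1"
        using ij k by auto
      have "take k (sub i j) = sub i (k + i - 1)"
        using k ls unfolding sub_def e(1) by (simp add: min_def)
      moreover have "drop k (sub i j) = sub (k + i - 1 + 1) j"
        unfolding sub_def drop_take drop_drop e(2) e(3) ..
      ultimately show "\<Lambda> ty x (sub i (k + i - 1)) * \<Lambda> ty y (sub (k + i - 1 + 1) j) =
          \<Lambda> ty x (take k (sub i j)) * \<Lambda> ty y (drop k (sub i j))" by simp
    next
      fix r assume r: "r \<in> {i..<j}"
      show "r + 1 - i + i - 1 = r" using r ij by simp
      show "r + 1 - i \<in> {1..<length (sub i j)}" using r ls ij by auto
    qed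
    then have m: "\<Lambda> ty (x \<otimes> y) (sub i j) = \<Lambda> ty y (sub i j) + \<Lambda> ty x (sub i j) +
        (\<Sum>r = i..<j. \<Lambda> ty x (sub i r) * \<Lambda> ty y (sub (r + 1) j))"
      using xy by (simp add: magnus_mult convolution_split[OF ne])
    have "Y i r x * Y (r + 1) j y = (if i = 1 then a else 1) * (\<Lambda> ty x (sub i r) * \<Lambda> ty y (sub (r + 1) j))"
      if "r \<in> {i..<j}" for r
      using that ij xy by (simp add: Y_def mult.assoc)
    then have "(\<Sum>r = i..<j. Y i r x * Y (r + 1) j y) =
        (if i = 1 then a else 1) * (\<Sum>r = i..<j. \<Lambda> ty x (sub i r) * \<Lambda> ty y (sub (r + 1) j))"
      unfolding sum_distrib_left by (intro sum.cong) auto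
    then show ?thesis using xy by (simp add: Y_def m algebra_simps)
  qed
  have "\<exists>c. 1 \<le> i \<and> i \<le> j \<and> j \<le> n \<and> (i, j) \<noteq> (1, n) \<longrightarrow> c \<in> cochains1 Q \<and> (\<forall>x\<in>carrier S. c (proj x) = Y i j x)" for i j
  proof (cases "1 \<le> i \<and> i \<le> j \<and> j \<le> n \<and> (i, j) \<noteq> (1, n)")
    case True
    then have len: "length (sub i j) < n" using lw by (auto simp: sub_def)
    have "\<exists>c\<in>cochains1 Q. \<forall>x\<in>carrier S. c (proj x) = Y i j x"
    proof (rule descend1)
      show "locally_const (topol S) (Y i j)" using Y_cochain[of i j] by (simp add: cochains1_iff)
      show "Y i j (x \<otimes> \<nu>) = Y i j x" if "x \<in> carrier S" "\<nu> \<in> N" for x \<nu>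
        using that Nn magnus_mult_filtration(1)[where ty = ty and k = n, OF that(1) _ len] by (auto simp: Y_def)
    qed
    then show ?thesis by blast
  qed blast
  then obtain c where c: "\<And>i j. 1 \<le> i \<Longrightarrow> i \<le> j \<Longrightarrow> j \<le> n \<Longrightarrow> (i, j) \<noteq> (1, n) \<Longrightarrow>
      c i j \<in> cochains1 Q \<and> (\<forall>x\<in>carrier S. c i j (proj x) = Y i j x)"
    by metis
  \<comment> \<open>Since r < j \<le> n and r + 1 > 1, neither factor has the index (1, n), for
    which no cochain on S/N was chosen.\<close>
  have prod: "c i r (proj x) * c (r + 1) j (proj y) = Y i r x * Y (r + 1) j y"
    if "1 \<le> i" "j \<le> n" "r \<in> {i..<j}" "x \<in> carrier S" "y \<in> carrier S" for i j r x y
    using that c[of i r] c[of "r + 1" j] by simp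
  \<comment> \<open>Below (1, n) these are the defining equations; at (1, n) they exhibit the
    inflated Massey cocycle as the coboundary of \<open>Y 1 n\<close>.\<close>
  have mc: "massey_cochain c i j (proj x, proj y) = coboundary S (Y i j) (x, y)"
    if "1 \<le> i" "i \<le> j" "j \<le> n" "x \<in> carrier S" "y \<in> carrier S" for i j x y
  proof -
    have "(\<Sum>r = i..<j. c i r (proj x) * c (r + 1) j (proj y)) = (\<Sum>r = i..<j. Y i r x * Y (r + 1) j y)"
      using that by (intro sum.cong[OF refl] prod) auto
    then show ?thesis using Y_mult[OF that] that by (simp add: massey_cochain_apply coboundary_apply)
  qed
  have ds: "defining_system Q n c"
    unfolding defining_system_def
  proof (intro allI impI)
    fix i j assume "1 \<le> i \<and> i \<le> j \<and> j \<le> n \<and> (i, j) \<noteq> (1, n)"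
    then have ij: "1 \<le> i" "i \<le> j" "j \<le> n" "(i, j) \<noteq> (1, n)" by blast+
    have "coboundary Q (c i j) = massey_cochain c i j"
    proof (rule ext_on_pairs[of "carrier Q"])
      fix p q assume "p \<in> carrier Q" "q \<in> carrier Q"
      then obtain x y where xy: "x \<in> carrier S" "y \<in> carrier S" "p = proj x" "q = proj y"
        by (auto simp: carrier_Q)
      have "coboundary Q (c i j) (p, q) = coboundary S (Y i j) (x, y)"
        using c[OF ij] xy by (simp add: coboundary_apply mult_Q proj_closed)
      then show "coboundary Q (c i j) (p, q) = massey_cochain c i j (p, q)"
        using mc[OF ij(1-3) xy(1,2)] xy by simp
    next
      fix p assume p: "p \<notin> carrier Q \<times> carrier Q"
      then show "coboundary Q (c i j) p = 0" by (rule coboundary_outside)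
      obtain q q' where pq: "p = (q, q')" by (cases p)
      have "c i r q * c (r + 1) j q' = 0" if r: "r \<in> {i..<j}" for r
      proof -
        have "c i r \<in> cochains1 Q" "c (r + 1) j \<in> cochains1 Q"
          using c[of i r] c[of "r + 1" j] ij r by auto
        then show ?thesis using cochains1_outside[of "c i r" Q q] cochains1_outside[of "c (r + 1) j" Q q'] p
          by (auto simp: pq)
      qed
      then show "massey_cochain c i j p = 0" by (simp add: pq massey_cochain_apply)
    qed
    then show "c i j \<in> cochains1 Q \<and> coboundary Q (c i j) = massey_cochain c i j" using c[OF ij] by blast
  qed
  have "trg (combo (\<lambda>_. a) {w}) = H2_class Q (massey_cochain c 1 n)"
  proof (rule transgression_eqI[OF Y_cochain[of 1 n]])
    show "coboundary S (Y 1 n) = pullback2 S proj (massey_cochain c 1 n)"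
      by (rule ext_on_pairs[of "carrier S"])
        (use n_pos in \<open>simp_all add: coboundary_outside pullback2_outside pullback2_apply mc\<close>)
    show "massey_cochain c 1 n \<in> cochains2 Q"
      using Q.massey_cochain_in_Z2[OF ds] by (simp add: carrier_Z2_iff)
    show "Y 1 n x = combo (\<lambda>_. a) {w} x" if "x \<in> N" for x
      using that lw by (simp add: Y_def combo_def sub_def)
  qed
  then show ?thesis using ds by blast
qed

text \<open>A defining system on \<open>S/N\<close> together with a cochain trivialising the inflated Massey cocycle is
  a unitriangular representation of \<open>S\<close>; its corner entry is a combination of Magnus coefficients.\<close>

lemma massey_is_combo:
  fixes c :: "nat \<Rightarrow> nat \<Rightarrow> 'a set \<Rightarrow> 'm mod_ring"
  assumes ds: "defining_system Q n c"
  shows "\<exists>\<psi>\<in>combos. trg \<psi> = H2_class Q (massey_cochain c 1 n)"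
proof -
  have z: "massey_cochain c 1 n \<in> carrier (Z2 Q)" by (rule Q.massey_cochain_in_Z2[OF ds])
  obtain y where y: "y \<in> cochains1 S" "coboundary S y = pullback2 S proj (massey_cochain c 1 n)"
    using Z2_is_coboundary[OF proj.pullback2_Z2[OF z]] by blast
  \<comment> \<open>The corner missing from a defining system is filled with the cochain that
    trivialises the inflated Massey cocycle.\<close>
  define b where "b i j = (if (i, j) = (1, n) then y else pullback1 S proj (c i j))" for i j
  have b_cochain: "b i j \<in> cochains1 S" if "1 \<le> i" "i \<le> j" "j \<le> n" for i j
    using that y(1) proj.pullback1_cochain[OF Q.defining_system_cochain[OF ds that]] by (auto simp: b_def)
  have b_apply: "b i j x = c i j (proj x)" if "(i, j) \<noteq> (1, n)" "x \<in> carrier S" for i j x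
    using that by (auto simp: b_def pullback1_apply)
  have b_mult: "b i j (x \<otimes> x') = b i j x + b i j x' + (\<Sum>r = i..<j. b i r x * b (r + 1) j x')"
    if ij: "1 \<le> i" "i \<le> j" "j \<le> n" and x: "x \<in> carrier S" "x' \<in> carrier S" for i j x x'
  proof -
    have s: "(\<Sum>r = i..<j. b i r x * b (r + 1) j x') = (\<Sum>r = i..<j. c i r (proj x) * c (r + 1) j (proj x'))"
    proof (rule sum.cong[OF refl])
      fix r assume r: "r \<in> {i..<j}"
      have ne: "(i, r) \<noteq> (1, n)" "(r + 1, j) \<noteq> (1, n)" using r ij by auto
      show "b i r x * b (r + 1) j x' = c i r (proj x) * c (r + 1) j (proj x')"
        unfolding b_apply[OF ne(1) x(1)] b_apply[OF ne(2) x(2)] ..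
    qed
    show ?thesis
    proof (cases "(i, j) = (1, n)")
      case True
      have "coboundary S y (x, x') = massey_cochain c 1 n (proj x, proj x')"
        unfolding y(2) using x by (simp add: pullback2_apply)
      then have "y (x \<otimes> x') = y x + y x' + (\<Sum>r = i..<j. c i r (proj x) * c (r + 1) j (proj x'))"
        using x True by (simp add: coboundary_apply massey_cochain_apply algebra_simps)
      then show ?thesis unfolding s using True by (simp add: b_def)
    next
      case False
      then show ?thesis unfolding s
        using Q.defining_system_mult[OF ds ij False proj_closed[OF x(1)] proj_closed[OF x(2)]] x
        by (simp add: b_apply mult_Q)
    qed
  qed
  have b_one: "b i j \<one> = 0" if "1 \<le> i" "i \<le> j" "j \<le> n" for i j
    using that
  proof (induction j rule: less_induct)
    case (less j)
    have "(\<Sum>r = i..<j. b i r \<one> * b (r + 1) j \<one>) = 0"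
      using less by (intro sum.neutral ballI) auto
    then show ?case using b_mult[OF less.prems one_closed one_closed] by simp
  qed
  \<comment> \<open>The index shift from \<open>p\<close> to \<open>p + 1\<close> turns the products
    b_{ir} b_{r+1,j} into matrix multiplication over rows and columns 0 to n; the corner entry (0,
    n) is \<open>y\<close>.\<close>
  define R where "R p q x = (if p = q then 1 else if p < q then b (p + 1) q x else 0)" for p q :: nat and x
  have R_mult: "R p q (x \<otimes> x') = (\<Sum>r\<le>n. R p r x * R r q x')"
    if pq: "p \<le> n" "q \<le> n" and x: "x \<in> carrier S" "x' \<in> carrier S" for p q x x'
  proof (cases "p < q")
    case True
    have "(\<Sum>r\<le>n. R p r x * R r q x') = (\<Sum>r\<in>insert p (insert q {p + 1..<q}). R p r x * R r q x')"
      by (rule sum.mono_neutral_right) (use pq True in \<open>auto simp: R_def\<close>)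
    also have "\<dots> = R p q x' + (R p q x + (\<Sum>r = p + 1..<q. R p r x * R r q x'))"
      using True by (simp add: R_def)
    also have "(\<Sum>r = p + 1..<q. R p r x * R r q x') = (\<Sum>r = p + 1..<q. b (p + 1) r x * b (r + 1) q x')"
      by (rule sum.cong[OF refl]) (simp add: R_def)
    finally show ?thesis
      using b_mult[of "p + 1" q x x'] True pq x by (simp add: R_def algebra_simps)
  next
    case False
    have "(\<Sum>r\<le>n. R p r x * R r q x') = (\<Sum>r\<in>{r. r = p \<and> p = q}. R p r x * R r q x')"
      by (rule sum.mono_neutral_right) (use pq False in \<open>auto simp: R_def\<close>)
    then show ?thesis using False by (simp add: R_def)
  qed
  have "unitriangular_representation A S n R"
  proof unfold_locales
    show "locally_const (topol S) (R p q)" if "p \<le> n" "q \<le> n" for p q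
    proof (cases "p < q")
      case True
      then have "b (p + 1) q \<in> cochains1 S" using that by (intro b_cochain) auto
      moreover have "R p q = b (p + 1) q" using True by (simp add: R_def fun_eq_iff)
      ultimately show ?thesis by (simp add: cochains1_iff)
    qed (simp add: R_def[abs_def])
    show "R p q (x \<otimes> x') = (\<Sum>r\<le>n. R p r x * R r q x')"
      if "p \<le> n" "q \<le> n" "x \<in> carrier S" "x' \<in> carrier S" for p q x x'
      using R_mult[OF that] .
    show "R p q \<one> = kronecker p q" if "p \<le> n" "q \<le> n" for p q
      using that b_one[of "p + 1" q] by (simp add: R_def)
  qed (use n_pos in \<open>auto simp: R_def\<close>)
  then interpret R: unitriangular_representation A S n R .
  obtain F d where Fd: "finite F" "F \<subseteq> words"
    "\<And>x. x \<in> magnus_filtration ty A S n \<Longrightarrow> R 0 n x = (\<Sum>w\<in>F. d w * \<Lambda> ty x w)"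
    using R.corner_expansion[of ty] by blast
  have "trg (combo d F) = H2_class Q (massey_cochain c 1 n)"
  proof (rule transgression_eqI[OF y])
    show "massey_cochain c 1 n \<in> cochains2 Q" using z by (simp add: carrier_Z2_iff)
    show "y x = combo d F x" if "x \<in> N" for x
    proof -
      have "R 0 n x = y x" using n_pos by (simp add: R_def b_def)
      then show ?thesis using Fd(3)[of x] Nn that by (auto simp: combo_def)
    qed
  qed
  moreover have "combo d F \<in> combos" using Fd by (auto simp: combos_def)
  ultimately show ?thesis by blast
qed

lemma trg_zero: "trg (\<lambda>x. 0) = \<one>\<^bsub>H2 Q\<^esub>"
  unfolding Q.H2_one
proof (rule transgression_eqI[OF cochains1_zero])
  show "coboundary S (\<lambda>x. 0) = pullback2 S proj (\<lambda>p. 0)"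
    unfolding coboundary_zero by (auto simp: pullback2_def)
  show "(\<lambda>p. 0) \<in> cochains2 Q" using Q.Z2_zero_closed by (simp add: carrier_Z2_iff)
qed simp

lemma massey_products_eq:
  "{H2_class Q (massey_cochain c 1 n) | c :: nat \<Rightarrow> nat \<Rightarrow> 'a set \<Rightarrow> 'm mod_ring. defining_system Q n c} \<subseteq> trg ` combos"
  using massey_is_combo by blast

lemma trg_combos_subgroup: "subgroup (trg ` combos) (H2 Q)"
proof -
  interpret H: group "H2 Q :: ('a set \<times> 'a set \<Rightarrow> 'm mod_ring) set monoid" by (rule Q.group_H2)
  show ?thesis
  proof (rule H.subgroupI)
    show "trg ` combos \<subseteq> carrier (H2 Q)" using transgression_closed combos_invariant by blast
    show "trg ` combos \<noteq> {}" using combos.zero_mem by blast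
    fix \<alpha> assume "\<alpha> \<in> trg ` combos"
    then obtain \<psi> where \<psi>: "\<psi> \<in> combos" "\<alpha> = trg \<psi>" by blast
    note \<psi>' = combos.uminus_mem[OF \<psi>(1)]
    have "trg (\<lambda>x. - \<psi> x) \<otimes>\<^bsub>H2 Q\<^esub> \<alpha> = \<one>\<^bsub>H2 Q\<^esub>"
      unfolding \<psi>(2) transgression_add[OF combos_invariant[OF \<psi>'] combos_invariant[OF \<psi>(1)], symmetric]
      by (simp add: trg_zero)
    then have "inv\<^bsub>H2 Q\<^esub> \<alpha> = trg (\<lambda>x. - \<psi> x)"
      using \<psi> \<psi>' transgression_closed combos_invariant by (intro H.inv_equality) auto
    then show "inv\<^bsub>H2 Q\<^esub> \<alpha> \<in> trg ` combos" using \<psi>' by blast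
    fix \<beta> assume "\<beta> \<in> trg ` combos"
    then obtain \<phi> where \<phi>: "\<phi> \<in> combos" "\<beta> = trg \<phi>" by blast
    show "\<alpha> \<otimes>\<^bsub>H2 Q\<^esub> \<beta> \<in> trg ` combos"
      unfolding \<psi>(2) \<phi>(2) transgression_add[OF combos_invariant[OF \<psi>(1)] combos_invariant[OF \<phi>(1)], symmetric]
      using combos.add_mem[OF \<psi>(1) \<phi>(1)] by blast
  qed
qed

lemma combo_insert:
  assumes "finite F" "w \<notin> F"
  shows "combo d (insert w F) = (\<lambda>x. combo (\<lambda>_. d w) {w} x + combo d F x)"
  using assms by (auto simp: combo_def fun_eq_iff)

text \<open>For the converse inclusion a combination is split into its words. Each word with its
  coefficient transgresses to a Massey product, and transgression is additive.\<close>

lemma carrier_H2_massey: "carrier (H2_massey Q n) = trg ` combos"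
proof -
  let ?M = "{H2_class Q (massey_cochain c 1 n) | c :: nat \<Rightarrow> nat \<Rightarrow> 'a set \<Rightarrow> 'm mod_ring. defining_system Q n c}"
  interpret H: group "H2 Q :: ('a set \<times> 'a set \<Rightarrow> 'm mod_ring) set monoid" by (rule Q.group_H2)
  have "generate (H2 Q) ?M \<subseteq> trg ` combos"
    by (rule H.generate_subgroup_incl[OF massey_products_eq trg_combos_subgroup])
  moreover have "trg (combo d F) \<in> generate (H2 Q) ?M" if "finite F" "F \<subseteq> words" for d F
    using that
  proof (induction F rule: finite_induct)
    case empty
    have "combo d {} = (\<lambda>x. 0)" by (rule ext) (simp add: combo_def)
    then show ?case using generate.one[of "H2 Q" ?M] by (simp add: trg_zero)
  next
    case (insert w F)
    have M: "trg (combo (\<lambda>_. d w) {w}) \<in> ?M" using word_massey[of w "d w"] insert.prems by blast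
    have IH: "trg (combo d F) \<in> generate (H2 Q) ?M" using insert.IH insert.prems by blast
    have "trg (combo (\<lambda>_. d w) {w}) \<otimes>\<^bsub>H2 Q\<^esub> trg (combo d F) \<in> generate (H2 Q) ?M"
      by (rule generate.eng[OF generate.incl[OF M] IH])
    then show ?case
      unfolding combo_insert[OF insert.hyps]
      using insert.prems combo_invariant[of "{w}" "\<lambda>_. d w"] combo_invariant[of F d]
      by (simp add: transgression_add)
  qed
  ultimately show ?thesis unfolding H2_massey_def by (auto simp: combos_def)
qed

text \<open>The degree-n coefficients as a vector. On \<open>N\<close> this is additive with kernel
  N \<inter> S_{n+1}, so the quotient becomes a \<open>coordinate_subgroup\<close>.\<close>

definition word_vector :: "'a \<Rightarrow> 'a list \<Rightarrow> 'm mod_ring" where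
  "word_vector x w = (if w \<in> words then \<Lambda> ty x w else 0)"

lemma word_vectors_subgroup: "coordinate_subgroup (word_vector ` N)"
proof
  have "word_vector \<one> = (\<lambda>_. 0)"
    using words_not_Nil by (auto simp: word_vector_def fun_eq_iff magnus_one series_one_def)
  then show "(\<lambda>_. 0) \<in> word_vector ` N" using N_one by (metis imageI)
  fix f g assume "f \<in> word_vector ` N" "g \<in> word_vector ` N"
  then obtain x y where xy: "x \<in> N" "y \<in> N" "f = word_vector x" "g = word_vector y" by blast
  have "(\<lambda>w. f w + g w) = word_vector (x \<otimes> y)"
    using magnus_add_N[OF N_carrier[OF xy(1)] xy(2)] by (auto simp: word_vector_def xy(3,4) fun_eq_iff)
  then show "(\<lambda>w. f w + g w) \<in> word_vector ` N" using N_mult[OF xy(1,2)] by blast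
qed

lemma N_next_filtration_iff:
  assumes "x \<in> N"
  shows "x \<in> magnus_filtration ty A S (n + 1) \<longleftrightarrow> (\<forall>w\<in>words. \<Lambda> ty x w = 0)"
proof
  assume "x \<in> magnus_filtration ty A S (n + 1)"
  then show "\<forall>w\<in>words. \<Lambda> ty x w = 0" using words_not_Nil by (auto intro: magnus_filtration_zero)
next
  assume "\<forall>w\<in>words. \<Lambda> ty x w = 0"
  moreover have "x \<in> magnus_filtration ty A S n" using assms Nn by blast
  ultimately show "x \<in> magnus_filtration ty A S (n + 1)"
    unfolding magnus_filtration_def by (auto simp: less_Suc_eq)
qed

lemma closedin_coefficient: "closedin (topol S) {x \<in> N. \<Lambda> ty x w = r}"
proof -
  have "closedin (topol S) {x \<in> topspace (topol S). \<Lambda> ty x w \<in> {r}}"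
    by (rule closedin_continuous_map_preimage[OF locally_const_magnus]) simp
  then have "closedin (topol S) (N \<inter> {x \<in> topspace (topol S). \<Lambda> ty x w \<in> {r}})"
    by (rule closedin_Int[OF N_closed])
  moreover have "N \<inter> {x \<in> topspace (topol S). \<Lambda> ty x w \<in> {r}} = {x \<in> N. \<Lambda> ty x w = r}"
    using N_subset by auto
  ultimately show ?thesis by simp
qed

text \<open>Finite intersection property: each coefficient condition is closed and \<open>K\<close>
  is compact.\<close>

lemma compact_family:
  assumes closed: "closedin (topol S) K" and KN: "K \<subseteq> N"
    and fin: "\<And>F. finite F \<Longrightarrow> F \<subseteq> words \<Longrightarrow> \<exists>x\<in>K. \<forall>w\<in>F. \<Lambda> ty x w = f w"
  shows "\<exists>x\<in>K. \<forall>w\<in>words. \<Lambda> ty x w = f w"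
proof (rule ccontr)
  assume neg: "\<not> (\<exists>x\<in>K. \<forall>w\<in>words. \<Lambda> ty x w = f w)"
  let ?U = "\<lambda>w. topspace (topol S) - {x \<in> N. \<Lambda> ty x w = f w}"
  have "compactin (topol S) K" by (rule closedin_compact_space[OF compact closed])
  then have "\<exists>\<F>. finite \<F> \<and> \<F> \<subseteq> ?U ` words \<and> K \<subseteq> \<Union>\<F>"
  proof (rule compactinD)
    show "openin (topol S) V" if "V \<in> ?U ` words" for V
      using that closedin_coefficient by (auto simp only: closedin_def)
    show "K \<subseteq> \<Union>(?U ` words)"
    proof
      fix x assume x: "x \<in> K"
      then obtain w where "w \<in> words" "\<Lambda> ty x w \<noteq> f w" using neg by blast
      then show "x \<in> \<Union>(?U ` words)" using x KN by auto
    qed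
  qed
  then obtain \<F> where \<F>: "finite \<F>" "\<F> \<subseteq> ?U ` words" "K \<subseteq> \<Union>\<F>" by blast
  obtain F where F: "F \<subseteq> words" "finite F" "\<F> = ?U ` F" using finite_subset_image[OF \<F>(1,2)] by blast
  obtain x where x: "x \<in> K" "\<forall>w\<in>F. \<Lambda> ty x w = f w" using fin[OF F(2,1)] by blast
  then obtain w where "w \<in> F" "x \<in> ?U w" using \<F>(3) F(3) by blast
  then show False using x KN by blast
qed

text \<open>The set where \<open>g\<close> is nonzero is compact and avoids S_{n+1}, so finitely
  many words \<open>F\<close> already witness this: \<open>g\<close> vanishes wherever the
  coefficients at \<open>F\<close> do. Hence \<open>g\<close> factors through the word vectors as a
  functional that only sees \<open>F\<close>, and self-injectivity makes it a combination.\<close>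

lemma invariant_hom_is_combo:
  fixes g :: "'a \<Rightarrow> 'm mod_ring"
  assumes cont: "locally_const (subtopology (topol S) N) g"
    and add: "\<And>x y. x \<in> N \<Longrightarrow> y \<in> N \<Longrightarrow> g (x \<otimes> y) = g x + g y"
    and van: "\<And>x. x \<in> N \<Longrightarrow> x \<in> magnus_filtration ty A S (n + 1) \<Longrightarrow> g x = 0"
    and out: "\<And>x. x \<notin> N \<Longrightarrow> g x = 0"
  shows "g \<in> combos"
proof -
  let ?K = "{x \<in> topspace (subtopology (topol S) N). g x \<in> - {0}}"
  have "closedin (subtopology (topol S) N) ?K"
    by (rule closedin_continuous_map_preimage[OF cont]) simp
  then have K: "closedin (topol S) ?K" by (rule closedin_trans_full[OF _ N_closed])
  have KN: "?K \<subseteq> N" by auto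
  have "\<exists>F. finite F \<and> F \<subseteq> words \<and> \<not> (\<exists>x\<in>?K. \<forall>w\<in>F. \<Lambda> ty x w = 0)"
  proof (rule ccontr)
    assume "\<nexists>F. finite F \<and> F \<subseteq> words \<and> \<not> (\<exists>x\<in>?K. \<forall>w\<in>F. \<Lambda> ty x w = 0)"
    then have "\<exists>x\<in>?K. \<forall>w\<in>words. \<Lambda> ty x w = 0"
      by (intro compact_family[OF K KN]) blast
    then obtain x where x: "x \<in> ?K" "\<forall>w\<in>words. \<Lambda> ty x w = 0" by blast
    then have "x \<in> N" by auto
    then have "g x = 0" using x(2) by (intro van) (simp_all only: N_next_filtration_iff)
    then show False using x(1) by simp
  qed
  then obtain F where F: "finite F" "F \<subseteq> words" and ker0: "\<not> (\<exists>x\<in>?K. \<forall>w\<in>F. \<Lambda> ty x w = 0)"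
    by blast
  have ker: "g x = 0" if "x \<in> N" "\<forall>w\<in>F. \<Lambda> ty x w = 0" for x
    using ker0 that N_subset by auto
  have g_inv: "g (inv y) = - g y" if "y \<in> N" for y
  proof -
    have "g (\<one> \<otimes> \<one>) = g \<one> + g \<one>" by (rule add[OF N_one N_one])
    then have "g \<one> = 0" by simp
    then show ?thesis using add[OF subgroup.m_inv_closed[OF N_subgroup that] that] that
      by (simp add: eq_neg_iff_add_eq_0)
  qed
  define \<phi> where "\<phi> f = g (SOME x. x \<in> N \<and> word_vector x = f)" for f
  have \<phi>: "\<phi> (word_vector x) = g x" if x: "x \<in> N" for x
  proof -
    define y where "y = (SOME y. y \<in> N \<and> word_vector y = word_vector x)"
    have y: "y \<in> N \<and> word_vector y = word_vector x" unfolding y_def by (rule someI[of _ x]) (simp add: x)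
    have iN: "inv x \<in> N" by (rule subgroup.m_inv_closed[OF N_subgroup x])
    have "\<Lambda> ty (y \<otimes> inv x) w = 0" if w: "w \<in> words" for w
    proof -
      have "\<Lambda> ty y w = \<Lambda> ty x w" using fun_cong[OF conjunct2[OF y], of w] w by (simp add: word_vector_def)
      moreover have "\<Lambda> ty (x \<otimes> inv x) w = \<Lambda> ty x w + \<Lambda> ty (inv x) w" using magnus_add_N[OF _ iN w, of x] x by simp
      moreover have "\<Lambda> ty (x \<otimes> inv x) w = 0" using x words_not_Nil[OF w] by (simp add: magnus_one series_one_def)
      ultimately show ?thesis using magnus_add_N[OF _ iN w, of y] y by simp
    qed
    then have "g (y \<otimes> inv x) = 0" using F(2) y iN by (intro ker N_mult) auto
    then have "g y = g x" using add[of y "inv x"] y iN g_inv[OF x] by simp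
    then show ?thesis by (simp add: \<phi>_def y_def)
  qed
  have "\<exists>c. \<forall>f\<in>word_vector ` N. \<phi> f = (\<Sum>w\<in>F. c w * f w)"
  proof (rule additive_eq_linear_combination[OF F(1) word_vectors_subgroup])
    fix f h assume "f \<in> word_vector ` N" "h \<in> word_vector ` N"
    then obtain x y where xy: "x \<in> N" "y \<in> N" "f = word_vector x" "h = word_vector y" by blast
    have "(\<lambda>w. f w + h w) = word_vector (x \<otimes> y)"
      using magnus_add_N[OF N_carrier[OF xy(1)] xy(2)] by (auto simp: word_vector_def xy(3,4) fun_eq_iff)
    then show "\<phi> (\<lambda>w. f w + h w) = \<phi> f + \<phi> h"
      using xy N_mult by (simp add: \<phi> add)
  next
    fix f assume "f \<in> word_vector ` N" and f0: "\<forall>w\<in>F. f w = 0"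
    then obtain x where x: "x \<in> N" "f = word_vector x" by blast
    have "\<forall>w\<in>F. \<Lambda> ty x w = 0"
    proof
      fix w assume w: "w \<in> F"
      then have "word_vector x w = 0" using f0 x(2) by blast
      moreover have "w \<in> words" using w F(2) by blast
      ultimately show "\<Lambda> ty x w = 0" by (simp only: word_vector_def if_True)
    qed
    then show "\<phi> f = 0" using ker[OF x(1)] \<phi>[OF x(1)] x(2) by simp
  qed
  then obtain c where c: "\<And>x. x \<in> N \<Longrightarrow> \<phi> (word_vector x) = (\<Sum>w\<in>F. c w * word_vector x w)" by blast
  have "g = combo c F"
  proof
    fix x
    show "g x = combo c F x"
    proof (cases "x \<in> N")
      case True
      have "(\<Sum>w\<in>F. c w * word_vector x w) = (\<Sum>w\<in>F. c w * \<Lambda> ty x w)"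
        using F(2) by (intro sum.cong) (auto simp: word_vector_def)
      then show ?thesis using c[OF True] \<phi>[OF True] True by (simp add: combo_def)
    qed (simp add: combo_def out)
  qed
  then show ?thesis using F by (auto simp: combos_def)
qed

text \<open>For a finite set of words, a linear relation on the coefficients of all elements of
  \<open>N\<close> is a vanishing \<open>combo\<close>; the values \<open>f\<close> respect these
  relations, so \<open>separate_from_subgroup\<close> provides an element of \<open>N\<close>.
  Compactness then treats all words at once.\<close>

lemma realize_coefficients:
  fixes f :: "'a list \<Rightarrow> 'm mod_ring"
  assumes "\<And>d F. finite F \<Longrightarrow> F \<subseteq> words \<Longrightarrow> combo d F = (\<lambda>_. 0) \<Longrightarrow> (\<Sum>w\<in>F. d w * f w) = 0"
  shows "\<exists>x\<in>N. \<forall>w\<in>words. \<Lambda> ty x w = f w"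
proof (rule compact_family[OF N_closed subset_refl])
  fix F assume F: "finite F" "F \<subseteq> words"
  have wv: "word_vector x w = \<Lambda> ty x w" if "w \<in> F" for x w
    using that F(2) by (auto simp: word_vector_def)
  have "\<exists>v\<in>word_vector ` N. \<forall>w\<in>F. v w = f w"
  proof (rule separate_from_subgroup[OF F(1) word_vectors_subgroup])
    fix c assume c: "\<forall>v\<in>word_vector ` N. (\<Sum>w\<in>F. c w * v w) = 0"
    have "combo c F x = 0" for x
    proof (cases "x \<in> N")
      case True
      have "(\<Sum>w\<in>F. c w * \<Lambda> ty x w) = (\<Sum>w\<in>F. c w * word_vector x w)"
        by (rule sum.cong) (simp_all add: wv)
      then show ?thesis using c True by (simp add: combo_def)
    qed (simp add: combo_def)
    then show "(\<Sum>w\<in>F. c w * f w) = 0" using assms[OF F] by blast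
  qed
  then show "\<exists>x\<in>N. \<forall>w\<in>F. \<Lambda> ty x w = f w" using wv by auto
qed

end

subsection \<open>Duality and inflation\<close>

lemma top_subgroup_simps [simp]:
  "carrier (top_subgroup G H) = H" "x \<otimes>\<^bsub>top_subgroup G H\<^esub> y = x \<otimes>\<^bsub>G\<^esub> y" "\<one>\<^bsub>top_subgroup G H\<^esub> = \<one>\<^bsub>G\<^esub>"
  "topol (top_subgroup G H) = subtopology (topol G) H"
  by (simp_all add: top_subgroup_def)

lemma r_coset_top_subgroup [simp]: "K #>\<^bsub>top_subgroup G H\<^esub> x = K #>\<^bsub>G\<^esub> x"
  by (simp add: r_coset_def)

context top_grp
begin

lemma group_top_subgroup:
  assumes H: "subgroup H G"
  shows "group (top_subgroup G H)"
proof (rule groupI)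
  note mem = subgroup.mem_carrier[OF H]
  fix x y z assume x: "x \<in> carrier (top_subgroup G H)"
  then show "\<one>\<^bsub>top_subgroup G H\<^esub> \<otimes>\<^bsub>top_subgroup G H\<^esub> x = x" using mem by simp
  show "\<exists>y\<in>carrier (top_subgroup G H). y \<otimes>\<^bsub>top_subgroup G H\<^esub> x = \<one>\<^bsub>top_subgroup G H\<^esub>"
    using x mem subgroup.m_inv_closed[OF H] by (intro bexI[of _ "inv x"]) auto
  assume y: "y \<in> carrier (top_subgroup G H)"
  then show "x \<otimes>\<^bsub>top_subgroup G H\<^esub> y \<in> carrier (top_subgroup G H)" using x subgroup.m_closed[OF H] by simp
  assume z: "z \<in> carrier (top_subgroup G H)"
  then show "x \<otimes>\<^bsub>top_subgroup G H\<^esub> y \<otimes>\<^bsub>top_subgroup G H\<^esub> z = x \<otimes>\<^bsub>top_subgroup G H\<^esub> (y \<otimes>\<^bsub>top_subgroup G H\<^esub> z)"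
    using x y mem by (simp add: m_assoc)
qed (simp add: subgroup.one_closed[OF H])

lemma inv_top_subgroup:
  assumes H: "subgroup H G" and x: "x \<in> H"
  shows "inv\<^bsub>top_subgroup G H\<^esub> x = inv x"
  by (rule group.inv_equality[OF group_top_subgroup[OF H]])
    (use x subgroup.mem_carrier[OF H x] subgroup.m_inv_closed[OF H x] in simp_all)

lemma topological_group_top_subgroup:
  assumes H: "subgroup H G"
  shows "topological_group (top_subgroup G H)"
proof (rule topological_groupI[OF group_top_subgroup[OF H]])
  let ?T = "subtopology (topol G) H"
  have sub: "H \<subseteq> carrier G" using H by (rule subgroup.subset)
  then have top: "topspace ?T = H" by auto
  then show "topspace (topol (top_subgroup G H)) = carrier (top_subgroup G H)" by simp
  have fs: "continuous_map (prod_topology ?T ?T) (topol G) fst" "continuous_map (prod_topology ?T ?T) (topol G) snd"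
    by (rule continuous_map_into_fulltopology[OF continuous_map_fst],
        rule continuous_map_into_fulltopology[OF continuous_map_snd])
  have "continuous_map (prod_topology ?T ?T) ?T (\<lambda>p. fst p \<otimes> snd p)"
    unfolding continuous_map_in_subtopology
  proof
    show "continuous_map (prod_topology ?T ?T) (topol G) (\<lambda>p. fst p \<otimes> snd p)"
      by (rule continuous_mult'[OF fs])
    show "(\<lambda>p. fst p \<otimes> snd p) \<in> topspace (prod_topology ?T ?T) \<rightarrow> H"
      unfolding topspace_prod_topology top using subgroup.m_closed[OF H] by auto
  qed
  then show "continuous_map (prod_topology (topol (top_subgroup G H)) (topol (top_subgroup G H)))
      (topol (top_subgroup G H)) (\<lambda>p. fst p \<otimes>\<^bsub>top_subgroup G H\<^esub> snd p)"
    by simp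
  have "continuous_map ?T ?T (\<lambda>x. inv x)"
    unfolding continuous_map_in_subtopology
  proof
    show "continuous_map ?T (topol G) (\<lambda>x. inv x)"
      by (rule continuous_map_from_subtopology[OF continuous_inv])
    show "(\<lambda>x. inv x) \<in> topspace ?T \<rightarrow> H"
      unfolding top using subgroup.m_inv_closed[OF H] by auto
  qed
  then have "continuous_map ?T ?T (\<lambda>x. inv\<^bsub>top_subgroup G H\<^esub> x)"
    by (rule continuous_map_eq) (simp only: top inv_top_subgroup[OF H])
  then show "continuous_map (topol (top_subgroup G H)) (topol (top_subgroup G H)) (\<lambda>x. inv\<^bsub>top_subgroup G H\<^esub> x)"
    by simp
qed

lemma normal_top_subgroup:
  assumes H: "subgroup H G" and K: "K \<lhd> G" and KH: "K \<subseteq> H"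
  shows "K \<lhd> top_subgroup G H"
proof -
  interpret H: group "top_subgroup G H" by (rule group_top_subgroup[OF H])
  have Ks: "subgroup K G" using K by (rule normal_imp_subgroup)
  have "subgroup K (top_subgroup G H)"
  proof (rule H.subgroupI)
    show "inv\<^bsub>top_subgroup G H\<^esub> a \<in> K" if "a \<in> K" for a
      using that KH subgroup.m_inv_closed[OF Ks that] by (simp add: inv_top_subgroup[OF H] subset_iff)
  qed (use KH subgroup.one_closed[OF Ks] subgroup.m_closed[OF Ks] in auto)
  moreover have "x \<otimes>\<^bsub>top_subgroup G H\<^esub> h \<otimes>\<^bsub>top_subgroup G H\<^esub> inv\<^bsub>top_subgroup G H\<^esub> x \<in> K"
    if "x \<in> carrier (top_subgroup G H)" "h \<in> K" for x h
    using that normal.inv_op_closed2[OF K, of x h] subgroup.mem_carrier[OF H, of x]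
    by (simp add: inv_top_subgroup[OF H])
  ultimately show ?thesis unfolding H.normal_inv_iff by blast
qed

end

section \<open>The duality between cosets and Massey classes\<close>

context massey_setup
begin

definition T where "T = magnus_filtration ty A S (n + 1)"
abbreviation NT where "NT \<equiv> N <#> T"
abbreviation D where "D \<equiv> top_subgroup S NT"

lemma T_normal: "T \<lhd> S" unfolding T_def by (rule magnus_filtration_normal)

lemma mem_T_iff: "x \<in> N \<Longrightarrow> x \<in> T \<longleftrightarrow> (\<forall>w\<in>words. \<Lambda> ty x w = 0)"
  unfolding T_def by (rule N_next_filtration_iff)

sublocale TQ: top_quotient S T
  by (rule top_quotient.intro[OF top_grp_axioms top_quotient_axioms.intro[OF T_normal]])

lemma NT_subgroup: "subgroup NT S"
  using normal_subgroup_set_mult_closed[OF normal T_normal] by (rule normal_imp_subgroup)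

lemma T_subset_NT: "T \<subseteq> NT"
proof
  fix t assume "t \<in> T"
  then have "t = \<one> \<otimes> t" using TQ.N_subset by auto
  then show "t \<in> NT" unfolding set_mult_def using N_one \<open>t \<in> T\<close> by blast
qed

lemma N_subset_NT: "N \<subseteq> NT"
proof
  fix x assume "x \<in> N"
  then have "x = x \<otimes> \<one>" by simp
  then show "x \<in> NT" unfolding set_mult_def using subgroup.one_closed[OF TQ.N_subgroup] \<open>x \<in> N\<close> by blast
qed

lemma NT_cases:
  assumes "x \<in> NT"
  obtains \<nu> t where "\<nu> \<in> N" "t \<in> T" "x = \<nu> \<otimes> t"
  using assms unfolding set_mult_def by blast

sublocale DQ: top_quotient "top_subgroup S NT" T
  by (rule top_quotient.intro[OF top_grp.intro[OF topological_group_top_subgroup[OF NT_subgroup]]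
        top_quotient_axioms.intro[OF normal_top_subgroup[OF NT_subgroup T_normal T_subset_NT]]])

text \<open>Every coset of \<open>T\<close> in \<open>NT\<close> meets \<open>N\<close>, where the
  homomorphisms dual to Massey classes are defined.\<close>

lemma carrier_DQ: "carrier (DQ.Q) = {T #> \<sigma> |\<sigma>. \<sigma> \<in> N}"
proof (intro subset_antisym subsetI)
  fix a assume "a \<in> carrier (DQ.Q)"
  then obtain x where x: "x \<in> NT" "a = T #> x" by (auto simp: DQ.carrier_Q)
  then obtain \<nu> t where e: "\<nu> \<in> N" "t \<in> T" "x = \<nu> \<otimes> t" by (elim NT_cases)
  then have "a = T #> \<nu>" using x TQ.proj_mult_N[of \<nu> t] by simp
  then show "a \<in> {T #> \<sigma> |\<sigma>. \<sigma> \<in> N}" using e by blast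
next
  fix a assume "a \<in> {T #> \<sigma> |\<sigma>. \<sigma> \<in> N}"
  then show "a \<in> carrier (DQ.Q)" using N_subset_NT by (auto simp: DQ.carrier_Q)
qed

lemma coefficient_mult_T: "x \<in> carrier S \<Longrightarrow> t \<in> T \<Longrightarrow> w \<in> words \<Longrightarrow> \<Lambda> ty (x \<otimes> t) w = \<Lambda> ty x w"
  unfolding T_def by (rule magnus_mult_filtration(1)[where k = "n + 1"]) auto

lemma combo_ext_mult_T:
  assumes "F \<subseteq> words" "x \<in> carrier S" "t \<in> T"
  shows "combo_ext d F (x \<otimes> t) = combo_ext d F x"
proof -
  have "t \<in> carrier S" using assms(3) TQ.N_subset by blast
  moreover have "(\<Sum>w\<in>F. d w * \<Lambda> ty (x \<otimes> t) w) = (\<Sum>w\<in>F. d w * \<Lambda> ty x w)"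
  proof (rule sum.cong[OF refl])
    fix w assume "w \<in> F"
    then have "w \<in> words" using assms(1) by blast
    then show "d w * \<Lambda> ty (x \<otimes> t) w = d w * \<Lambda> ty x w" by (simp only: coefficient_mult_T[OF assms(2,3)])
  qed
  ultimately show ?thesis using assms(2) by (simp add: combo_ext_def)
qed

text \<open>Write \<tau> = \<sigma> t with t \<in> N. Degree-n coefficients are additive on
  \<open>N\<close>, so equality of all of them says that those of t vanish, which for elements of
  \<open>N\<close> means t \<in> T.\<close>

lemma coset_eq_iff:
  assumes \<sigma>: "\<sigma> \<in> N" "\<tau> \<in> N"
  shows "T #> \<sigma> = T #> \<tau> \<longleftrightarrow> (\<forall>w\<in>words. \<Lambda> ty \<sigma> w = \<Lambda> ty \<tau> w)"
proof
  assume "T #> \<sigma> = T #> \<tau>"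
  then obtain t where "t \<in> T" "\<tau> = \<sigma> \<otimes> t" using TQ.proj_eq_iff[of \<sigma> \<tau>] \<sigma> by auto
  then show "\<forall>w\<in>words. \<Lambda> ty \<sigma> w = \<Lambda> ty \<tau> w" using coefficient_mult_T[of \<sigma> t] \<sigma> by simp
next
  assume eq: "\<forall>w\<in>words. \<Lambda> ty \<sigma> w = \<Lambda> ty \<tau> w"
  define t where "t = inv \<sigma> \<otimes> \<tau>"
  have t: "t \<in> N" unfolding t_def by (rule N_mult[OF subgroup.m_inv_closed[OF N_subgroup \<sigma>(1)] \<sigma>(2)])
  have \<tau>: "\<tau> = \<sigma> \<otimes> t" unfolding t_def using \<sigma> by (simp add: m_assoc[symmetric])
  have "\<Lambda> ty t w = 0" if w: "w \<in> words" for w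
    using magnus_add_N[OF N_carrier[OF \<sigma>(1)] t w] bspec[OF eq w] unfolding \<tau>[symmetric] by simp
  then have "t \<in> T" using mem_T_iff[OF t] by blast
  then show "T #> \<sigma> = T #> \<tau>" using TQ.proj_mult_N[of \<sigma> t] \<sigma> \<tau> by simp
qed

lemma combos_const_on_cosets:
  assumes "\<psi> \<in> combos" "\<sigma> \<in> N" "\<tau> \<in> N" "T #> \<sigma> = T #> \<tau>"
  shows "\<psi> \<sigma> = \<psi> \<tau>"
proof -
  obtain d F where \<psi>: "\<psi> = combo d F" "F \<subseteq> words" using assms(1) unfolding combos_def by blast
  have "\<forall>w\<in>words. \<Lambda> ty \<sigma> w = \<Lambda> ty \<tau> w" using coset_eq_iff[OF assms(2,3)] assms(4) by blast
  then have "d w * \<Lambda> ty \<sigma> w = d w * \<Lambda> ty \<tau> w" if "w \<in> F" for w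
    using \<psi>(2) that by (metis subsetD)
  then have "(\<Sum>w\<in>F. d w * \<Lambda> ty \<sigma> w) = (\<Sum>w\<in>F. d w * \<Lambda> ty \<tau> w)"
    by (rule sum.cong[OF refl])
  then show ?thesis using assms(2,3) by (simp add: \<psi>(1) combo_def)
qed

text \<open>Evaluates trg^-1(b) at a representative in \<open>N\<close>. For Massey classes the
  choice is immaterial, because combinations of degree-n coefficients are constant on
  \<open>N\<close> along cosets of \<open>T\<close>.\<close>

definition pairing :: "'a set \<Rightarrow> ('a set \<times> 'a set \<Rightarrow> 'm mod_ring) set \<Rightarrow> 'm mod_ring" where
  "pairing a b = inv_into H1N trg b (SOME \<sigma>. \<sigma> \<in> N \<and> a = T #> \<sigma>)"

lemma pairing_eq:
  assumes \<psi>: "\<psi> \<in> combos" and \<sigma>: "\<sigma> \<in> N"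
  shows "pairing (T #> \<sigma>) (trg \<psi>) = \<psi> \<sigma>"
proof -
  let ?\<tau> = "SOME \<tau>. \<tau> \<in> N \<and> T #> \<sigma> = T #> \<tau>"
  have "?\<tau> \<in> N \<and> T #> \<sigma> = T #> ?\<tau>" by (rule someI[of _ \<sigma>]) (simp add: \<sigma>)
  then have "\<psi> \<sigma> = \<psi> ?\<tau>" using combos_const_on_cosets[OF \<psi> \<sigma>] by blast
  then show ?thesis
    unfolding pairing_def inv_into_f_f[OF transgression_inj combos_invariant[OF \<psi>]] ..
qed

lemma mult_H2_massey: "\<alpha> \<otimes>\<^bsub>H2_massey Q n\<^esub> \<beta> = \<alpha> \<otimes>\<^bsub>H2 Q\<^esub> \<beta>"
  by (simp add: H2_massey_def)

lemma trg_add_combos: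
  "\<psi> \<in> combos \<Longrightarrow> \<phi> \<in> combos \<Longrightarrow> trg \<psi> \<otimes>\<^bsub>H2_massey Q n\<^esub> trg \<phi> = trg (\<lambda>x. \<psi> x + \<phi> x)"
  by (simp add: mult_H2_massey transgression_add combos_invariant)

text \<open>Each coefficient is a natural multiple of 1, so an additive map is
  \<open>\<int>/m\<close>-linear and is determined by its values at single words.\<close>

lemma additive_combo:
  assumes add: "\<And>\<psi> \<phi>. \<psi> \<in> combos \<Longrightarrow> \<phi> \<in> combos \<Longrightarrow> h (\<lambda>x. \<psi> x + \<phi> x) = h \<psi> + (h \<phi> :: 'm mod_ring)"
    and F: "finite F" "F \<subseteq> words"
  shows "h (combo d F) = (\<Sum>w\<in>F. d w * h (combo (\<lambda>_. 1) {w}))"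
  using F
proof (induction F rule: finite_induct)
  case empty
  have "combo d {} = (\<lambda>_. 0)" by (rule ext) (simp add: combo_def)
  moreover have "h (\<lambda>x. 0 + 0) = h (\<lambda>_. 0) + h (\<lambda>_. 0)" by (rule add[OF combos.zero_mem combos.zero_mem])
  ultimately show ?case by simp
next
  case (insert w F)
  have one: "combo (\<lambda>_. 1) {w} \<in> combos" and dw: "combo (\<lambda>_. d w) {w} \<in> combos" and rest: "combo d F \<in> combos"
    using insert.prems insert.hyps unfolding combos_def by blast+
  define k where "k = nat (to_int_mod_ring (d w))"
  have k: "d w = of_nat k" by (simp add: k_def of_nat_nat_to_int_mod_ring)
  have "combo (\<lambda>_. d w) {w} = (\<lambda>x. of_nat k * combo (\<lambda>_. 1) {w} x)"
    by (rule ext) (simp add: combo_def k)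
  moreover have "h (\<lambda>x. of_nat k * combo (\<lambda>_. 1) {w} x) = of_nat k * h (combo (\<lambda>_. 1) {w})"
    by (rule combos.additive_scale[OF _ one]) (rule add)
  ultimately have s: "h (combo (\<lambda>_. d w) {w}) = d w * h (combo (\<lambda>_. 1) {w})" by (simp add: k)
  show ?case
    unfolding combo_insert[OF insert.hyps] add[OF dw rest] s
    using insert by simp
qed

lemma perfect_pairing_massey: "perfect_pairing (DQ.Q) (H2_massey Q n) pairing"
  unfolding perfect_pairing_def
proof (intro conjI ballI impI)
  fix a assume "a \<in> carrier (DQ.Q)"
  then obtain \<sigma> where \<sigma>: "\<sigma> \<in> N" "a = T #> \<sigma>" by (auto simp: carrier_DQ)
  show "pairing a \<in> hom (H2_massey Q n) additive_Zmod"
    unfolding hom_additive_Zmod_iff carrier_H2_massey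
    using \<sigma> combos.add_mem by (auto simp: trg_add_combos pairing_eq)
next
  fix b :: "('a set \<times> 'a set \<Rightarrow> 'm mod_ring) set" assume "b \<in> carrier (H2_massey Q n)"
  then obtain d F where b: "b = trg (combo d F)" "finite F" "F \<subseteq> words"
    by (auto simp: carrier_H2_massey combos_def)
  then have \<psi>: "combo d F \<in> combos" unfolding combos_def by blast
  show "(\<lambda>a. pairing a b) \<in> hom (DQ.Q) additive_Zmod"
    unfolding hom_additive_Zmod_iff carrier_DQ
  proof (intro ballI)
    fix x y assume "x \<in> {T #> \<sigma> |\<sigma>. \<sigma> \<in> N}" "y \<in> {T #> \<sigma> |\<sigma>. \<sigma> \<in> N}"
    then obtain \<sigma> \<tau> where e: "\<sigma> \<in> N" "\<tau> \<in> N" "x = T #> \<sigma>" "y = T #> \<tau>" by blast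
    have xy: "x \<otimes>\<^bsub>DQ.Q\<^esub> y = T #> (\<sigma> \<otimes> \<tau>)"
      using DQ.mult_Q[of \<sigma> \<tau>] e N_subset_NT by auto
    have "combo d F (\<sigma> \<otimes> \<tau>) = combo d F \<sigma> + combo d F \<tau>"
      using combos_invariant[OF \<psi>] e(1,2) unfolding H1_inv_iff by blast
    then show "pairing (x \<otimes>\<^bsub>DQ.Q\<^esub> y) b = pairing x b + pairing y b"
      unfolding xy unfolding b(1) e(3,4) by (simp only: pairing_eq[OF \<psi>] e(1,2) N_mult)
  qed
  \<comment> \<open>On \<open>NT\<close> the lifted function coincides with
    \<open>combo_ext d F\<close>, which is locally constant on \<open>S\<close> and insensitive to
    \<open>T\<close>.\<close>
  show "locally_const (topol (DQ.Q)) (\<lambda>a. pairing a b)"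
  proof (rule DQ.continuous_from_Q)
    have "locally_const (topol S) (combo_ext d F)" using combo_ext_cochain by (simp add: cochains1_iff)
    then have "locally_const (topol D) (combo_ext d F)" by (simp add: continuous_map_from_subtopology)
    then show "locally_const (topol D) (\<lambda>x. pairing (T #>\<^bsub>D\<^esub> x) b)"
    proof (rule locally_const_cong)
      fix x assume "x \<in> topspace (topol D)"
      then have "x \<in> NT" by simp
      then obtain \<nu> t where e: "\<nu> \<in> N" "t \<in> T" "x = \<nu> \<otimes> t" by (elim NT_cases)
      have "pairing (T #> x) b = combo d F \<nu>"
        unfolding e(3) b(1) using TQ.proj_mult_N[of \<nu> t] e pairing_eq[OF \<psi> e(1)] by simp
      also have "\<dots> = combo_ext d F x" using combo_ext_mult_T[OF b(3) N_carrier[OF e(1)] e(2)] e(1,3) by (simp add: combo_ext_eq_combo)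
      finally show "combo_ext d F x = pairing (T #>\<^bsub>D\<^esub> x) b" by simp
    qed
  qed
next
  fix f :: "('a set \<times> 'a set \<Rightarrow> 'm mod_ring) set \<Rightarrow> 'm mod_ring"
  assume f: "f \<in> hom (H2_massey Q n) additive_Zmod"
  define h where "h \<psi> = f (trg \<psi>)" for \<psi>
  have h_add: "h (\<lambda>x. \<psi> x + \<phi> x) = h \<psi> + h \<phi>" if "\<psi> \<in> combos" "\<phi> \<in> combos" for \<psi> \<phi>
    using f that unfolding hom_additive_Zmod_iff carrier_H2_massey h_def trg_add_combos[OF that, symmetric] by blast
  have h_combo: "h (combo d F) = (\<Sum>w\<in>F. d w * h (combo (\<lambda>_. 1) {w}))" if "finite F" "F \<subseteq> words" for d F
    by (rule additive_combo[OF _ that]) (rule h_add)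
  define v where "v w = h (combo (\<lambda>_. 1) {w})" for w
  have "h (\<lambda>x. 0 + 0) = h (\<lambda>_. 0) + h (\<lambda>_. 0)" by (rule h_add[OF combos.zero_mem combos.zero_mem])
  then have h0: "h (\<lambda>_. 0) = 0" by simp
  \<comment> \<open>The values of \<open>f\<close> prescribe the coefficients of the element sought.
    They respect every relation, since a relation is a combination equal to 0 and \<open>h\<close>
    sends 0 to 0.\<close>
  have "\<exists>\<sigma>\<in>N. \<forall>w\<in>words. \<Lambda> ty \<sigma> w = v w"
  proof (rule realize_coefficients)
    fix d F assume "finite F" "F \<subseteq> words" "combo d F = (\<lambda>_. 0)"
    then show "(\<Sum>w\<in>F. d w * v w) = 0" using h_combo[of F d] h0 by (simp add: v_def)
  qed
  then obtain \<sigma> where \<sigma>: "\<sigma> \<in> N" "\<And>w. w \<in> words \<Longrightarrow> \<Lambda> ty \<sigma> w = v w" by blast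
  show "\<exists>!a. a \<in> carrier (DQ.Q) \<and> (\<forall>b\<in>carrier (H2_massey Q n). pairing a b = f b)"
  proof (rule ex1I, intro conjI ballI)
    show "T #> \<sigma> \<in> carrier (DQ.Q)" using \<sigma> by (auto simp: carrier_DQ)
    fix b :: "('a set \<times> 'a set \<Rightarrow> 'm mod_ring) set" assume "b \<in> carrier (H2_massey Q n)"
    then obtain d F where b: "b = trg (combo d F)" "finite F" "F \<subseteq> words"
      by (auto simp: carrier_H2_massey combos_def)
    then have \<psi>: "combo d F \<in> combos" unfolding combos_def by blast
    have "d w * \<Lambda> ty \<sigma> w = d w * v w" if "w \<in> F" for w
      using that b(3) \<sigma>(2)[of w] by (metis subsetD)
    then have "(\<Sum>w\<in>F. d w * \<Lambda> ty \<sigma> w) = (\<Sum>w\<in>F. d w * v w)"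
      by (rule sum.cong[OF refl])
    then have "combo d F \<sigma> = (\<Sum>w\<in>F. d w * v w)"
      using \<sigma>(1) by (simp add: combo_def)
    also have "\<dots> = f b" using h_combo[OF b(2,3), of d] by (simp add: v_def h_def b(1))
    finally show "pairing (T #> \<sigma>) b = f b" unfolding b(1) pairing_eq[OF \<psi> \<sigma>(1)] .
  next
    fix a assume a: "a \<in> carrier (DQ.Q) \<and> (\<forall>b\<in>carrier (H2_massey Q n). pairing a b = f b)"
    then obtain \<tau> where \<tau>: "\<tau> \<in> N" "a = T #> \<tau>" by (auto simp: carrier_DQ)
    have "\<Lambda> ty \<tau> w = \<Lambda> ty \<sigma> w" if w: "w \<in> words" for w
    proof -
      have c: "combo (\<lambda>_. 1) {w} \<in> combos" using w unfolding combos_def by blast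
      then have "pairing a (trg (combo (\<lambda>_. 1) {w})) = v w"
        using a unfolding carrier_H2_massey v_def h_def by blast
      then show ?thesis
        unfolding \<tau>(2) pairing_eq[OF c \<tau>(1)] using \<tau>(1) \<sigma>(2)[OF w] by (simp add: combo_def)
    qed
    then show "a = T #> \<sigma>" unfolding \<tau>(2) coset_eq_iff[OF \<tau>(1) \<sigma>(1)] by blast
  qed
next
  fix g :: "'a set \<Rightarrow> 'm mod_ring"
  assume g: "g \<in> hom (DQ.Q) additive_Zmod"
    and g_cont: "locally_const (topol (DQ.Q)) g"
  \<comment> \<open>Pulled back to \<open>N\<close>, a continuous character of the quotient becomes
    a homomorphism that vanishes on \<open>N \<inter> T\<close>, hence a combination.\<close>
  define g' where "g' x = (if x \<in> N then g (T #> x) else 0)" for x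
  have g'_add: "g' (x \<otimes> y) = g' x + g' y" if "x \<in> N" "y \<in> N" for x y
  proof -
    have "T #> x \<in> carrier (DQ.Q)" "T #> y \<in> carrier (DQ.Q)"
      using that by (auto simp: carrier_DQ)
    then have "g ((T #> x) \<otimes>\<^bsub>DQ.Q\<^esub> (T #> y)) = g (T #> x) + g (T #> y)"
      using g unfolding hom_additive_Zmod_iff by blast
    moreover have "(T #> x) \<otimes>\<^bsub>DQ.Q\<^esub> (T #> y) = T #> (x \<otimes> y)"
      using DQ.mult_Q[of x y] that N_subset_NT by auto
    ultimately show ?thesis using that N_mult by (simp add: g'_def)
  qed
  have g'_combo: "g' \<in> combos"
  proof (rule invariant_hom_is_combo[folded T_def])
    show "g' (x \<otimes> y) = g' x + g' y" if "x \<in> N" "y \<in> N" for x y by (rule g'_add[OF that])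
    have "locally_const (topol D) (\<lambda>x. g (T #>\<^bsub>D\<^esub> x))"
      by (rule locally_const_compose[OF DQ.proj_continuous g_cont])
    then have "locally_const (subtopology (topol D) N) (\<lambda>x. g (T #> x))"
      by (intro continuous_map_from_subtopology) simp
    moreover have "subtopology (topol D) N = subtopology (topol S) N"
      using N_subset_NT by (simp add: subtopology_subtopology Int_absorb1)
    ultimately have "locally_const (subtopology (topol S) N) (\<lambda>x. g (T #> x))" by simp
    then show "locally_const (subtopology (topol S) N) g'"
      by (rule locally_const_cong) (simp add: g'_def)
    show "g' x = 0" if x: "x \<in> N" "x \<in> T" for x
    proof -
      have "g' (\<one> \<otimes> \<one>) = g' \<one> + g' \<one>" by (rule g'_add[OF N_one N_one])
      then have "g' \<one> = 0" by simp
      moreover have "T #> x = T #> \<one>"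
        using coset_join2[OF _ TQ.N_subgroup] x subgroup.one_closed[OF TQ.N_subgroup] by simp
      ultimately show ?thesis using x N_one by (simp add: g'_def)
    qed
  qed (simp_all add: g'_def)
  show "\<exists>!b. b \<in> carrier (H2_massey Q n) \<and> (\<forall>a\<in>carrier (DQ.Q). pairing a b = g a)"
  proof (rule ex1I, intro conjI ballI)
    show "trg g' \<in> carrier (H2_massey Q n)" unfolding carrier_H2_massey using g'_combo by blast
    fix a assume "a \<in> carrier (DQ.Q)"
    then obtain \<sigma> where \<sigma>: "\<sigma> \<in> N" "a = T #> \<sigma>" by (auto simp: carrier_DQ)
    show "pairing a (trg g') = g a"
      unfolding \<sigma>(2) pairing_eq[OF g'_combo \<sigma>(1)] using \<sigma>(1) by (simp add: g'_def)
  next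
    fix b :: "('a set \<times> 'a set \<Rightarrow> 'm mod_ring) set" assume b: "b \<in> carrier (H2_massey Q n) \<and> (\<forall>a\<in>carrier (DQ.Q). pairing a b = g a)"
    then obtain \<psi> where \<psi>: "\<psi> \<in> combos" "b = trg \<psi>" by (auto simp: carrier_H2_massey)
    have "\<psi> x = g' x" for x
    proof (cases "x \<in> N")
      case True
      then have "T #> x \<in> carrier (DQ.Q)" by (auto simp: carrier_DQ)
      then have "pairing (T #> x) b = g (T #> x)" using b by blast
      then show ?thesis unfolding \<psi>(2) pairing_eq[OF \<psi>(1) True] using True by (simp add: g'_def)
    next
      case False
      then show ?thesis using combos_invariant[OF \<psi>(1)] unfolding H1_inv_iff by (simp add: g'_def)
    qed
    then show "b = trg g'" unfolding \<psi>(2) by (intro arg_cong[where f = trg]) (rule ext)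
  qed
qed

section \<open>The kernel of inflation\<close>

lemma M_normal: "N \<inter> T \<lhd> S"
  by (rule normal_subgroup_intersect[OF normal T_normal])

sublocale MQ: top_quotient S "N \<inter> T"
  by (rule top_quotient.intro[OF top_grp_axioms top_quotient_axioms.intro[OF M_normal]])

lemma N_coset_of_M_coset: "x \<in> carrier S \<Longrightarrow> N <#> ((N \<inter> T) #> x) = N #> x"
proof (intro subset_antisym subsetI)
  fix y assume x: "x \<in> carrier S" and "y \<in> N <#> ((N \<inter> T) #> x)"
  then obtain \<nu> \<mu> where e: "\<nu> \<in> N" "\<mu> \<in> N \<inter> T" "y = \<nu> \<otimes> (\<mu> \<otimes> x)"
    unfolding set_mult_def r_coset_def by blast
  then have "y = (\<nu> \<otimes> \<mu>) \<otimes> x" using x by (simp add: m_assoc)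
  then show "y \<in> N #> x" unfolding r_coset_def using N_mult e by blast
next
  fix y assume x: "x \<in> carrier S" and "y \<in> N #> x"
  then obtain \<nu> where e: "\<nu> \<in> N" "y = \<nu> \<otimes> x" unfolding r_coset_def by blast
  then have "y = \<nu> \<otimes> (\<one> \<otimes> x)" using x by simp
  moreover have "\<one> \<in> N \<inter> T" using N_one subgroup.one_closed[OF TQ.N_subgroup] by blast
  ultimately show "y \<in> N <#> ((N \<inter> T) #> x)" unfolding set_mult_def r_coset_def using e(1) by blast
qed

lemma top_hom_inflation: "top_hom (quotient_group S (N \<inter> T)) Q (\<lambda>C. N <#> C)"
proof unfold_locales
  show "(\<lambda>C. N <#> C) \<in> hom (quotient_group S (N \<inter> T)) Q"
  proof (rule homI)
    fix p assume "p \<in> carrier (quotient_group S (N \<inter> T))"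
    then obtain x where x: "x \<in> carrier S" "p = (N \<inter> T) #> x" by (auto simp: MQ.carrier_Q)
    show "N <#> p \<in> carrier Q" unfolding x(2) N_coset_of_M_coset[OF x(1)] by (rule proj_closed[OF x(1)])
    fix q assume "q \<in> carrier (quotient_group S (N \<inter> T))"
    then obtain y where y: "y \<in> carrier S" "q = (N \<inter> T) #> y" by (auto simp: MQ.carrier_Q)
    show "N <#> (p \<otimes>\<^bsub>quotient_group S (N \<inter> T)\<^esub> q) = (N <#> p) \<otimes>\<^bsub>Q\<^esub> (N <#> q)"
      unfolding x(2) y(2) MQ.mult_Q[OF x(1) y(1)] N_coset_of_M_coset[OF x(1)] N_coset_of_M_coset[OF y(1)]
        N_coset_of_M_coset[OF m_closed[OF x(1) y(1)]] mult_Q[OF x(1) y(1)] ..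
  qed
  show "continuous_map (topol (quotient_group S (N \<inter> T))) (topol Q) (\<lambda>C. N <#> C)"
    by (rule MQ.continuous_from_Q, rule continuous_map_eq[OF proj_continuous]) (simp add: N_coset_of_M_coset)
qed

text \<open>If the inflated class is trivial, \<open>y\<close> differs from a pulled back cochain by
  a homomorphism on \<open>S\<close>, which vanishes on \<open>N\<close>; so \<psi> is constant on
  \<open>N \<inter> T\<close> and equals its value 0 at \<one>. Conversely, the combination on
  \<open>S\<close> is invariant under \<open>N \<inter> T\<close> and descends to a cochain that
  trivialises the inflated class.\<close>

lemma inflation_kernel:
  assumes \<psi>: "\<psi> \<in> H1N"
  shows "inflation S N (N \<inter> T) (trg \<psi>) = \<one>\<^bsub>H2 (quotient_group S (N \<inter> T))\<^esub> \<longleftrightarrow> \<psi> \<in> combos"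
proof -
  let ?QM = "quotient_group S (N \<inter> T)"
  interpret inf: top_hom ?QM Q "\<lambda>C. N <#> C" by (rule top_hom_inflation)
  have pull: "pullback2 S MQ.proj (pullback2 ?QM (\<lambda>C. N <#> C) z) = pullback2 S proj z"
    for z :: "'a set \<times> 'a set \<Rightarrow> 'm mod_ring"
    by (rule ext_on_pairs[of "carrier S"])
      (simp_all add: pullback2_outside pullback2_apply MQ.proj_closed N_coset_of_M_coset)
  show ?thesis
  proof
    assume triv: "inflation S N (N \<inter> T) (trg \<psi>) = \<one>\<^bsub>H2 ?QM\<^esub>"
    obtain y z where y: "y \<in> cochains1 S" "z \<in> carrier (Z2 Q)" "\<And>x. x \<in> N \<Longrightarrow> y x = \<psi> x" "coboundary S y = pullback2 S proj z"
      and trg: "trg \<psi> = H2_class Q z"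
      using transgression_witness[OF \<psi>] by blast
    from trg have "H2_class ?QM (pullback2 ?QM (\<lambda>C. N <#> C) z) = H2_class ?QM (\<lambda>p. 0)"
      using triv unfolding inflation_def by (simp add: inf.H2_map_class MQ.Q.H2_one)
    then obtain v where v: "v \<in> cochains1 ?QM" "\<And>p. pullback2 ?QM (\<lambda>C. N <#> C) z p = 0 + coboundary ?QM v p"
      using MQ.Q.H2_class_eqD by blast
    have "pullback2 ?QM (\<lambda>C. N <#> C) z = coboundary ?QM v" using v(2) by (simp add: fun_eq_iff)
    then have dy: "coboundary S y = coboundary S (pullback1 S MQ.proj v)"
      unfolding MQ.proj.coboundary_pullback1 y(4) by (simp only: pull[symmetric])
    define u where "u x = y x - pullback1 S MQ.proj v x" for x
    have u: "u \<in> cochains1 S" unfolding u_def[abs_def] by (rule cochains1_diff[OF y(1) MQ.proj.pullback1_cochain[OF v(1)]])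
    have "coboundary S u = (\<lambda>p. 0)" unfolding u_def[abs_def] coboundary_diff dy by simp
    then have u0: "u x = 0" if "x \<in> N" for x using hom_vanishes_on_N[OF u _ that] by blast
    have yv: "\<psi> x = v (MQ.proj x)" if "x \<in> N" for x
      using u0[OF that] y(3)[OF that] that by (simp add: u_def pullback1_apply)
    show "\<psi> \<in> combos"
    proof (rule invariant_hom_is_combo[folded T_def])
      show "locally_const (subtopology (topol S) N) \<psi>" using \<psi> unfolding H1_inv_iff by blast
      show "\<psi> (x \<otimes> y) = \<psi> x + \<psi> y" if "x \<in> N" "y \<in> N" for x y using \<psi> that unfolding H1_inv_iff by blast
      show "\<psi> x = 0" if "x \<notin> N" for x using \<psi> that unfolding H1_inv_iff by blast
      show "\<psi> x = 0" if x: "x \<in> N" "x \<in> T" for x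
      proof -
        have "MQ.proj x = MQ.proj \<one>"
          using coset_join2[OF _ MQ.N_subgroup] x subgroup.one_closed[OF MQ.N_subgroup] by simp
        then have "\<psi> x = \<psi> \<one>" by (simp only: yv[OF x(1)] yv[OF N_one])
        then show ?thesis using H1N_one[OF \<psi>] by simp
      qed
    qed
  next
    assume "\<psi> \<in> combos"
    then obtain d F where dF: "\<psi> = combo d F" "F \<subseteq> words" unfolding combos_def by blast
    obtain z where z: "z \<in> cochains2 Q" "pullback2 S proj z = coboundary S (combo_ext d F)"
      using combo_ext_witness[OF dF(2)] by blast
    have "trg \<psi> = H2_class Q z"
      by (rule transgression_eqI[OF combo_ext_cochain z(2)[symmetric] z(1)]) (simp add: dF(1) combo_ext_eq_combo)
    then have inf: "inflation S N (N \<inter> T) (trg \<psi>) = H2_class ?QM (pullback2 ?QM (\<lambda>C. N <#> C) z)"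
      unfolding inflation_def by (simp add: inf.H2_map_class)
    have "\<exists>v\<in>cochains1 ?QM. \<forall>x\<in>carrier S. v (MQ.proj x) = combo_ext d F x"
    proof (rule MQ.descend1)
      show "locally_const (topol S) (combo_ext d F)" using combo_ext_cochain by (simp add: cochains1_iff)
      show "combo_ext d F (x \<otimes> t) = combo_ext d F x" if "x \<in> carrier S" "t \<in> N \<inter> T" for x t
        using combo_ext_mult_T[OF dF(2) that(1)] that(2) by blast
    qed
    then obtain v where v: "v \<in> cochains1 ?QM" "\<And>x. x \<in> carrier S \<Longrightarrow> v (MQ.proj x) = combo_ext d F x" by blast
    have "pullback1 S MQ.proj v = combo_ext d F"
      by (rule ext) (simp add: pullback1_def v(2) combo_ext_def)
    then have "pullback2 ?QM (\<lambda>C. N <#> C) z = coboundary ?QM v"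
      using inf.pullback2_cochain[OF z(1)] MQ.Q.coboundary_in_Z2[OF v(1)]
      by (intro MQ.pullback2_inject)
        (simp_all add: carrier_Z2_iff pull z(2) MQ.proj.coboundary_pullback1[symmetric])
    then show "inflation S N (N \<inter> T) (trg \<psi>) = \<one>\<^bsub>H2 ?QM\<^esub>"
      unfolding inf MQ.Q.H2_one by (intro MQ.Q.H2_class_eqI[OF v(1)]) simp
  qed
qed

text \<open>Transgression is onto, so \<open>inflation_kernel\<close> describes every class killed
  by inflation. The one-element group on the left expresses that the inclusion is injective.\<close>

lemma exact_inflation:
  "exact_seq
    ([H2 (quotient_group S (N \<inter> T)), H2 Q, H2_massey Q n, singleton_group \<one>\<^bsub>H2 Q\<^esub>],
     [inflation S N (N \<inter> T) :: ('a set \<times> 'a set \<Rightarrow> 'm mod_ring) set \<Rightarrow> ('a set \<times> 'a set \<Rightarrow> 'm mod_ring) set, id, id])"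
proof -
  interpret H: group "H2 Q :: ('a set \<times> 'a set \<Rightarrow> 'm mod_ring) set monoid" by (rule Q.group_H2)
  interpret inf: top_hom "quotient_group S (N \<inter> T)" Q "\<lambda>C. N <#> C" by (rule top_hom_inflation)
  have massey: "(H2_massey Q n :: ('a set \<times> 'a set \<Rightarrow> 'm mod_ring) set monoid) = H2 Q\<lparr>carrier := trg ` combos\<rparr>"
    using carrier_H2_massey by (simp add: H2_massey_def)
  have group_massey: "group (H2_massey Q n :: ('a set \<times> 'a set \<Rightarrow> 'm mod_ring) set monoid)"
    unfolding massey by (rule subgroup.subgroup_is_group[OF trg_combos_subgroup Q.group_H2])
  have one: "\<one>\<^bsub>H2 Q\<^esub> \<in> trg ` combos" by (rule subgroup.one_closed[OF trg_combos_subgroup])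
  have sub: "trg ` combos \<subseteq> carrier (H2 Q)" by (rule subgroup.subset[OF trg_combos_subgroup])
  have "kernel (H2 Q) (H2 (quotient_group S (N \<inter> T)))
      (inflation S N (N \<inter> T) :: ('a set \<times> 'a set \<Rightarrow> 'm mod_ring) set \<Rightarrow> ('a set \<times> 'a set \<Rightarrow> 'm mod_ring) set) = trg ` combos"
  proof (intro subset_antisym subsetI)
    fix \<alpha> :: "('a set \<times> 'a set \<Rightarrow> 'm mod_ring) set" assume "\<alpha> \<in> kernel (H2 Q) (H2 (quotient_group S (N \<inter> T))) (inflation S N (N \<inter> T))"
    then have \<alpha>: "\<alpha> \<in> carrier (H2 Q)" "inflation S N (N \<inter> T) \<alpha> = \<one>\<^bsub>H2 (quotient_group S (N \<inter> T))\<^esub>"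
      by (auto simp: kernel_def)
    obtain \<psi> where "\<psi> \<in> H1N" "trg \<psi> = \<alpha>" using transgression_surj[OF \<alpha>(1)] by blast
    then show "\<alpha> \<in> trg ` combos" using inflation_kernel[of \<psi>] \<alpha>(2) by blast
  next
    fix \<alpha> :: "('a set \<times> 'a set \<Rightarrow> 'm mod_ring) set" assume "\<alpha> \<in> trg ` combos"
    then obtain \<psi> where \<psi>: "\<psi> \<in> combos" "\<alpha> = trg \<psi>" by blast
    then show "\<alpha> \<in> kernel (H2 Q) (H2 (quotient_group S (N \<inter> T))) (inflation S N (N \<inter> T))"
      using inflation_kernel[OF combos_invariant[OF \<psi>(1)]] transgression_closed[OF combos_invariant[OF \<psi>(1)]]
      by (simp add: kernel_def)
  qed
  moreover have "inflation S N (N \<inter> T) \<in> hom (H2 Q) (H2 (quotient_group S (N \<inter> T)) :: ('a set \<times> 'a set \<Rightarrow> 'm mod_ring) set monoid)"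
    unfolding inflation_def by (rule inf.H2_map_hom)
  moreover have "group_hom (singleton_group \<one>\<^bsub>H2 Q\<^esub>) (H2_massey Q n) (id :: ('a set \<times> 'a set \<Rightarrow> 'm mod_ring) set \<Rightarrow> _)"
    unfolding group_hom_def group_hom_axioms_def
  proof (intro conjI group_massey)
    show "id \<in> hom (singleton_group \<one>\<^bsub>H2 Q\<^esub>) (H2_massey Q n :: ('a set \<times> 'a set \<Rightarrow> 'm mod_ring) set monoid)"
      by (rule homI) (simp_all add: massey one singleton_group_def)
  qed simp
  moreover have "id \<in> hom (H2_massey Q n) (H2 Q :: ('a set \<times> 'a set \<Rightarrow> 'm mod_ring) set monoid)"
    by (rule homI) (use sub in \<open>auto simp: massey\<close>)
  moreover have "kernel (H2_massey Q n) (H2 Q) id = {\<one>\<^bsub>H2 Q\<^esub> :: ('a set \<times> 'a set \<Rightarrow> 'm mod_ring) set}"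
    using one by (auto simp: kernel_def massey)
  ultimately show ?thesis
    using MQ.Q.group_H2 Q.group_H2 by (simp add: carrier_H2_massey)
qed

end

theorem theorem10p1:
  fixes S :: "'a top_group" and A N :: "'a set" and n :: nat
  assumes "n \<ge> 2"
    and "free_profinite_group A S"
    and "N \<lhd> S"
    and "closedin (topol S) N"
    and "N \<subseteq> magnus_filtration TYPE('m::nontriv) A S n"
  shows "(\<exists>P :: 'a set \<Rightarrow> ('a set \<times> 'a set \<Rightarrow> 'm mod_ring) set \<Rightarrow> 'm mod_ring.
      perfect_pairing
        (quotient_group
          (top_subgroup S (N <#>\<^bsub>S\<^esub> magnus_filtration TYPE('m) A S (n + 1)))
          (magnus_filtration TYPE('m) A S (n + 1)))
        (H2_massey (quotient_group S N) n) P \<and>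
      (\<forall>\<sigma>\<in>N. \<forall>\<alpha>\<in>carrier (H2_massey (quotient_group S N) n).
        P (magnus_filtration TYPE('m) A S (n + 1) #>\<^bsub>S\<^esub> \<sigma>) \<alpha> =
        trg_pairing S N (power_commutator_subgroup CARD('m) S N #>\<^bsub>S\<^esub> \<sigma>) \<alpha>))
    \<and> exact_seq
        ([H2 (quotient_group S (N \<inter> magnus_filtration TYPE('m) A S (n + 1))),
          H2 (quotient_group S N),
          H2_massey (quotient_group S N) n,
          singleton_group \<one>\<^bsub>H2 (quotient_group S N)\<^esub>],
         [inflation S N (N \<inter> magnus_filtration TYPE('m) A S (n + 1)) ::
            ('a set \<times> 'a set \<Rightarrow> 'm mod_ring) set \<Rightarrow> ('a set \<times> 'a set \<Rightarrow> 'm mod_ring) set,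
          id, id])"
proof -
  have "profinite_group S" using assms(2) by (simp add: free_profinite_group_def)
  then have "topological_group S" by (simp add: profinite_group_def)
  \<comment> \<open>The filtration decreases and n \<ge> 2.\<close>
  moreover have "N \<subseteq> magnus_filtration TYPE('m) A S 2"
    using assms(1,5) unfolding magnus_filtration_def by fastforce
  ultimately interpret massey_setup A S N "TYPE('m)" n
    using assms
    by (intro massey_setup.intro closed_transgression_setup.intro transgression_setup.intro free_profinite.intro
        top_quotient.intro top_grp.intro massey_setup_axioms.intro closed_transgression_setup_axioms.intro
        transgression_setup_axioms.intro top_quotient_axioms.intro)
  show ?thesis
    unfolding T_def[symmetric]
  proof (intro conjI exI[of _ pairing] ballI)
    show "perfect_pairing (DQ.Q) (H2_massey Q n) pairing"
      by (rule perfect_pairing_massey)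
    show "pairing (T #>\<^bsub>S\<^esub> \<sigma>) \<alpha> = trg_pairing S N (power_commutator_subgroup CARD('m) S N #>\<^bsub>S\<^esub> \<sigma>) \<alpha>"
      if \<sigma>: "\<sigma> \<in> N" and \<alpha>: "\<alpha> \<in> carrier (H2_massey Q n)" for \<sigma> \<alpha>
    proof -
      obtain \<psi> where \<psi>: "\<psi> \<in> combos" "\<alpha> = trg \<psi>" using \<alpha> by (auto simp: carrier_H2_massey)
      show ?thesis unfolding \<psi>(2) pairing_eq[OF \<psi>(1) \<sigma>] trg_pairing_eq[OF combos_invariant[OF \<psi>(1)] \<sigma>] ..
    qed
  qed (rule exact_inflation)
qed

end
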